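(* There is a randomized algorithm for Partial Grundy Coloring on $d$-degenerate graphs running in time $\mathcal{O}\big((k(d+1))^{2k^2+k}\cdot(m+n)\big)$, where $n$ and $m$ are the numbers of vertices and edges of the input graph $G$, such that if $(G,k)$ is a no-instance the algorithm outputs No with probability $1$, and if $(G,k)$ is a yes-instance it outputs Yes with probability at least $2/3$.
   Context: A graph is $d$-degenerate if every subgraph has a vertex of degree at most $d$. Partial Grundy Coloring: given a graph $G$ and a positive integer $k$, decide whether $G$ admits a partial Grundy coloring using at least $k$ colors, i.e., for some $k'\ge k$ a proper coloring $c:V(G)\to[k']$ such that for every $i\in[k']$ there is a vertex $v$ with $c(v)=i$ which, for every $j\in[i-1]$, has a neighbor $u$ with $c(u)=j$. *)

theory Defs
  imports "HOL-Probability.Probability"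
begin

section \<open>Graphs and partial Grundy colorings\<close>

record 'a graph =
  verts :: "'a set"
  edges :: "'a set set"

definition simple_graph :: "'a graph \<Rightarrow> bool" where
  "simple_graph G \<longleftrightarrow> finite (verts G) \<and> (\<forall>e\<in>edges G. e \<subseteq> verts G \<and> card e = 2)"

definition subgraph :: "'a graph \<Rightarrow> 'a graph \<Rightarrow> bool" where
  "subgraph H G \<longleftrightarrow> simple_graph H \<and> verts H \<subseteq> verts G \<and> edges H \<subseteq> edges G"

definition degree :: "'a graph \<Rightarrow> 'a \<Rightarrow> nat" where
  "degree G v = card {e \<in> edges G. v \<in> e}"

definition degenerate :: "nat \<Rightarrow> 'a graph \<Rightarrow> bool" where
  "degenerate d G \<longleftrightarrow>
     (\<forall>H. subgraph H G \<and> verts H \<noteq> {} \<longrightarrow> (\<exists>v\<in>verts H. degree H v \<le> d))"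

definition proper_coloring :: "'a graph \<Rightarrow> nat \<Rightarrow> ('a \<Rightarrow> nat) \<Rightarrow> bool" where
  "proper_coloring G k c \<longleftrightarrow>
     (\<forall>v\<in>verts G. c v \<in> {1..k}) \<and> (\<forall>u v. {u, v} \<in> edges G \<longrightarrow> c u \<noteq> c v)"

definition partial_grundy_coloring :: "'a graph \<Rightarrow> nat \<Rightarrow> ('a \<Rightarrow> nat) \<Rightarrow> bool" where
  "partial_grundy_coloring G k c \<longleftrightarrow> proper_coloring G k c \<and>
     (\<forall>i\<in>{1..k}. \<exists>v\<in>verts G. c v = i \<and>
        (\<forall>j\<in>{1..<i}. \<exists>u\<in>verts G. {u, v} \<in> edges G \<and> c u = j))"

definition PGC_yes_instance :: "'a graph \<Rightarrow> nat \<Rightarrow> bool" where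
  "PGC_yes_instance G k \<longleftrightarrow> (\<exists>k'\<ge>k. \<exists>c. partial_grundy_coloring G k' c)"

section \<open>Randomized word RAM\<close>

text \<open>
  Registers and memory cells hold \<open>w\<close>-bit words, i.e. numbers below \<open>2 ^ w\<close>. Instruction operands
  are register indices, except for the number in \<open>Const\<close>, the jump target in \<open>Jless\<close> and the answer
  in \<open>Halt\<close>. Addition and multiplication wrap around; subtraction is cut off at 0.
  \<open>Load\<close> and \<open>Store\<close> take the memory address from a register (indirect addressing).
  \<open>Rand a b\<close> puts into register \<open>a\<close> a fresh uniformly distributed number less than the content of
  \<open>b\<close> (and 0 if \<open>b\<close> contains 0). Every instruction takes one unit of time.
\<close>

datatype instr =
    Const nat nat
  | Add nat nat nat
  | Sub nat nat nat
  | Mul nat nat nat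
  | Load nat nat
  | Store nat nat
  | Rand nat nat
  | Jless nat nat nat
  | Halt bool

datatype config =
    Running (pc: nat) (regs: "nat \<Rightarrow> nat") (mem: "nat \<Rightarrow> nat")
  | Halted (answer: bool)

fun exec :: "nat \<Rightarrow> instr \<Rightarrow> nat \<Rightarrow> (nat \<Rightarrow> nat) \<Rightarrow> (nat \<Rightarrow> nat) \<Rightarrow> config pmf" where
  "exec w (Const a x) p r m = return_pmf (Running (Suc p) (r(a := x mod 2 ^ w)) m)"
| "exec w (Add a b c) p r m = return_pmf (Running (Suc p) (r(a := (r b + r c) mod 2 ^ w)) m)"
| "exec w (Sub a b c) p r m = return_pmf (Running (Suc p) (r(a := r b - r c)) m)"
| "exec w (Mul a b c) p r m = return_pmf (Running (Suc p) (r(a := (r b * r c) mod 2 ^ w)) m)"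
| "exec w (Load a b) p r m = return_pmf (Running (Suc p) (r(a := m (r b))) m)"
| "exec w (Store a b) p r m = return_pmf (Running (Suc p) r (m(r a := r b)))"
| "exec w (Rand a b) p r m =
     map_pmf (\<lambda>x. Running (Suc p) (r(a := x)) m) (pmf_of_set {..<max 1 (r b)})"
| "exec w (Jless a b l) p r m = return_pmf (Running (if r a < r b then l else Suc p) r m)"
| "exec w (Halt ans) p r m = return_pmf (Halted ans)"

text \<open>A machine whose program counter leaves the program is stuck and never halts.\<close>

fun step :: "nat \<Rightarrow> instr list \<Rightarrow> config \<Rightarrow> config pmf" where
  "step w P (Running p r m) =
     (if p < length P then exec w (P ! p) p r m else return_pmf (Running p r m))"
| "step w P (Halted ans) = return_pmf (Halted ans)"

primrec run :: "nat \<Rightarrow> instr list \<Rightarrow> nat \<Rightarrow> config \<Rightarrow> config pmf" where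
  "run w P 0 s = return_pmf s"
| "run w P (Suc t) s = bind_pmf (step w P s) (run w P t)"

definition start :: "nat list \<Rightarrow> config" where
  "start xs = Running 0 (\<lambda>_. 0) (\<lambda>i. if i < length xs then xs ! i else 0)"

text \<open>Worst-case running time: the bound holds for every outcome of the random choices.\<close>

definition halts_within :: "nat \<Rightarrow> instr list \<Rightarrow> nat list \<Rightarrow> nat \<Rightarrow> bool" where
  "halts_within w P xs t \<longleftrightarrow> (\<forall>s\<in>set_pmf (run w P t (start xs)). \<exists>ans. s = Halted ans)"

definition prob_answer :: "nat \<Rightarrow> instr list \<Rightarrow> nat list \<Rightarrow> nat \<Rightarrow> bool \<Rightarrow> real" where
  "prob_answer w P xs t ans = measure_pmf.prob (run w P t (start xs)) {Halted ans}"

section \<open>Input representation\<close>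

text \<open>The neighbors of a vertex may be listed in any order.\<close>

definition adjacency_lists :: "nat graph \<Rightarrow> nat list list \<Rightarrow> bool" where
  "adjacency_lists G adj \<longleftrightarrow> verts G = {..<length adj} \<and>
     (\<forall>v<length adj. distinct (adj ! v) \<and> set (adj ! v) = {u. {v, u} \<in> edges G})"

text \<open>Each adjacency list is preceded by its length; the input occupies \<open>2 + n + 2 * m\<close> words.\<close>

definition encode_instance :: "nat list list \<Rightarrow> nat \<Rightarrow> nat list" where
  "encode_instance adj k = k # length adj # concat (map (\<lambda>us. length us # us) adj)"

end

theory Submission
  imports Defs
begin

text \<open>
  First-fit turns any \<^emph>\<open>witness\<close>, i.e. a properly colored set \<open>W\<close> of vertices that contains for each
  color \<open>i < k\<close> a vertex of color \<open>i\<close> with neighbors in \<open>W\<close> of all smaller colors, into a partial Grundy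
  coloring with at least \<open>k\<close> colors. Conversely every such coloring contains a witness with at most
  \<open>k (k + 1) / 2\<close> vertices.

  To find a witness, order the vertices by peeling off vertices of small degree; then each vertex has
  less than \<open>D\<close> neighbors after it, for some \<open>D \<le> d + 1\<close> that is found by trying \<open>D = 1, 2, \<dots>\<close>. In one trial,
  go through the vertices from last to first and draw a number \<open>x < k * D\<close> for each: if \<open>x < k\<close> and no
  neighbor is in class \<open>x\<close> yet, the vertex joins class \<open>x\<close>. The classes are always independent, so it is
  sound to answer Yes if they form a witness. A fixed small witness \<open>W\<close> survives if its vertices draw
  their own colors and the later neighbors of \<open>W\<close> outside \<open>W\<close> draw a number \<open>\<ge> k\<close>. By Bernoulli's
  inequality the latter costs at most a factor \<open>1 / D\<close> for each vertex of \<open>W\<close>, so that a trial succeeds with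
  probability at least \<open>(k * D) ^ - (k\<^sup>2 + k)\<close>, and \<open>(k * D) ^ (2 * k\<^sup>2)\<close> trials suffice. This number does not fit
  into a word; the trials are counted in base \<open>k * D\<close> with \<open>2 * k\<^sup>2\<close> digits in memory.
\<close>

section \<open>A structured language on top of the machine\<close>

text \<open>The direction of sampling limits the price of a witness vertex. When it is drawn, its
  fewer than \<open>D\<close> later neighbors are settled and only they can spoil it; its earlier
  neighbors, possibly very many, are drawn afterwards and have to give way. The range
  \<open>k * D\<close> is chosen so that a draw leaves a vertex unclassified with probability
  \<open>1 - 1/D\<close>. The machine is not given \<open>d\<close>. A peeling round that gets stuck
  exhibits an induced subgraph of minimum degree at least \<open>D\<close>, which forces
  \<open>D <= d\<close>, so \<open>D\<close> never grows beyond \<open>d + 1\<close>. In the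
  exponent \<open>2 * k^2 + k\<close>, the first summand counts trials. The second absorbs the
  factor \<open>k^2\<close> in the cost of a single trial, since \<open>k^2 <= 2 * 2^k\<close>. The
  obstacle is to obtain time and probability bounds for a concrete machine. No independence of
  events is ever stated: the Yes-probability still owed travels backwards through the code like the
  remaining time, and each random draw merely averages it. Hence the success probability of a trial
  arises as a product along the sampling loop, and the amplification by induction on the trials
  left.\<close>

text \<open>
  \<open>ok\<close> collects the worst-case time \<open>t\<close>, soundness (Yes only if \<open>Y\<close>) and a lower bound \<open>q\<close> on the probability
  of Yes, so that one backward analysis of the program proves all three claims.
\<close>

definition ok :: "nat \<Rightarrow> bool \<Rightarrow> instr list \<Rightarrow> nat \<Rightarrow> real \<Rightarrow> config \<Rightarrow> bool" where
  "ok w Y P t q s \<longleftrightarrow> (\<forall>s'\<in>set_pmf (run w P t s). \<exists>b. s' = Halted b \<and> (b \<longrightarrow> Y)) \<and>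
     q \<le> pmf (run w P t s) (Halted True)"

lemma run_add: "run w P (t + u) s = bind_pmf (run w P t s) (run w P u)"
  by (induction t arbitrary: s) (simp_all add: bind_return_pmf bind_assoc_pmf cong: bind_pmf_cong)

lemma run_Halted [simp]: "run w P t (Halted b) = return_pmf (Halted b)"
  by (induction t) (simp_all add: bind_return_pmf)

text \<open>Halted configurations are fixed by \<open>step\<close>, so once every outcome has
  halted, further steps leave the distribution unchanged. This makes \<open>t\<close> an upper bound
  that may be relaxed.\<close>

lemma ok_mono:
  assumes "ok w Y P t q s" "t \<le> t'" "q' \<le> q"
  shows "ok w Y P t' q' s"
proof -
  have h: "\<forall>s'\<in>set_pmf (run w P t s). \<exists>b. s' = Halted b" using assms(1) unfolding ok_def by blast
  have "run w P t' s = bind_pmf (run w P t s) (run w P (t' - t))"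
    using assms(2) run_add[of w P t "t' - t" s] by simp
  also have "\<dots> = bind_pmf (run w P t s) return_pmf"
    using h by (intro bind_pmf_cong) auto
  finally have "run w P t' s = run w P t s" by (simp add: bind_return_pmf')
  then show ?thesis using assms unfolding ok_def by simp
qed

lemma ok_step:
  assumes "step w P s = return_pmf s'" "ok w Y P t q s'"
  shows "ok w Y P (Suc t) q s"
  using assms unfolding ok_def by (simp add: bind_return_pmf)

lemma ok_Halted: "(b \<longrightarrow> Y) \<Longrightarrow> q \<le> (if b then 1 else 0) \<Longrightarrow> ok w Y P t q (Halted b)"
  unfolding ok_def by (cases b) (auto simp: indicator_def)

text \<open>The only place where randomness enters: the bound \<open>g x\<close> demanded after a
  draw may depend on the drawn \<open>x\<close>, and the average of \<open>g\<close> is what is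
  guaranteed before it.\<close>

lemma ok_rand:
  assumes "step w P s = map_pmf f (pmf_of_set {..<B})" "0 < B"
    and "\<And>x. x < B \<Longrightarrow> ok w Y P t (g x) (f x)"
    and "q \<le> (\<Sum>x<B. g x) / real B"
  shows "ok w Y P (Suc t) q s"
proof -
  have ne: "{..<B} \<noteq> {}" "finite {..<B}" using assms(2) by auto
  have r: "run w P (Suc t) s = bind_pmf (pmf_of_set {..<B}) (\<lambda>x. run w P t (f x))"
    using assms(1) by (simp add: bind_map_pmf)
  have "pmf (run w P (Suc t) s) (Halted True) = (\<Sum>x<B. pmf (run w P t (f x)) (Halted True)) / real B"
    unfolding r pmf_bind using ne by (subst integral_pmf_of_set) auto
  moreover have "(\<Sum>x<B. g x) \<le> (\<Sum>x<B. pmf (run w P t (f x)) (Halted True))"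
    using assms(3) unfolding ok_def by (intro sum_mono) auto
  ultimately have "q \<le> pmf (run w P (Suc t) s) (Halted True)"
    using assms(4) divide_right_mono[of "\<Sum>x<B. g x" _ "real B"] by fastforce
  moreover have "\<forall>s'\<in>set_pmf (run w P (Suc t) s). \<exists>b. s' = Halted b \<and> (b \<longrightarrow> Y)"
    unfolding r using assms(3) ne unfolding ok_def by (auto simp: set_pmf_of_set)
  ultimately show ?thesis unfolding ok_def by blast
qed

text \<open>
  \<open>IfLess a b\<close> and \<open>WhileLess a b\<close> test whether register \<open>a\<close> is less than register \<open>b\<close>. \<open>Block\<close> has no effect on
  the code; it only keeps \<open>vc\<close> below from unfolding a program part that has its own specification.
  The machine has no unconditional jump: \<open>Jless 0 1\<close> serves as one while register 0 contains 0 and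
  register 1 contains 1.
\<close>

datatype com =
    Skip
  | Ins instr
  | Seq com com (infixr ";;" 60)
  | IfLess nat nat com com
  | WhileLess nat nat com
  | Block com

primrec csize :: "com \<Rightarrow> nat" where
  "csize Skip = 0"
| "csize (Ins i) = 1"
| "csize (c1 ;; c2) = csize c1 + csize c2"
| "csize (IfLess a b c1 c2) = csize c1 + csize c2 + 2"
| "csize (WhileLess a b c) = csize c + 3"
| "csize (Block c) = csize c"

text \<open>Jump targets are absolute, hence the position argument. The else branch precedes the
  then branch, so only the else branch ends with an unconditional jump.\<close>

primrec compile :: "com \<Rightarrow> nat \<Rightarrow> instr list" where
  "compile Skip p = []"
| "compile (Ins i) p = [i]"
| "compile (c1 ;; c2) p = compile c1 p @ compile c2 (p + csize c1)"
| "compile (IfLess a b c1 c2) p =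
     [Jless a b (p + 2 + csize c2)] @ compile c2 (p + 1) @
     [Jless 0 1 (p + 2 + csize c2 + csize c1)] @ compile c1 (p + 2 + csize c2)"
| "compile (WhileLess a b c) p =
     [Jless a b (p + 2), Jless 0 1 (p + 3 + csize c)] @ compile c (p + 2) @ [Jless 0 1 p]"
| "compile (Block c) p = compile c p"

lemma length_compile [simp]: "length (compile c p) = csize c"
  by (induction c arbitrary: p) auto

section \<open>Weakest preconditions for position-independent code\<close>

definition code_at :: "instr list \<Rightarrow> nat \<Rightarrow> instr list \<Rightarrow> bool" where
  "code_at P p xs \<longleftrightarrow> p + length xs \<le> length P \<and> (\<forall>i<length xs. P ! (p + i) = xs ! i)"

lemma code_at_append: "code_at P p (xs @ ys) \<longleftrightarrow> code_at P p xs \<and> code_at P (p + length xs) ys"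
proof -
  have "(\<forall>i<length xs + length ys. P ! (p + i) = (xs @ ys) ! i) \<longleftrightarrow>
    (\<forall>i<length xs. P ! (p + i) = xs ! i) \<and> (\<forall>i<length ys. P ! (p + length xs + i) = ys ! i)"
    (is "?A \<longleftrightarrow> ?B \<and> ?C")
  proof
    assume A: ?A
    have ?B using A by (auto simp: nth_append)
    moreover have ?C
    proof (intro allI impI)
      fix i assume "i < length ys"
      then show "P ! (p + length xs + i) = ys ! i"
        using A[rule_format, of "length xs + i"] by (simp add: nth_append add.assoc)
    qed
    ultimately show "?B \<and> ?C" by blast
  next
    assume BC: "?B \<and> ?C"
    show ?A
    proof (intro allI impI)
      fix i assume i: "i < length xs + length ys"
      show "P ! (p + i) = (xs @ ys) ! i"
      proof (cases "i < length xs")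
        case True then show ?thesis using BC by (auto simp: nth_append)
      next
        case False
        then show ?thesis using BC i conjunct2[OF BC, rule_format, of "i - length xs"]
          by (auto simp: nth_append)
      qed
    qed
  qed
  then show ?thesis unfolding code_at_def by auto
qed

lemma code_at_Cons: "code_at P p (x # xs) \<longleftrightarrow> p < length P \<and> P ! p = x \<and> code_at P (Suc p) xs"
  using code_at_append[of P p "[x]" xs] by (auto simp: code_at_def)

type_synonym cont = "nat \<Rightarrow> real \<Rightarrow> (nat \<Rightarrow> nat) \<Rightarrow> (nat \<Rightarrow> nat) \<Rightarrow> bool"

text \<open>A predicate transformer in continuation style. The continuation sees, besides the state,
  the time \<open>t\<close> still available and the Yes-probability \<open>q\<close> still owed. A
  \<open>Halt\<close> inside \<open>c\<close> can satisfy it without ever reaching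
  \<open>K\<close>.\<close>

definition wp :: "nat \<Rightarrow> bool \<Rightarrow> com \<Rightarrow> cont \<Rightarrow> cont" where
  "wp w Y c K t q r m \<longleftrightarrow> (\<forall>P p. code_at P p (compile c p) \<longrightarrow>
     (\<forall>t q r m. K t q r m \<longrightarrow> ok w Y P t q (Running (p + csize c) r m)) \<longrightarrow>
     ok w Y P t q (Running p r m))"

lemma wp_weaken:
  assumes "wp w Y c K t q r m" "\<And>t q r m. K t q r m \<Longrightarrow> \<exists>t' q'. t' \<le> t \<and> q \<le> q' \<and> K' t' q' r m"
    "t \<le> t'" "q' \<le> q"
  shows "wp w Y c K' t' q' r m"
  unfolding wp_def
proof (intro allI impI)
  fix P p
  assume c: "code_at P p (compile c p)"
    and K: "\<forall>t q r m. K' t q r m \<longrightarrow> ok w Y P t q (Running (p + csize c) r m)"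
  have "\<forall>t q r m. K t q r m \<longrightarrow> ok w Y P t q (Running (p + csize c) r m)"
    using K assms(2) ok_mono by meson
  then have "ok w Y P t q (Running p r m)" using assms(1) c unfolding wp_def by blast
  then show "ok w Y P t' q' (Running p r m)" using assms(3,4) ok_mono by blast
qed

lemma wp_Skip: "K t q r m \<Longrightarrow> wp w Y Skip K t q r m"
  unfolding wp_def by simp

lemma wp_Seq: "wp w Y c1 (wp w Y c2 K) t q r m \<Longrightarrow> wp w Y (c1 ;; c2) K t q r m"
  unfolding wp_def by (simp add: code_at_append add.assoc)

lemma wp_Block: "wp w Y (Block c) K = wp w Y c K"
  unfolding wp_def[abs_def] by simp

lemma wp_det:
  assumes "\<And>p. exec w i p r m = return_pmf (Running (Suc p) r' m')" "0 < t" "K (t - 1) q r' m'"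
  shows "wp w Y (Ins i) K t q r m"
  unfolding wp_def
proof (intro allI impI)
  fix P p assume "code_at P p (compile (Ins i) p)"
    and K: "\<forall>t q r m. K t q r m \<longrightarrow> ok w Y P t q (Running (p + csize (Ins i)) r m)"
  then have "step w P (Running p r m) = return_pmf (Running (Suc p) r' m')"
    using assms(1) by (simp add: code_at_Cons)
  then have "ok w Y P (Suc (t - 1)) q (Running p r m)"
    using K assms(3) by (intro ok_step) auto
  then show "ok w Y P t q (Running p r m)" using assms(2) by simp
qed

lemma wp_Halt:
  assumes "0 < t" "b \<longrightarrow> Y" "q \<le> (if b then 1 else 0)"
  shows "wp w Y (Ins (Halt b)) K t q r m"
  unfolding wp_def
proof (intro allI impI)
  fix P p assume "code_at P p (compile (Ins (Halt b)) p)"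
  then have "step w P (Running p r m) = return_pmf (Halted b)" by (simp add: code_at_Cons)
  then have "ok w Y P (Suc (t - 1)) q (Running p r m)"
    using assms ok_Halted by (intro ok_step) auto
  then show "ok w Y P t q (Running p r m)" using assms(1) by simp
qed

lemma wp_Rand:
  assumes "0 < t" "0 < r b" "\<And>x. x < r b \<Longrightarrow> K (t - 1) (g x) (r(a := x)) m"
    "q \<le> (\<Sum>x<r b. g x) / real (r b)"
  shows "wp w Y (Ins (Rand a b)) K t q r m"
  unfolding wp_def
proof (intro allI impI)
  fix P p assume "code_at P p (compile (Ins (Rand a b)) p)"
    and K: "\<forall>t q r m. K t q r m \<longrightarrow> ok w Y P t q (Running (p + csize (Ins (Rand a b))) r m)"
  moreover have "max 1 (r b) = r b" using assms(2) by simp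
  ultimately have st: "step w P (Running p r m) =
      map_pmf (\<lambda>x. Running (Suc p) (r(a := x)) m) (pmf_of_set {..<r b})"
    by (simp add: code_at_Cons)
  have "ok w Y P (Suc (t - 1)) q (Running p r m)"
    by (rule ok_rand[OF st assms(2) _ assms(4)]) (use K assms(3) in auto)
  then show "ok w Y P t q (Running p r m)" using assms(1) by simp
qed

lemma ok_Jless:
  assumes "p < length P" "P ! p = Jless a b l" "0 < t"
    "ok w Y P (t - 1) q (Running (if r a < r b then l else Suc p) r m)"
  shows "ok w Y P t q (Running p r m)"
proof -
  have "step w P (Running p r m) = return_pmf (Running (if r a < r b then l else Suc p) r m)"
    using assms by simp
  from ok_step[OF this assms(4)] show ?thesis using assms(3) by simp
qed

lemma wp_If:
  assumes "0 < t" "r a < r b \<Longrightarrow> wp w Y c1 K (t - 1) q r m"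
    "\<not> r a < r b \<Longrightarrow> wp w Y c2 (\<lambda>t q r m. 0 < t \<and> r 0 < r 1 \<and> K (t - 1) q r m) (t - 1) q r m"
  shows "wp w Y (IfLess a b c1 c2) K t q r m"
  unfolding wp_def
proof (intro allI impI)
  fix P p assume "code_at P p (compile (IfLess a b c1 c2) p)"
    and K: "\<forall>t q r m. K t q r m \<longrightarrow> ok w Y P t q (Running (p + csize (IfLess a b c1 c2)) r m)"
  then have c: "p < length P" "P ! p = Jless a b (p + 2 + csize c2)"
    "code_at P (p + 1) (compile c2 (p + 1))"
    "p + 1 + csize c2 < length P"
    "P ! (p + 1 + csize c2) = Jless 0 1 (p + 2 + csize c2 + csize c1)"
    "code_at P (p + 2 + csize c2) (compile c1 (p + 2 + csize c2))"
    by (auto simp: code_at_append code_at_Cons)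
  have e1: "p + 2 + csize c2 + csize c1 = p + csize (IfLess a b c1 c2)" by simp
  show "ok w Y P t q (Running p r m)"
  proof (cases "r a < r b")
    case True
    then have "ok w Y P (t - 1) q (Running (p + 2 + csize c2) r m)"
      using assms(2) c(6) K unfolding wp_def e1[symmetric] by blast
    then show ?thesis using ok_Jless[OF c(1,2) assms(1)] True by simp
  next
    case False
    have "ok w Y P t q (Running (p + 1 + csize c2) r m)"
      if h: "0 < t \<and> r 0 < r 1 \<and> K (t - 1) q r m" for t q r m
    proof (rule ok_Jless[OF c(4,5)])
      show "ok w Y P (t - 1) q
        (Running (if r 0 < r 1 then p + 2 + csize c2 + csize c1 else Suc (p + 1 + csize c2)) r m)"
        using h K unfolding e1 by simp
    qed (use h in simp)
    then have "ok w Y P (t - 1) q (Running (p + 1) r m)"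
      using assms(3)[OF False] c(3) unfolding wp_def by blast
    then show ?thesis using ok_Jless[OF c(1,2) assms(1)] False by simp
  qed
qed

text \<open>A single unrolling without invariant; its users supply the induction. An iteration pays
  two jumps, the test and the jump back; the exit also pays two, the failed test and the jump
  out.\<close>

lemma wp_While:
  assumes "0 < t"
    "r a < r b \<Longrightarrow> wp w Y c (\<lambda>t q r m. 0 < t \<and> r 0 < r 1 \<and> wp w Y (WhileLess a b c) K (t - 1) q r m) (t - 1) q r m"
    "\<not> r a < r b \<Longrightarrow> 1 < t \<and> r 0 < r 1 \<and> K (t - 2) q r m"
  shows "wp w Y (WhileLess a b c) K t q r m"
  unfolding wp_def[of _ _ "WhileLess a b c" K t q r m]
proof (intro allI impI)
  fix P p assume cc: "code_at P p (compile (WhileLess a b c) p)"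
    and K: "\<forall>t q r m. K t q r m \<longrightarrow> ok w Y P t q (Running (p + csize (WhileLess a b c)) r m)"
  from cc have c: "p < length P" "P ! p = Jless a b (p + 2)"
    "p + 1 < length P" "P ! (p + 1) = Jless 0 1 (p + 3 + csize c)"
    "code_at P (p + 2) (compile c (p + 2))"
    "p + 2 + csize c < length P" "P ! (p + 2 + csize c) = Jless 0 1 p"
    by (auto simp: code_at_append code_at_Cons)
  have e1: "p + 3 + csize c = p + csize (WhileLess a b c)" by simp
  show "ok w Y P t q (Running p r m)"
  proof (cases "r a < r b")
    case True
    have "ok w Y P t q (Running (p + 2 + csize c) r m)"
      if h: "0 < t \<and> r 0 < r 1 \<and> wp w Y (WhileLess a b c) K (t - 1) q r m" for t q r m
    proof (rule ok_Jless[OF c(6,7)])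
      have "ok w Y P (t - 1) q (Running p r m)" using h K cc unfolding wp_def by blast
      then show "ok w Y P (t - 1) q (Running (if r 0 < r 1 then p else Suc (p + 2 + csize c)) r m)"
        using h by simp
    qed (use h in simp)
    then have "ok w Y P (t - 1) q (Running (p + 2) r m)"
      using assms(2)[OF True] c(5) unfolding wp_def[of _ _ c] by blast
    then show ?thesis using ok_Jless[OF c(1,2) assms(1)] True by simp
  next
    case False
    then have h: "1 < t" "r 0 < r 1" "K (t - 2) q r m" using assms(3) by auto
    have "ok w Y P (t - 1) q (Running (p + 1) r m)"
    proof (rule ok_Jless[OF c(3,4)])
      have "t - 1 - 1 = t - 2" by simp
      then show "ok w Y P (t - 1 - 1) q (Running (if r 0 < r 1 then p + 3 + csize c else Suc (p + 1)) r m)"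
        using h K unfolding e1 by simp
    qed (use h in simp)
    then show ?thesis using ok_Jless[OF c(1,2) assms(1)] False by simp
  qed
qed

text \<open>Executes loop-free code symbolically, with the absence of overflow as an additional obligation.\<close>

fun vci :: "nat \<Rightarrow> bool \<Rightarrow> instr \<Rightarrow> cont \<Rightarrow> cont" where
  "vci w Y (Const a x) K t q r m = (0 < t \<and> x < 2 ^ w \<and> K (t - 1) q (r(a := x)) m)"
| "vci w Y (Add a b c) K t q r m = (0 < t \<and> r b + r c < 2 ^ w \<and> K (t - 1) q (r(a := r b + r c)) m)"
| "vci w Y (Sub a b c) K t q r m = (0 < t \<and> K (t - 1) q (r(a := r b - r c)) m)"
| "vci w Y (Mul a b c) K t q r m = (0 < t \<and> r b * r c < 2 ^ w \<and> K (t - 1) q (r(a := r b * r c)) m)"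
| "vci w Y (Load a b) K t q r m = (0 < t \<and> K (t - 1) q (r(a := m (r b))) m)"
| "vci w Y (Store a b) K t q r m = (0 < t \<and> K (t - 1) q r (m(r a := r b)))"
| "vci w Y (Rand a b) K t q r m = wp w Y (Ins (Rand a b)) K t q r m"
| "vci w Y (Jless a b l) K t q r m = False"
| "vci w Y (Halt b) K t q r m = (0 < t \<and> (b \<longrightarrow> Y) \<and> q \<le> (if b then 1 else 0))"

primrec vc :: "nat \<Rightarrow> bool \<Rightarrow> com \<Rightarrow> cont \<Rightarrow> cont" where
  "vc w Y Skip K = K"
| "vc w Y (Ins i) K = vci w Y i K"
| "vc w Y (c1 ;; c2) K = vc w Y c1 (vc w Y c2 K)"
| "vc w Y (IfLess a b c1 c2) K = (\<lambda>t q r m. 0 < t \<and> (if r a < r b then vc w Y c1 K (t - 1) q r m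
     else vc w Y c2 (\<lambda>t q r m. 0 < t \<and> r 0 < r 1 \<and> K (t - 1) q r m) (t - 1) q r m))"
| "vc w Y (WhileLess a b c) K = wp w Y (WhileLess a b c) K"
| "vc w Y (Block c) K = wp w Y c K"

lemma vci_wp: "vci w Y i K t q r m \<Longrightarrow> wp w Y (Ins i) K t q r m"
  by (cases i) (auto intro!: wp_Halt intro: wp_det)

lemma wp_mono: "wp w Y c K t q r m \<Longrightarrow> (\<And>t q r m. K t q r m \<Longrightarrow> K' t q r m) \<Longrightarrow> wp w Y c K' t q r m"
  by (erule wp_weaken) blast+

lemma vc_wp: "vc w Y c K t q r m \<Longrightarrow> wp w Y c K t q r m"
proof (induction c arbitrary: K t q r m)
  case (Seq c1 c2)
  then have "wp w Y c1 (vc w Y c2 K) t q r m" by simp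
  then have "wp w Y c1 (wp w Y c2 K) t q r m" using Seq.IH(2) by (rule wp_mono)
  then show ?case by (rule wp_Seq)
next
  case (IfLess a b c1 c2)
  then show ?case by (auto intro!: wp_If split: if_splits)
qed (auto intro: wp_Skip vci_wp simp: wp_Block)

section \<open>Timed triples for the deterministic parts\<close>

definition hoare :: "nat \<Rightarrow> com \<Rightarrow> nat \<Rightarrow> (nat \<Rightarrow> nat) \<Rightarrow> (nat \<Rightarrow> nat) \<Rightarrow>
    ((nat \<Rightarrow> nat) \<Rightarrow> (nat \<Rightarrow> nat) \<Rightarrow> bool) \<Rightarrow> bool" where
  "hoare w c T r m Q \<longleftrightarrow> (\<forall>Y t q. wp w Y c (\<lambda>t' q' r m. t' = t \<and> q' = q \<and> Q r m) (t + T) q r m)"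

lemma hoareI:
  assumes "\<And>Y t q. vc w Y c (\<lambda>t' q' r m. t \<le> t' \<and> q' = q \<and> Q r m) (t + T) q r m"
  shows "hoare w c T r m Q"
  unfolding hoare_def
proof (intro allI)
  fix Y t q
  show "wp w Y c (\<lambda>t' q' r m. t' = t \<and> q' = q \<and> Q r m) (t + T) q r m"
    by (rule wp_weaken[OF vc_wp[OF assms[of Y t q]]]) auto
qed

text \<open>The opaque \<open>K\<close> keeps the postcondition out of the goal during symbolic
  execution.\<close>

lemma hoareK:
  assumes "\<And>Y t q K. (\<And>t' r m. t \<le> t' \<Longrightarrow> Q r m \<Longrightarrow> K t' q r m) \<Longrightarrow> vc w Y c K (t + T) q r m"
  shows "hoare w c T r m Q"
  by (rule hoareI, rule assms) auto

lemma hoare_use: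
  assumes "hoare w c T r m Q" "T \<le> t" "\<And>r' m'. Q r' m' \<Longrightarrow> K (t - T) q r' m'"
  shows "wp w Y c K t q r m"
proof -
  have "wp w Y c (\<lambda>t' q' r m. t' = t - T \<and> q' = q \<and> Q r m) (t - T + T) q r m"
    using assms(1) unfolding hoare_def by blast
  then show ?thesis using assms(2,3) by (auto elim: wp_mono)
qed

lemma hoare_conseq:
  assumes "hoare w c T r m Q" "T \<le> T'" "\<And>r' m'. Q r' m' \<Longrightarrow> Q' r' m'"
  shows "hoare w c T' r m Q'"
  unfolding hoare_def
proof (intro allI)
  fix Y t q
  show "wp w Y c (\<lambda>t' q' r m. t' = t \<and> q' = q \<and> Q' r m) (t + T') q r m"
    by (rule wp_weaken[OF hoare_use[OF assms(1), where t = "t + T'" and q = q and Y = Y and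
          K = "\<lambda>t' q' r m. t' = t + T' - T \<and> q' = q \<and> Q r m"]])
       (use assms(2,3) in auto)
qed

text \<open>\<open>\<phi>\<close> is a potential that serves as termination measure and time bound
  at once: each iteration must lower it by its own cost \<open>T\<close> plus the two jumps. Costs
  can thus be amortized over a ghost value \<open>x\<close>.\<close>

lemma hoare_while:
  assumes "J x r m"
    and body: "\<And>x r m. J x r m \<Longrightarrow> r a < r b \<Longrightarrow> \<exists>T. T + 2 \<le> \<phi> x \<and> hoare w c T r m
        (\<lambda>r' m'. r' 0 < r' 1 \<and> (\<exists>x'. J x' r' m' \<and> \<phi> x' + T + 2 \<le> \<phi> x))"
    and fin: "\<And>x r m. J x r m \<Longrightarrow> \<not> r a < r b \<Longrightarrow> r 0 < r 1"
  shows "hoare w (WhileLess a b c) (\<phi> x + 2) r m (\<lambda>r m. \<not> r a < r b \<and> (\<exists>x. J x r m))"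
  unfolding hoare_def
proof (intro allI)
  fix Y and t :: nat and q :: real
  let ?K = "\<lambda>t' q' r m. t \<le> t' \<and> q' = q \<and> \<not> r a < r b \<and> (\<exists>x. J x r m)"
  have "wp w Y (WhileLess a b c) ?K (t + (\<phi> x + 2)) q r m"
    using assms(1)
  proof (induction "\<phi> x" arbitrary: x r m rule: less_induct)
    case less
    show ?case
    proof (rule wp_While)
      assume ab: "r a < r b"
      obtain T where T: "T + 2 \<le> \<phi> x" "hoare w c T r m
          (\<lambda>r' m'. r' 0 < r' 1 \<and> (\<exists>x'. J x' r' m' \<and> \<phi> x' + T + 2 \<le> \<phi> x))"
        using body[OF less.prems(1) ab] by blast
      show "wp w Y c (\<lambda>t q r m. 0 < t \<and> r 0 < r 1 \<and> wp w Y (WhileLess a b c) ?K (t - 1) q r m)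
         (t + (\<phi> x + 2) - 1) q r m"
      proof (rule hoare_use[OF T(2)])
        fix r' m' assume h: "r' 0 < r' 1 \<and> (\<exists>x'. J x' r' m' \<and> \<phi> x' + T + 2 \<le> \<phi> x)"
        then obtain x' where x': "J x' r' m'" "\<phi> x' + T + 2 \<le> \<phi> x" by blast
        have "wp w Y (WhileLess a b c) ?K (t + (\<phi> x' + 2)) q r' m'"
          using less.hyps[OF _ x'(1)] x'(2) by simp
        then have "wp w Y (WhileLess a b c) ?K (t + (\<phi> x + 2) - 1 - T - 1) q r' m'"
          by (rule wp_weaken) (use x'(2) in auto)
        then show "0 < t + (\<phi> x + 2) - 1 - T \<and> r' 0 < r' 1 \<and>
            wp w Y (WhileLess a b c) ?K (t + (\<phi> x + 2) - 1 - T - 1) q r' m'"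
          using h T(1) by auto
      qed (use T(1) in simp)
    qed (use fin[OF less.prems(1)] less.prems(1) in auto)
  qed
  then show "wp w Y (WhileLess a b c) (\<lambda>t' q' r m. t' = t \<and> q' = q \<and> \<not> r a < r b \<and> (\<exists>x. J x r m))
     (t + (\<phi> x + 2)) q r m"
    by (rule wp_weaken) auto
qed

text \<open>The cost \<open>T i\<close> may vary with \<open>i\<close>, so that a loop over the
  vertices is charged the sum of their degrees instead of \<open>n\<close> times the maximum
  degree.\<close>

lemma hoare_for:
  assumes "I 0 r m"
    and body: "\<And>i r m. I i r m \<Longrightarrow> i < N \<Longrightarrow> r a < r b \<and> hoare w c (T i) r m (\<lambda>r' m'. r' 0 < r' 1 \<and> I (Suc i) r' m')"
    and fin: "\<And>r m. I N r m \<Longrightarrow> \<not> r a < r b \<and> r 0 < r 1"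
  shows "hoare w (WhileLess a b c) ((\<Sum>i<N. T i + 2) + 2) r m (I N)"
proof -
  let ?\<phi> = "\<lambda>i. \<Sum>j\<in>{i..<N}. T j + (2::nat)"
  have "hoare w (WhileLess a b c) (?\<phi> 0 + 2) r m (\<lambda>r m. \<not> r a < r b \<and> (\<exists>i. i \<le> N \<and> I i r m))"
  proof (rule hoare_while[where J = "\<lambda>i r m. i \<le> N \<and> I i r m" and \<phi> = ?\<phi>])
    fix i r m assume h: "i \<le> N \<and> I i r m" "r a < r b"
    then have i: "i < N" using fin by (metis le_neq_implies_less)
    then have e: "?\<phi> i = T i + 2 + ?\<phi> (Suc i)"
      by (simp add: sum.atLeast_Suc_lessThan)
    have "hoare w c (T i) r m (\<lambda>r' m'. r' 0 < r' 1 \<and> (\<exists>i'. (i' \<le> N \<and> I i' r' m') \<and> ?\<phi> i' + T i + 2 \<le> ?\<phi> i))"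
    proof (rule hoare_conseq[OF conjunct2[OF body[of i r m]]])
      fix r' m' assume "r' 0 < r' 1 \<and> I (Suc i) r' m'"
      then show "r' 0 < r' 1 \<and> (\<exists>i'. (i' \<le> N \<and> I i' r' m') \<and> ?\<phi> i' + T i + 2 \<le> ?\<phi> i)"
        using i e by (intro conjI exI[of _ "Suc i"]) auto
    qed (use h i in auto)
    then show "\<exists>T. T + 2 \<le> ?\<phi> i \<and> hoare w c T r m (\<lambda>r' m'. r' 0 < r' 1 \<and>
        (\<exists>i'. (i' \<le> N \<and> I i' r' m') \<and> ?\<phi> i' + T + 2 \<le> ?\<phi> i))"
      using e by (intro exI[of _ "T i"]) auto
  next
    fix i r m assume h: "i \<le> N \<and> I i r m" "\<not> r a < r b"
    then show "r 0 < r 1" using body fin by (metis le_neq_implies_less)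
  qed (use assms(1) in simp)
  then show ?thesis
  proof (rule hoare_conseq)
    fix r' m' assume "\<not> r' a < r' b \<and> (\<exists>i\<le>N. I i r' m')"
    then show "I N r' m'" using body by (metis le_neq_implies_less)
  qed (simp add: atLeast0LessThan)
qed

section \<open>Witnesses of partial Grundy colorings\<close>

text \<open>Insert the vertices of \<open>U\<close> one at a time, each with the least positive
  color absent from its colored neighbors. Minimality provides a neighbor of every smaller color,
  and colors never change afterwards.\<close>

lemma first_fit_extension:
  fixes E :: "'a \<Rightarrow> 'a \<Rightarrow> bool" and c0 :: "'a \<Rightarrow> nat"
  assumes "finite U" "S \<inter> U = {}" "finite S"
    and sym: "\<And>u v. E u v \<Longrightarrow> E v u" and irr: "\<And>u. \<not> E u u"
    and proper: "\<And>u v. u \<in> S \<Longrightarrow> v \<in> S \<Longrightarrow> E u v \<Longrightarrow> c0 u \<noteq> c0 v"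
  shows "\<exists>c. (\<forall>v\<in>S. c v = c0 v) \<and> (\<forall>u\<in>S \<union> U. \<forall>v\<in>S \<union> U. E u v \<longrightarrow> c u \<noteq> c v) \<and>
    (\<forall>v\<in>U. 1 \<le> c v \<and> (\<forall>j\<in>{1..<c v}. \<exists>u\<in>S \<union> U. E u v \<and> c u = j))"
  using assms(1,2)
proof (induction U rule: finite_induct)
  case empty
  then show ?case using proper by auto
next
  case (insert x U)
  then obtain c where c: "\<forall>v\<in>S. c v = c0 v"
    "\<forall>u\<in>S \<union> U. \<forall>v\<in>S \<union> U. E u v \<longrightarrow> c u \<noteq> c v"
    "\<forall>v\<in>U. 1 \<le> c v \<and> (\<forall>j\<in>{1..<c v}. \<exists>u\<in>S \<union> U. E u v \<and> c u = j)" by auto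
  let ?C = "c ` {u \<in> S \<union> U. E u x}"
  let ?P = "\<lambda>j. 1 \<le> j \<and> j \<notin> ?C"
  have "finite (insert 0 ?C)" using insert.hyps(1) assms(3) by auto
  from ex_new_if_finite[OF infinite_UNIV_nat this] have "\<exists>j. ?P j"
    by (metis One_nat_def Suc_leI insertCI neq0_conv)
  then have l: "?P (Least ?P)" by (metis (mono_tags, lifting) LeastI)
  have below: "j \<in> ?C" if "1 \<le> j" "j < Least ?P" for j
    using that not_less_Least by blast
  let ?c = "c(x := Least ?P)"
  have xn: "x \<notin> S" "x \<notin> U" using insert by auto
  have "\<forall>v\<in>S. ?c v = c0 v" using c(1) xn by auto
  moreover have "\<forall>u\<in>S \<union> insert x U. \<forall>v\<in>S \<union> insert x U. E u v \<longrightarrow> ?c u \<noteq> ?c v"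
  proof (intro ballI impI)
    fix u v assume uv: "u \<in> S \<union> insert x U" "v \<in> S \<union> insert x U" "E u v"
    have ne: "u \<noteq> v" using uv(3) irr by auto
    consider "u = x" | "v = x" | "u \<noteq> x" "v \<noteq> x" by blast
    then show "?c u \<noteq> ?c v"
    proof cases
      case 1
      then have "c v \<in> ?C" using uv ne sym by auto
      then show ?thesis using 1 ne l by auto
    next
      case 2
      then have "c u \<in> ?C" using uv ne by auto
      then show ?thesis using 2 ne l by auto
    next
      case 3
      then show ?thesis using uv c(2) by auto
    qed
  qed
  moreover have "\<forall>v\<in>insert x U. 1 \<le> ?c v \<and> (\<forall>j\<in>{1..<?c v}. \<exists>u\<in>S \<union> insert x U. E u v \<and> ?c u = j)"
  proof (intro ballI conjI)
    fix v assume v: "v \<in> insert x U"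
    show "1 \<le> ?c v" using v c(3) l by auto
    fix j assume j: "j \<in> {1..<?c v}"
    show "\<exists>u\<in>S \<union> insert x U. E u v \<and> ?c u = j"
    proof (cases "v = x")
      case True
      then have "j \<in> ?C" using j below by auto
      then obtain u where "u \<in> S \<union> U" "E u x" "c u = j" by auto
      then show ?thesis using True xn by (intro bexI[of _ u]) auto
    next
      case False
      then obtain u where "u \<in> S \<union> U" "E u v" "c u = j" using v j c(3) by fastforce
      then show ?thesis using xn by (intro bexI[of _ u]) auto
    qed
  qed
  ultimately show ?case by blast
qed

text \<open>Colors start from 0, one below those of \<open>partial_grundy_coloring\<close>, to match
  the class numbers of the machine.\<close>

definition grundy_witness :: "'a graph \<Rightarrow> nat \<Rightarrow> 'a set \<Rightarrow> ('a \<Rightarrow> nat) \<Rightarrow> bool" where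
  "grundy_witness G k W c \<longleftrightarrow> W \<subseteq> verts G \<and> (\<forall>v\<in>W. c v < k) \<and>
     (\<forall>u\<in>W. \<forall>v\<in>W. {u, v} \<in> edges G \<longrightarrow> c u \<noteq> c v) \<and>
     (\<forall>i<k. \<exists>v\<in>W. c v = i \<and> (\<forall>j<i. \<exists>u\<in>W. {v, u} \<in> edges G \<and> c u = j))"

text \<open>Colors up to \<open>k\<close> are realized by the witness. A color above
  \<open>k\<close> belongs only to first-fit vertices, which see all smaller colors by construction.
  So the largest color in use can serve as \<open>k'\<close>.\<close>

lemma grundy_witness_yes:
  assumes G: "simple_graph G" and k: "1 \<le> k" and W: "grundy_witness G k W c0"
  shows "PGC_yes_instance G k"
proof -
  let ?E = "\<lambda>u v. {u, v} \<in> edges G"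
  have fV: "finite (verts G)" and E: "\<And>u v. ?E u v \<Longrightarrow> u \<in> verts G \<and> v \<in> verts G"
    and ec: "\<And>e. e \<in> edges G \<Longrightarrow> card e = 2"
    using G by (auto simp: simple_graph_def)
  have irr: "\<not> ?E u u" for u using ec[of "{u}"] by auto
  have WV: "W \<subseteq> verts G" using W by (simp add: grundy_witness_def)
  have "\<exists>c. (\<forall>v\<in>W. c v = Suc (c0 v)) \<and>
    (\<forall>u\<in>W \<union> (verts G - W). \<forall>v\<in>W \<union> (verts G - W). ?E u v \<longrightarrow> c u \<noteq> c v) \<and>
    (\<forall>v\<in>verts G - W. 1 \<le> c v \<and> (\<forall>j\<in>{1..<c v}. \<exists>u\<in>W \<union> (verts G - W). ?E u v \<and> c u = j))"
    by (rule first_fit_extension)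
       (use fV irr W in \<open>auto simp: insert_commute grundy_witness_def intro: finite_subset\<close>)
  moreover have "W \<union> (verts G - W) = verts G" using WV by auto
  ultimately obtain c where c: "\<forall>v\<in>W. c v = Suc (c0 v)"
    "\<forall>u\<in>verts G. \<forall>v\<in>verts G. ?E u v \<longrightarrow> c u \<noteq> c v"
    "\<forall>v\<in>verts G - W. 1 \<le> c v \<and> (\<forall>j\<in>{1..<c v}. \<exists>u\<in>verts G. ?E u v \<and> c u = j)" by auto
  define k' where "k' = Max (c ` verts G)"
  have wit: "\<exists>v\<in>W. c0 v = i \<and> (\<forall>j<i. \<exists>u\<in>W. {v, u} \<in> edges G \<and> c0 u = j)" if "i < k" for i
    using W that by (simp add: grundy_witness_def)
  obtain v where v: "v \<in> W" "c0 v = k - 1" using wit[of "k - 1"] k by auto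
  have vV: "v \<in> verts G" using v WV by auto
  have "c v \<le> k'" unfolding k'_def using fV vV by auto
  then have kk: "k \<le> k'" using c(1) v k by auto
  have le: "c u \<le> k'" if "u \<in> verts G" for u unfolding k'_def using fV that by auto
  have ge: "1 \<le> c u" if "u \<in> verts G" for u using c(1,3) that by (cases "u \<in> W") auto
  have "Max (c ` verts G) \<in> c ` verts G" using fV vV by (intro Max_in) auto
  then obtain z where z: "z \<in> verts G" "c z = k'" unfolding k'_def by auto
  have big: "\<forall>j\<in>{1..<c u}. \<exists>x\<in>verts G. ?E x u \<and> c x = j" if "u \<in> verts G" "k < c u" for u
  proof -
    have "u \<notin> W" using that c(1) W by (auto simp: grundy_witness_def)
    then show ?thesis using c(3) that by auto
  qed
  have "partial_grundy_coloring G k' c"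
    unfolding partial_grundy_coloring_def proper_coloring_def
  proof (intro conjI ballI allI impI)
    fix i assume i: "i \<in> {1..k'}"
    show "\<exists>v\<in>verts G. c v = i \<and> (\<forall>j\<in>{1..<i}. \<exists>u\<in>verts G. {u, v} \<in> edges G \<and> c u = j)"
    proof (cases "i \<le> k")
      case True
      then have "i - 1 < k" using i by auto
      from wit[OF this] obtain v where
        v: "v \<in> W" "c0 v = i - 1" "\<forall>j<i - 1. \<exists>u\<in>W. {v, u} \<in> edges G \<and> c0 u = j"
        by blast
      have "\<exists>u\<in>verts G. {u, v} \<in> edges G \<and> c u = j" if j: "j \<in> {1..<i}" for j
      proof -
        have "j - 1 < i - 1" using j by auto
        then obtain u where "u \<in> W" "{v, u} \<in> edges G" "c0 u = j - 1" using v(3) by blast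
        then show ?thesis using c(1) WV j by (intro bexI[of _ u]) (auto simp: insert_commute)
      qed
      then show ?thesis using v c(1) WV i by (intro bexI[of _ v]) auto
    next
      case False
      \<comment> \<open>Now \<open>k' > k\<close>, so the vertex \<open>z\<close> of color
        \<open>k'\<close> is a first-fit vertex and has a neighbor of color \<open>i\<close> unless
        \<open>i = k'\<close>.\<close>
      obtain x where x: "x \<in> verts G" "c x = i"
      proof (cases "i = k'")
        case True then show ?thesis using that z by auto
      next
        case neq: False
        then show ?thesis using that big[of z] z i False by fastforce
      qed
      then show ?thesis using big[of x] False by auto
    qed
  qed (use le ge c(2) E in auto)
  then show ?thesis unfolding PGC_yes_instance_def using kk by auto
qed

text \<open>Only the colors up to \<open>k\<close> of a possibly larger coloring are kept: for each
  color \<open>i\<close>, one vertex and one neighbor per smaller color, that is at most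
  \<open>i\<close> vertices.\<close>

lemma yes_grundy_witness:
  assumes "PGC_yes_instance G k"
  shows "\<exists>W c. grundy_witness G k W c \<and> finite W \<and> 2 * card W \<le> k ^ 2 + k"
proof -
  obtain k' c where kk: "k \<le> k'" and c: "partial_grundy_coloring G k' c"
    using assms by (auto simp: PGC_yes_instance_def)
  have "\<forall>i\<in>{1..k'}. \<exists>v\<in>verts G. c v = i \<and> (\<forall>j\<in>{1..<i}. \<exists>u\<in>verts G. {u, v} \<in> edges G \<and> c u = j)"
    using c by (simp add: partial_grundy_coloring_def)
  then obtain x where x: "\<And>i. i \<in> {1..k'} \<Longrightarrow> x i \<in> verts G \<and> c (x i) = i \<and>
      (\<forall>j\<in>{1..<i}. \<exists>u\<in>verts G. {u, x i} \<in> edges G \<and> c u = j)" by metis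
  then obtain y where y: "\<And>i j. i \<in> {1..k'} \<Longrightarrow> j \<in> {1..<i} \<Longrightarrow>
      y i j \<in> verts G \<and> {y i j, x i} \<in> edges G \<and> c (y i j) = j" by metis
  let ?A = "\<lambda>i. insert (x (Suc i)) (y (Suc i) ` {1..<Suc i})"
  let ?W = "\<Union>i<k. ?A i"
  have "card ?W \<le> (\<Sum>i<k. card (?A i))" by (rule card_UN_le) simp
  also have "\<dots> \<le> (\<Sum>i<k. Suc i)"
  proof (rule sum_mono)
    fix i assume "i \<in> {..<k}"
    have "card (?A i) \<le> Suc (card (y (Suc i) ` {1..<Suc i}))" by (simp add: card_insert_if)
    also have "\<dots> \<le> Suc i" using card_image_le[of "{1..<Suc i}" "y (Suc i)"] by simp
    finally show "card (?A i) \<le> Suc i" .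
  qed
  finally have "2 * card ?W \<le> 2 * (\<Sum>i<k. Suc i)" by simp
  also have "2 * (\<Sum>i<k. Suc i) = k ^ 2 + k"
    by (induction k) (auto simp: power2_eq_square)
  finally have card: "2 * card ?W \<le> k ^ 2 + k" .
  have Wc: "u \<in> verts G \<and> 1 \<le> c u \<and> c u \<le> k" if uW: "u \<in> ?W" for u
  proof -
    obtain i where i: "i < k" "u \<in> ?A i" using uW by blast
    have ik: "Suc i \<in> {1..k'}" using i kk by auto
    show ?thesis using i(2) x[OF ik] y[OF ik] i(1) by auto
  qed
  have pc: "c u \<noteq> c v" if "{u, v} \<in> edges G" for u v
    using c that by (auto simp: partial_grundy_coloring_def proper_coloring_def)
  have "grundy_witness G k ?W (\<lambda>v. c v - 1)"
    unfolding grundy_witness_def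
  proof (intro conjI ballI allI impI)
    show "?W \<subseteq> verts G" using Wc by blast
  next
    fix v assume "v \<in> ?W" from Wc[OF this] show "c v - 1 < k" by auto
  next
    fix u v assume "u \<in> ?W" "v \<in> ?W" "{u, v} \<in> edges G"
    then show "c u - 1 \<noteq> c v - 1" using Wc[of u] Wc[of v] pc[of u v] by linarith
  next
    fix i assume i: "i < k"
    then have ik: "Suc i \<in> {1..k'}" using kk by auto
    have "\<forall>j<i. \<exists>u\<in>?W. {x (Suc i), u} \<in> edges G \<and> c u - 1 = j"
    proof (intro allI impI)
      fix j assume j: "j < i"
      then have "y (Suc i) (Suc j) \<in> ?A i" by auto
      then have "y (Suc i) (Suc j) \<in> ?W" using i by blast
      then show "\<exists>u\<in>?W. {x (Suc i), u} \<in> edges G \<and> c u - 1 = j"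
        using y[OF ik, of "Suc j"] j by (intro bexI[of _ "y (Suc i) (Suc j)"]) (auto simp: insert_commute)
    qed
    moreover have "x (Suc i) \<in> ?W" using i by blast
    ultimately show "\<exists>v\<in>?W. c v - 1 = i \<and> (\<forall>j<i. \<exists>u\<in>?W. {v, u} \<in> edges G \<and> c u - 1 = j)"
      using x[OF ik] by (intro bexI[of _ "x (Suc i)"]) auto
  qed
  then show ?thesis using card by (intro exI[of _ ?W] exI[of _ "\<lambda>v. c v - 1"]) auto
qed

section \<open>Degeneracy, edge counts and probability estimates\<close>

lemma finite_edges: "simple_graph G \<Longrightarrow> finite (edges G)"
  unfolding simple_graph_def by (meson finite_Pow_iff finite_subset PowI subsetI)

text \<open>Degeneracy is applied to the subgraph induced by \<open>R\<close>, whose degrees are at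
  least the numbers of neighbors inside \<open>R\<close>.\<close>

lemma degenerate_min_degree:
  assumes G: "simple_graph G" and "degenerate d G" "R \<subseteq> verts G" "R \<noteq> {}"
    and D: "\<And>v. v \<in> R \<Longrightarrow> D \<le> card {u \<in> R. {v, u} \<in> edges G}"
  shows "D \<le> d"
proof -
  let ?H = "\<lparr>verts = R, edges = {e \<in> edges G. e \<subseteq> R}\<rparr>"
  have fR: "finite R" using G assms(3) by (auto simp: simple_graph_def intro: finite_subset)
  have "subgraph ?H G" using G assms(3) fR by (auto simp: subgraph_def simple_graph_def)
  then obtain v where v: "v \<in> R" "degree ?H v \<le> d"
    using assms(2,4) unfolding degenerate_def by fastforce
  have "card {u \<in> R. {v, u} \<in> edges G} \<le> card {e \<in> {e \<in> edges G. e \<subseteq> R}. v \<in> e}"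
  proof (rule card_inj_on_le)
    show "inj_on (\<lambda>u. {v, u}) {u \<in> R. {v, u} \<in> edges G}"
      by (auto simp: inj_on_def doubleton_eq_iff)
    show "(\<lambda>u. {v, u}) ` {u \<in> R. {v, u} \<in> edges G} \<subseteq> {e \<in> {e \<in> edges G. e \<subseteq> R}. v \<in> e}"
      using v by auto
    show "finite {e \<in> {e \<in> edges G. e \<subseteq> R}. v \<in> e}" using finite_edges[OF G] by auto
  qed
  then show ?thesis using v D[OF v(1)] by (simp add: degree_def)
qed

text \<open>Double counting: an edge yields at most two ordered pairs of adjacent vertices.\<close>

lemma sum_neighbors_le:
  assumes G: "simple_graph G"
  shows "(\<Sum>v\<in>verts G. card {u. {v, u} \<in> edges G}) \<le> 2 * card (edges G)"
proof -
  let ?N = "\<lambda>v. {u. {v, u} \<in> edges G}"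
  have fV: "finite (verts G)" using G by (simp add: simple_graph_def)
  have fN: "finite (?N v)" for v
    by (rule finite_subset[OF _ fV]) (use G in \<open>auto simp: simple_graph_def\<close>)
  have "(\<Sum>v\<in>verts G. card (?N v)) = card (SIGMA v:verts G. ?N v)"
    using fV fN by simp
  also have "\<dots> \<le> card (\<Union>e\<in>edges G. {(v, u). {v, u} = e})"
  proof (rule card_mono)
    have "finite {(v, u). {v, u} = e}" if "e \<in> edges G" for e
    proof -
      have "e \<subseteq> verts G" using that G by (simp add: simple_graph_def)
      then have "finite e" using fV finite_subset by blast
      then have "finite (e \<times> e)" by simp
      then show ?thesis by (rule finite_subset[rotated]) auto
    qed
    then show "finite (\<Union>e\<in>edges G. {(v, u). {v, u} = e})" using finite_edges[OF G] by auto
  qed auto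
  also have "\<dots> \<le> (\<Sum>e\<in>edges G. card {(v, u). {v, u} = e})"
    by (rule card_UN_le[OF finite_edges[OF G]])
  also have "\<dots> \<le> (\<Sum>e\<in>edges G. 2)"
  proof (rule sum_mono)
    fix e assume "e \<in> edges G"
    then obtain a b where e: "e = {a, b}" using G by (auto simp: simple_graph_def card_2_iff)
    have "{(v, u). {v, u} = e} \<subseteq> {(a, b), (b, a)}" unfolding e by (auto simp: doubleton_eq_iff)
    from card_mono[OF _ this] show "card {(v, u). {v, u} = e} \<le> 2"
      by (auto simp: card_insert_if split: if_splits)
  qed
  finally show ?thesis by simp
qed

lemma prod_two_sets:
  fixes x y :: real
  assumes Q: "bij_betw Q {..<n} {..<n}" and W: "W \<subseteq> {..<n}" and X: "X \<subseteq> {..<n}" "X \<inter> W = {}"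
  shows "(\<Prod>i<n. if Q i \<in> W then x else if Q i \<in> X then y else 1) = x ^ card W * y ^ card (X :: nat set)"
proof -
  have "(\<Prod>i<n. if Q i \<in> W then x else if Q i \<in> X then y else 1) =
    (\<Prod>v<n. if v \<in> W then x else if v \<in> X then y else 1)"
    by (rule prod.reindex_bij_betw[OF Q])
  also have "\<dots> = (\<Prod>v<n. (if v \<in> W then x else 1) * (if v \<in> X then y else 1))"
    using X(2) by (intro prod.cong) auto
  also have "\<dots> = (\<Prod>v<n. if v \<in> W then x else 1) * (\<Prod>v<n. if v \<in> X then y else 1)"
    by (simp add: prod.distrib)
  also have "(\<Prod>v<n. if v \<in> W then x else 1) = x ^ card W"
    using W by (simp add: prod.If_cases Int_absorb1)
  also have "(\<Prod>v<n. if v \<in> X then y else 1) = y ^ card X"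
    using X(1) by (simp add: prod.If_cases Int_absorb1)
  finally show ?thesis .
qed

text \<open>Used with \<open>a = card W\<close>, \<open>b = card X\<close> and
  \<open>e = k^2 + k\<close>. Half of the exponent pays for the witness vertices drawing their own
  colors, the other half for their at most \<open>D - 1\<close> later neighbors each, as
  \<open>(1 - 1/D)^(D - 1) >= 1/D >= 1/(k * D)\<close>. For \<open>D = 1\<close> the base is 0, but
  then \<open>b = 0\<close> and the power is 1.\<close>

lemma trial_probability:
  fixes a b D k e :: nat
  assumes "1 \<le> D" "1 \<le> k" "b \<le> (D - 1) * a" "2 * a \<le> e"
  shows "1 / real (k * D) ^ e \<le> (1 / real (k * D)) ^ a * ((real D - 1) / real D) ^ b"
proof -
  let ?y = "(real D - 1) / real D"
  have y: "0 \<le> ?y" "?y \<le> 1" using assms(1) by auto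
  have N1: "1 \<le> real (k * D)" using assms(1,2) by (metis mult_le_mono nat_mult_1 of_nat_1 of_nat_mono)
  have "1 + real (D - 1) * (- 1 / real D) \<le> (1 + (- 1 / real D)) ^ (D - 1)"
    using assms(1) by (intro Bernoulli_inequality) (auto simp: field_simps)
  moreover have "1 + real (D - 1) * (- 1 / real D) = 1 / real D" "1 + (- 1 / real D) = ?y"
    using assms(1) by (auto simp: field_simps of_nat_diff)
  ultimately have "1 / real D \<le> ?y ^ (D - 1)" by simp
  moreover have "1 / real (k * D) \<le> 1 / real D"
    using assms(1,2) by (intro divide_left_mono) auto
  ultimately have Dk: "1 / real (k * D) \<le> ?y ^ (D - 1)" by linarith
  have "1 / real (k * D) ^ e \<le> 1 / real (k * D) ^ (2 * a)"
    using N1 assms(4) by (intro divide_left_mono power_increasing mult_pos_pos zero_less_power) auto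
  also have "\<dots> = (1 / real (k * D)) ^ a * (1 / real (k * D)) ^ a"
    by (simp add: power_one_over mult_2 power_add)
  also have "\<dots> \<le> (1 / real (k * D)) ^ a * (?y ^ (D - 1)) ^ a"
    using Dk by (intro mult_left_mono power_mono) auto
  also have "\<dots> = (1 / real (k * D)) ^ a * ?y ^ ((D - 1) * a)" by (simp add: power_mult)
  also have "\<dots> \<le> (1 / real (k * D)) ^ a * ?y ^ b"
    using y assms(3) by (intro mult_left_mono power_decreasing) auto
  finally show ?thesis .
qed

text \<open>By \<open>k >= 2\<close>, the exponent \<open>2 * k^2\<close> is at least
  \<open>k^2 + k + 2\<close>, so at least \<open>N^2 >= 4\<close> successes are expected.
  Bernoulli's inequality for \<open>1 + p\<close> and \<open>(1 + p) * (1 - p) <= 1\<close> then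
  bound the failure probability without exponentials.\<close>

lemma amplification:
  fixes p :: real and N k :: nat
  assumes "2 \<le> k" "2 \<le> N" "1 / real N ^ (k ^ 2 + k) \<le> p" "p \<le> 1"
  shows "(1 - p) ^ (N ^ (2 * k ^ 2)) \<le> 1 / 3"
proof -
  let ?M = "N ^ (2 * k ^ 2)"
  have kk: "k ^ 2 + k + 2 \<le> 2 * k ^ 2"
  proof -
    have "2 * k \<le> k * k" using assms(1) by simp
    moreover have "k + 2 \<le> 2 * k" using assms(1) by simp
    ultimately show ?thesis unfolding power2_eq_square by linarith
  qed
  have Npos: "0 < real N ^ (k ^ 2 + k)" using assms(2) by simp
  then have p0: "0 < p" using assms(3) by (meson less_le_trans zero_less_divide_1_iff)
  have "4 \<le> real N ^ 2" using power_mono[of 2 "real N" 2] assms(2) by simp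
  also have "\<dots> = real N ^ (k ^ 2 + k + 2) * (1 / real N ^ (k ^ 2 + k))"
    using Npos assms(2) by (simp add: power_add power2_eq_square)
  also have "\<dots> \<le> real N ^ (2 * k ^ 2) * p"
    using kk assms by (intro mult_mono power_increasing) auto
  finally have 4: "4 \<le> real ?M * p" by simp
  have "1 + real ?M * p \<le> (1 + p) ^ ?M" using p0 by (intro Bernoulli_inequality) auto
  then have "3 * (1 - p) ^ ?M \<le> (1 + p) ^ ?M * (1 - p) ^ ?M"
    using 4 assms(4) by (intro mult_right_mono) auto
  also have "\<dots> = (1 - p ^ 2) ^ ?M"
    unfolding power_mult_distrib[symmetric] by (simp add: algebra_simps power2_eq_square)
  also have "\<dots> \<le> 1" using p0 assms(4) by (intro power_le_one) (auto simp: power_le_one)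
  finally show ?thesis by simp
qed

section \<open>Checking a candidate and counting trials\<close>

text \<open>The machine compares only by less-than; equality is the absence of both strict
  inequalities.\<close>

definition ifeq :: "nat \<Rightarrow> nat \<Rightarrow> com \<Rightarrow> com" where
  "ifeq a b c = IfLess a b Skip (IfLess b a Skip c)"

lemma vc_ifeq [simp]: "vc w Y (ifeq a b c) K t q r m \<longleftrightarrow> 0 < t \<and>
    (if r a < r b then K (t - 1) q r m
     else 1 < t \<and> (if r b < r a then 2 < t \<and> r 0 < r 1 \<and> K (t - 3) q r m
       else vc w Y c (\<lambda>t q r m. 1 < t \<and> r 0 < r 1 \<and> K (t - 2) q r m) (t - 2) q r m))"
proof -
  have "(\<lambda>t q r m. 0 < t \<and> r 0 < r 1 \<and> 0 < t - 1 \<and> r 0 < r 1 \<and> K (t - 1 - 1) q r m) =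
    (\<lambda>t q r m. 1 < t \<and> r 0 < r 1 \<and> K (t - 2) q r m)"
    by (auto simp: fun_eq_iff numeral_2_eq_2)
  then show ?thesis
    by (auto simp: ifeq_def numeral_2_eq_2 numeral_3_eq_3)
qed

definition keeps :: "nat set \<Rightarrow> (nat \<Rightarrow> nat) \<Rightarrow> (nat \<Rightarrow> nat) \<Rightarrow> bool" where
  "keeps X r r' \<longleftrightarrow> (\<forall>x. x \<notin> X \<longrightarrow> r' x = r x)"

lemma keeps_refl [simp]: "keeps X r r" by (simp add: keeps_def)

lemma keeps_upd [simp]: "a \<in> X \<Longrightarrow> keeps X r (r'(a := x)) \<longleftrightarrow> keeps X r r'"
  by (auto simp: keeps_def)

lemma keepsD: "keeps X r r' \<Longrightarrow> x \<notin> X \<Longrightarrow> r' x = r x" by (simp add: keeps_def)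

lemma keeps_trans: "keeps X r r' \<Longrightarrow> keeps X' r' r'' \<Longrightarrow> X' \<subseteq> X \<Longrightarrow> keeps X r r''"
  by (auto simp: keeps_def)

text \<open>
  Registers: 0 and 1 contain the constants 0 and 1; 2 is \<open>k\<close>; 3 is \<open>n\<close>; 4 to 8 are the base addresses
  \<open>S, 2 * S, \<dots>, 5 * S\<close> of the arrays of adjacency list addresses, of remaining degrees, of the queue, of
  the classes (\<open>\<ge> k\<close> means none) and of the trial counter; 9 is the degree bound; 10 and 11 are head and tail
  of the queue; 12 and 13 are base and length of the trial counter. The others are temporary.
\<close>

definition scan_loop :: com where
  "scan_loop = WhileLess 15 16 (Ins (Add 15 15 1) ;; Ins (Load 17 15) ;; Ins (Add 18 7 17) ;;
     Ins (Load 18 18) ;; ifeq 18 20 (Ins (Const 21 1)))"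

text \<open>Register 22 names a vertex, register 20 a number; register 21 becomes 1 if some neighbor
  of the vertex carries that number in the class array. Both the sampling and the check use
  it.\<close>

definition scan :: com where
  "scan = Ins (Const 21 0) ;; Ins (Add 18 4 22) ;; Ins (Load 15 18) ;; Ins (Load 16 15) ;;
     Ins (Add 16 16 15) ;; Block scan_loop"

text \<open>Conjunctions over colors are accumulated by multiplying 0-1 flags: register 27 here,
  register 24 in \<open>class_loop\<close>.\<close>

definition color_loop :: com where
  "color_loop = WhileLess 20 25 (Block scan ;; Ins (Mul 27 27 21) ;; Ins (Add 20 20 1))"

definition vertex_loop :: com where
  "vertex_loop = WhileLess 22 3 (Ins (Add 18 7 22) ;; Ins (Load 18 18) ;;
     ifeq 18 25 (Ins (Const 27 1) ;; Ins (Const 20 0) ;; Block color_loop ;;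
       IfLess 0 27 (Ins (Const 23 1)) Skip) ;;
     Ins (Add 22 22 1))"

definition class_loop :: com where
  "class_loop = WhileLess 25 2 (Ins (Const 23 0) ;; Ins (Const 22 0) ;; Block vertex_loop ;;
     Ins (Mul 24 24 23) ;; Ins (Add 25 25 1))"

definition clear_loop :: com where
  "clear_loop = WhileLess 14 3 (Ins (Add 18 7 14) ;; Ins (Store 18 2) ;; Ins (Add 14 14 1))"

text \<open>An odometer with register 28 as carry. Every increment visits all digits; the cost, of
  order \<open>k^2\<close>, is absorbed by the cost of the trial.\<close>

definition odo_loop :: com where
  "odo_loop = WhileLess 14 13 (Ins (Add 18 8 14) ;; Ins (Load 19 18) ;; Ins (Add 19 19 28) ;;
     IfLess 19 12 (Ins (Const 28 0)) (Ins (Const 28 1) ;; Ins (Const 19 0)) ;;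
     Ins (Store 18 19) ;; Ins (Add 14 14 1))"

text \<open>The cases \<open>k = 1\<close> and \<open>k > n\<close> need no sampling and are decided
  separately. The fourth power leaves room for addresses below \<open>8 * S\<close>, where
  \<open>S\<close> is quadratic in \<open>n\<close>.\<close>

locale grundy_instance =
  fixes G :: "nat graph" and adj :: "nat list list" and k d w :: nat
  assumes simple: "simple_graph G" and adj: "adjacency_lists G adj" and k2: "2 \<le> k"
    and kn: "k \<le> length adj" and degen: "degenerate d G"
    and word: "(length adj + card (edges G) + k + 2) ^ 4 \<le> (2::nat) ^ w"
begin

definition n :: nat where "n = length adj"
definition nbrs :: "nat \<Rightarrow> nat set" where "nbrs v = set (adj ! v)"
definition deg :: "nat \<Rightarrow> nat" where "deg v = length (adj ! v)"
text \<open>Spacing of the arrays. It takes one multiplication to compute and exceeds every input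
  address, the array length \<open>n\<close> and the number range \<open>k * D <= n^2\<close>; the
  \<open>2 * k^2\<close> counter digits fit into two blocks.\<close>

definition S :: nat where "S = (n + 2) ^ 2"
definition addr :: "nat \<Rightarrow> nat" where "addr v = 2 + (\<Sum>u<v. Suc (deg u))"

lemma verts_eq: "verts G = {..<n}"
  using adj by (simp add: adjacency_lists_def n_def)

lemma nbrs_iff: "v < n \<Longrightarrow> u \<in> nbrs v \<longleftrightarrow> {v, u} \<in> edges G"
  using adj by (auto simp: adjacency_lists_def n_def nbrs_def)

lemma nbrs_less: "v < n \<Longrightarrow> u \<in> nbrs v \<Longrightarrow> u < n"
  using simple verts_eq by (auto simp: nbrs_iff simple_graph_def)

lemma nbrs_sym: "v < n \<Longrightarrow> u \<in> nbrs v \<Longrightarrow> v \<in> nbrs u"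
  using nbrs_less[of v u] by (auto simp: nbrs_iff insert_commute)

lemma nbrs_irrefl: "v < n \<Longrightarrow> v \<notin> nbrs v"
  using simple by (auto simp: nbrs_iff simple_graph_def dest!: bspec)

lemma distinct_adj: "v < n \<Longrightarrow> distinct (adj ! v)"
  using adj by (auto simp: adjacency_lists_def n_def)

lemma deg_card: "v < n \<Longrightarrow> deg v = card (nbrs v)"
  using distinct_adj by (simp add: deg_def nbrs_def distinct_card)

lemma finite_nb [simp]: "finite (nbrs v)" by (simp add: nbrs_def)

lemma deg_le: "v < n \<Longrightarrow> deg v < n"
proof -
  assume v: "v < n"
  have "nbrs v \<subseteq> {..<n} - {v}" using nbrs_less[OF v] nbrs_irrefl[OF v] by auto
  then have "card (nbrs v) \<le> card ({..<n} - {v})" by (intro card_mono) auto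
  also have "\<dots> < n" using v by simp
  finally show ?thesis using deg_card v by simp
qed

lemma sum_dg: "(\<Sum>v<n. deg v) \<le> 2 * card (edges G)"
proof -
  have "(\<Sum>v<n. deg v) = (\<Sum>v\<in>verts G. card {u. {v, u} \<in> edges G})"
    unfolding verts_eq
  proof (rule sum.cong)
    fix v assume "v \<in> {..<n}"
    then have "nbrs v = {u. {v, u} \<in> edges G}" using nbrs_iff[of v] by auto
    then show "deg v = card {u. {v, u} \<in> edges G}" using deg_card[of v] \<open>v \<in> {..<n}\<close> by simp
  qed simp
  then show ?thesis using sum_neighbors_le[OF simple] by simp
qed

lemma addr_le: "v \<le> n \<Longrightarrow> addr v \<le> 2 + v * n"
proof (induction v)
  case (Suc v)
  then show ?case using deg_le[of v] by (simp add: addr_def)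
qed (simp add: addr_def)

lemma addr_Suc: "addr (Suc v) = addr v + deg v + 1" by (simp add: addr_def)

lemma n2: "2 \<le> n" "k \<le> n" using k2 kn by (auto simp: n_def)

lemma addr_bound: "v \<le> n \<Longrightarrow> addr v < S"
proof -
  assume "v \<le> n"
  then have "v * n \<le> n * n" by simp
  moreover have "S = n * n + 4 * n + 4" by (simp add: S_def power2_eq_square)
  ultimately show ?thesis using addr_le[OF \<open>v \<le> n\<close>] by linarith
qed

lemma addr_dg_less: "v < n \<Longrightarrow> addr v + deg v < S"
  using addr_bound[of "Suc v"] by (simp add: addr_Suc)

lemma n_S: "n < S" by (simp add: S_def power2_eq_square)

lemma S_word: "8 * S < 2 ^ w" and k_word: "2 * k ^ 2 \<le> 2 * S" and kn_word: "n * n < S"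
proof -
  have "8 * S < 36 * S" using n_S by simp
  \<comment> \<open>One of the two squares is at least \<open>6^2\<close>, because \<open>n\<close>
    and \<open>k\<close> are at least 2; the other one covers \<open>S\<close>.\<close>
  also have "\<dots> \<le> (n + card (edges G) + k + 2) ^ 2 * (n + card (edges G) + k + 2) ^ 2"
  proof (rule mult_mono)
    have "6 ^ 2 \<le> (n + card (edges G) + k + 2) ^ 2" using n2 k2 by (intro power_mono) auto
    then show "36 \<le> (n + card (edges G) + k + 2) ^ 2" by simp
    show "S \<le> (n + card (edges G) + k + 2) ^ 2" unfolding S_def by (intro power_mono) auto
  qed auto
  also have "\<dots> = (n + card (edges G) + k + 2) ^ 4" by (simp flip: power_add)
  also have "\<dots> \<le> 2 ^ w" using word by (simp add: n_def)
  finally show "8 * S < 2 ^ w" .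
  have "k ^ 2 \<le> (n + 2) ^ 2" using n2 by (intro power_mono) auto
  then show "2 * k ^ 2 \<le> 2 * S" by (simp add: S_def)
  show "n * n < S" by (simp add: S_def power2_eq_square)
qed

definition base :: "(nat \<Rightarrow> nat) \<Rightarrow> bool" where
  "base r \<longleftrightarrow> r 0 = 0 \<and> r 1 = 1 \<and> r 2 = k \<and> r 3 = n \<and> r 4 = S \<and> r 5 = 2 * S \<and> r 6 = 3 * S \<and>
     r 7 = 4 * S \<and> r 8 = 5 * S"

definition static :: "(nat \<Rightarrow> nat) \<Rightarrow> bool" where
  "static m \<longleftrightarrow> (\<forall>v<n. m (S + v) = addr v \<and> m (addr v) = deg v \<and> (\<forall>i<deg v. m (addr v + Suc i) = adj ! v ! i))"


section \<open>Correctness and cost of the witness check\<close>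

definition hit :: "(nat \<Rightarrow> nat) \<Rightarrow> nat \<Rightarrow> nat \<Rightarrow> bool" where
  "hit m v x \<longleftrightarrow> (\<exists>u\<in>nbrs v. m (4 * S + u) = x)"

definition good :: "(nat \<Rightarrow> nat) \<Rightarrow> nat \<Rightarrow> nat \<Rightarrow> bool" where
  "good m i v \<longleftrightarrow> m (4 * S + v) = i \<and> (\<forall>j<i. hit m v j)"

lemma hoare_scan:
  assumes b: "base r" and s: "static m" and v: "r 22 < n"
  shows "hoare w scan (9 + 11 * deg (r 22)) r m (\<lambda>r' m'. m' = m \<and>
    keeps {15, 16, 17, 18, 21} r r' \<and> r' 21 = of_bool (hit m (r 22) (r 20)))"
proof -
  let ?v = "r 22"
  let ?I = "\<lambda>i r' m'. m' = m \<and> keeps {15, 16, 17, 18, 21} r r' \<and>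
    r' 15 = addr ?v + i \<and> r' 16 = deg ?v + addr ?v \<and>
    r' 21 = (of_bool (\<exists>u\<in>set (take i (adj ! ?v)). m (4 * S + u) = r 20) :: nat)"
  have bounds: "8 * S < 2 ^ w" "n < S" using S_word n_S by auto
  have adv: "addr ?v + deg ?v < S" using addr_dg_less[OF v] .
  note br = b[unfolded base_def]
  have d: "hoare w scan_loop ((\<Sum>i<deg ?v. 9 + 2) + 2) r' m (?I (deg ?v))" if "?I 0 r' m" for r'
    unfolding scan_loop_def
  proof (rule hoare_for[where I = ?I and N = "deg ?v" and T = "\<lambda>_. 9"])
    show "?I 0 r' m" by fact
  next
    fix i r' m' assume I: "?I i r' m'" and i: "i < deg ?v"
    then have kd: "x \<notin> {15, 16, 17, 18, 21} \<Longrightarrow> r' x = r x" for x using keepsD by blast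
    have u: "adj ! ?v ! i < n" using nbrs_less[OF v] i by (simp add: nbrs_def deg_def)
    have m: "m (addr ?v + Suc i) = adj ! ?v ! i" "m (Suc (addr ?v + i)) = adj ! ?v ! i"
      using s v i by (auto simp: static_def)
    have tk: "set (take (Suc i) (adj ! ?v)) = insert (adj ! ?v ! i) (set (take i (adj ! ?v)))"
      using i by (simp add: take_Suc_conv_app_nth deg_def)
    show "r' 15 < r' 16 \<and> hoare w (Ins (Add 15 15 1) ;; Ins (Load 17 15) ;; Ins (Add 18 7 17) ;;
       Ins (Load 18 18) ;; ifeq 18 20 (Ins (Const 21 1))) 9 r' m' (\<lambda>r' m'. r' 0 < r' 1 \<and> ?I (Suc i) r' m')"
      apply (rule conjI)
      subgoal using I i by simp
      apply (rule hoareI)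
      using I i u br adv bounds
      by (simp add: m tk kd)
  qed (use br in \<open>auto simp: keepsD\<close>)
  show ?thesis
    unfolding scan_def
    apply (rule hoareK)
    subgoal premises K for Y t q K
      using v bounds adv
      apply (simp add: br s[unfolded static_def])
      apply (rule hoare_use[OF d])
        apply simp
       apply simp
      apply (rule K)
       apply simp
      apply (simp add: hit_def nbrs_def deg_def)
      done
    done
qed

lemma hoare_color_loop:
  assumes b: "base r" and s: "static m" and v: "r 22 < n" and i: "r 25 \<le> k" and r: "r 20 = 0" "r 27 = 1"
  shows "hoare w color_loop (k * (13 + 11 * deg (r 22)) + 2) r m (\<lambda>r' m'. m' = m \<and>
    keeps {15, 16, 17, 18, 20, 21, 27} r r' \<and> r' 27 = of_bool (\<forall>j<r 25. hit m (r 22) j))"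
proof -
  let ?I = "\<lambda>j r' m'. m' = m \<and> keeps {15, 16, 17, 18, 20, 21, 27} r r' \<and>
    r' 20 = j \<and> r' 27 = (of_bool (\<forall>j'<j. hit m (r 22) j') :: nat)"
  have bounds: "8 * S < 2 ^ w" "n < S" "k \<le> n" using S_word n_S n2 by auto
  note br = b[unfolded base_def]
  have "hoare w color_loop ((\<Sum>j<r 25. (11 + 11 * deg (r 22)) + 2) + 2) r m (?I (r 25))"
    unfolding color_loop_def
  proof (rule hoare_for[where I = ?I and N = "r 25" and T = "\<lambda>_. 11 + 11 * deg (r 22)"])
    show "?I 0 r m" using r by simp
  next
    fix j r' m' assume I: "?I j r' m'" and j: "j < r 25"
    have kd: "x \<notin> {15, 16, 17, 18, 20, 21, 27} \<Longrightarrow> r' x = r x" for x using I keepsD by blast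
    have b': "base r'" using br by (simp add: base_def kd)
    have m': "m' = m" using I by simp
    have sc: "hoare w scan (9 + 11 * deg (r 22)) r' m (\<lambda>r'' m'. m' = m \<and>
        keeps {15, 16, 17, 18, 21} r' r'' \<and> r'' 21 = of_bool (hit m (r 22) j))"
      using hoare_scan[OF b' s] I v by (simp add: kd)
    show "r' 20 < r' 25 \<and> hoare w (Block scan ;; Ins (Mul 27 27 21) ;; Ins (Add 20 20 1))
      (11 + 11 * deg (r 22)) r' m' (\<lambda>r' m'. r' 0 < r' 1 \<and> ?I (Suc j) r' m')"
    proof
      show "r' 20 < r' 25" using I j by (simp add: kd)
      show "hoare w (Block scan ;; Ins (Mul 27 27 21) ;; Ins (Add 20 20 1))
        (11 + 11 * deg (r 22)) r' m' (\<lambda>r' m'. r' 0 < r' 1 \<and> ?I (Suc j) r' m')"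
        apply (rule hoareK)
        subgoal premises K for Y t q K
          unfolding m'
          apply simp
          apply (rule hoare_use[OF sc])
           apply simp
          subgoal premises q for r'' m''
          proof -
            have kd': "x \<notin> {15, 16, 17, 18, 21} \<Longrightarrow> r'' x = r' x" for x using q keepsD by blast
            have kp: "keeps {15, 16, 17, 18, 20, 21, 27} r r''"
              using keeps_trans[of _ r r' _ r''] I q by blast
            show ?thesis
              using I j i bounds br q kp
              by (simp add: kd kd') (intro conjI impI K; simp add: kd kd' All_less_Suc)
          qed
          done
        done
    qed
  qed (use br in \<open>auto simp: keepsD\<close>)
  then show ?thesis
  proof (rule hoare_conseq)
    show "(\<Sum>j<r 25. (11 + 11 * deg (r 22)) + 2) + 2 \<le> k * (13 + 11 * deg (r 22)) + 2"
      using mult_le_mono1[OF i, of "13 + 11 * deg (r 22)"] by simp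
  qed auto
qed


text \<open>Every vertex is charged \<open>k\<close> scans of its list. Over the \<open>k\<close>
  classes this makes the check of order \<open>k^2 * (m + n)\<close>, the dominant cost of a
  trial.\<close>

definition vertex_time :: nat where
  "vertex_time = (\<Sum>v<n. (13 + k * (13 + 11 * deg v)) + 2) + 2"

lemma hoare_vertex_loop:
  assumes b: "base r" and s: "static m" and i: "r 25 < k" and r: "r 22 = 0" "r 23 = 0"
  shows "hoare w vertex_loop vertex_time r m (\<lambda>r' m'. m' = m \<and>
    keeps {15, 16, 17, 18, 20, 21, 22, 23, 27} r r' \<and>
    r' 23 = of_bool (\<exists>v<n. good m (r 25) v))"
proof -
  let ?I = "\<lambda>v r' m'. m' = m \<and> keeps {15, 16, 17, 18, 20, 21, 22, 23, 27} r r' \<and>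
    r' 22 = v \<and> r' 23 = (of_bool (\<exists>v'<v. good m (r 25) v') :: nat)"
  have bounds: "8 * S < 2 ^ w" "n < S" "k \<le> n" using S_word n_S n2 by auto
  note br = b[unfolded base_def]
  have "hoare w vertex_loop vertex_time r m (?I n)"
    unfolding vertex_loop_def vertex_time_def
  proof (rule hoare_for[where I = ?I and N = n and T = "\<lambda>v. 13 + k * (13 + 11 * deg v)"])
    show "?I 0 r m" using r by simp
  next
    fix v r' m' assume I: "?I v r' m'" and v: "v < n"
    have m': "m' = m" using I by simp
    have kd: "x \<notin> {15, 16, 17, 18, 20, 21, 22, 23, 27} \<Longrightarrow> r' x = r x" for x using I keepsD by blast
    have b': "base r'" using br by (simp add: base_def kd)
    show "r' 22 < r' 3 \<and> hoare w (Ins (Add 18 7 22) ;; Ins (Load 18 18) ;;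
     ifeq 18 25 (Ins (Const 27 1) ;; Ins (Const 20 0) ;; Block color_loop ;;
       IfLess 0 27 (Ins (Const 23 1)) Skip) ;; Ins (Add 22 22 1)) (13 + k * (13 + 11 * deg v)) r' m'
       (\<lambda>r' m'. r' 0 < r' 1 \<and> ?I (Suc v) r' m')"
      unfolding m'
      apply (rule conjI)
      subgoal using I v br by (simp add: kd)
      apply (rule hoareK)
      subgoal premises K for Y t q K
      proof (cases "m (4 * S + v) = r 25")
        case False
        then have g: "\<not> good m (r 25) v" by (simp add: good_def)
        then show ?thesis
          using I v bounds br False
          by (simp add: kd) (intro conjI impI K; simp add: kd Ex_less_Suc)
      next
        case True
        then have g: "good m (r 25) v = (\<forall>j<r 25. hit m v j)" by (simp add: good_def)
        have e: "r' (Suc 0) = Suc 0" "r' 0 = 0" using b' by (auto simp: base_def)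
        show ?thesis
          using I v bounds br True i
          apply (simp add: kd)
          apply (rule hoare_use[OF hoare_color_loop])
                apply (use b' in \<open>simp add: base_def\<close>)
               apply (rule s)
               apply (simp add: kd)
              apply (simp add: kd)
             apply simp
            apply simp
           apply simp
          subgoal premises q for r'' m''
          proof -
            have kd': "x \<notin> {15, 16, 17, 18, 20, 21, 27} \<Longrightarrow> x \<noteq> 22 \<Longrightarrow> x \<noteq> 23 \<Longrightarrow> r'' x = r' x"
              "r'' 22 = r' 22" "r'' 23 = r' 23" for x using q by (auto simp: keeps_def)
            have kp: "keeps {15, 16, 17, 18, 20, 21, 22, 23, 27} r r''"
              using I q by (simp add: keeps_def)
            show ?thesis
              using I v bounds br i kp q
              by (simp add: kd kd' e) (intro conjI impI K; simp add: kd kd' g Ex_less_Suc)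
          qed
          done
      qed
      done
  qed (use br in \<open>auto simp: keepsD\<close>)
  then show ?thesis by (rule hoare_conseq) auto
qed

lemma hoare_class_loop:
  assumes b: "base r" and s: "static m" and r: "r 25 = 0" "r 24 = 1"
  shows "hoare w class_loop (k * (6 + vertex_time) + 2) r m (\<lambda>r' m'. m' = m \<and>
    keeps {15, 16, 17, 18, 20, 21, 22, 23, 24, 25, 27} r r' \<and>
    r' 24 = of_bool (\<forall>i<k. \<exists>v<n. good m i v))"
proof -
  let ?I = "\<lambda>i r' m'. m' = m \<and>
    keeps {15, 16, 17, 18, 20, 21, 22, 23, 24, 25, 27} r r' \<and>
    r' 25 = i \<and> r' 24 = (of_bool (\<forall>i'<i. \<exists>v<n. good m i' v) :: nat)"
  have bounds: "8 * S < 2 ^ w" "n < S" "k \<le> n" using S_word n_S n2 by auto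
  note br = b[unfolded base_def]
  have "hoare w class_loop ((\<Sum>i<k. (4 + vertex_time) + 2) + 2) r m (?I k)"
    unfolding class_loop_def
  proof (rule hoare_for[where I = ?I and N = k and T = "\<lambda>_. 4 + vertex_time"])
    show "?I 0 r m" using r by simp
  next
    fix i r' m' assume I: "?I i r' m'" and i: "i < k"
    have m': "m' = m" using I by simp
    have kd: "x \<notin> {15, 16, 17, 18, 20, 21, 22, 23, 24, 25, 27} \<Longrightarrow> r' x = r x" for x using I keepsD by blast
    have b': "base r'" using br by (simp add: base_def kd)
    show "r' 25 < r' 2 \<and> hoare w (Ins (Const 23 0) ;; Ins (Const 22 0) ;; Block vertex_loop ;;
     Ins (Mul 24 24 23) ;; Ins (Add 25 25 1)) (4 + vertex_time) r' m'
       (\<lambda>r' m'. r' 0 < r' 1 \<and> ?I (Suc i) r' m')"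
      unfolding m'
      apply (rule conjI)
      subgoal using I i br by (simp add: kd)
      apply (rule hoareK)
      subgoal premises K for Y t q K
        using I i bounds br
        apply (simp add: kd)
        apply (rule hoare_use[OF hoare_vertex_loop])
             apply (use b' in \<open>simp add: base_def\<close>)
            apply (rule s)
           apply (simp add: kd)
          apply simp
         apply simp
        apply simp
        subgoal premises q for r'' m''
        proof -
          have kd': "x \<notin> {15, 16, 17, 18, 20, 21, 22, 23, 27} \<Longrightarrow> r'' x = r' x" for x
            using q by (auto simp: keeps_def)
          have kp: "keeps {15, 16, 17, 18, 20, 21, 22, 23, 24, 25, 27} r r''"
            using I q by (simp add: keeps_def)
          show ?thesis
            using I i bounds br kp q
            by (simp add: kd kd') (intro conjI impI K; simp add: kd kd' All_less_Suc)
        qed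
        done
      done
  qed (use br in \<open>auto simp: keepsD\<close>)
  then show ?thesis by (rule hoare_conseq) auto
qed

lemma hoare_clear_loop:
  assumes b: "base r" and r: "r 14 = 0"
  shows "hoare w clear_loop (5 * n + 2) r m (\<lambda>r' m'. keeps {14, 18} r r' \<and>
    m' = (\<lambda>x. if 4 * S \<le> x \<and> x < 4 * S + n then k else m x))"
proof -
  let ?I = "\<lambda>i r' m'. keeps {14, 18} r r' \<and> r' 14 = i \<and>
    m' = (\<lambda>x. if 4 * S \<le> x \<and> x < 4 * S + i then k else m x)"
  have bounds: "8 * S < 2 ^ w" "n < S" "k \<le> n" using S_word n_S n2 by auto
  note br = b[unfolded base_def]
  have "hoare w clear_loop ((\<Sum>i<n. 3 + 2) + 2) r m (?I n)"
    unfolding clear_loop_def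
  proof (rule hoare_for[where I = ?I and N = n and T = "\<lambda>_. 3"])
    show "?I 0 r m" using r by auto
  next
    fix i r' m' assume I: "?I i r' m'" and i: "i < n"
    then have kd: "x \<notin> {14, 18} \<Longrightarrow> r' x = r x" for x using keepsD by blast
    show "r' 14 < r' 3 \<and> hoare w (Ins (Add 18 7 14) ;; Ins (Store 18 2) ;; Ins (Add 14 14 1)) 3 r' m'
       (\<lambda>r' m'. r' 0 < r' 1 \<and> ?I (Suc i) r' m')"
      apply (rule conjI)
      subgoal using I i br by (simp add: kd)
      apply (rule hoareI)
      using I i br bounds
      by (simp add: kd fun_eq_iff)
  qed (use br in \<open>auto simp: keepsD\<close>)
  then show ?thesis by (rule hoare_conseq) auto
qed

section \<open>The trial counter\<close>

definition counter_val :: "nat \<Rightarrow> nat \<Rightarrow> (nat \<Rightarrow> nat) \<Rightarrow> nat" where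
  "counter_val N i m = (\<Sum>j<i. m (5 * S + j) * N ^ j)"

text \<open>The carry starts as the 1 to be added. After \<open>i\<close> digits, new value plus
  carry times \<open>N^i\<close> equals old value plus 1 on these digits; a carry left at the end
  signals overflow.\<close>

lemma hoare_odo_loop:
  assumes b: "base r" and r: "r 14 = 0" "r 28 = 1" "r 13 = L" "r 12 = N"
    and L: "L \<le> 2 * S" and N: "1 \<le> N" "N \<le> S" and dig: "\<forall>j<L. m (5 * S + j) < N"
  shows "hoare w odo_loop (11 * L + 2) r m (\<lambda>r' m'. keeps {14, 18, 19, 28} r r' \<and>
    (\<forall>x<5 * S. m' x = m x) \<and> (\<forall>j<L. m' (5 * S + j) < N) \<and> r' 28 \<le> 1 \<and>
    counter_val N L m' + r' 28 * N ^ L = counter_val N L m + 1)"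
proof -
  let ?I = "\<lambda>i r' m'. keeps {14, 18, 19, 28} r r' \<and> r' 14 = i \<and>
    (\<forall>x. x < 5 * S \<or> 5 * S + i \<le> x \<longrightarrow> m' x = m x) \<and> (\<forall>j<i. m' (5 * S + j) < N) \<and> r' 28 \<le> (1::nat) \<and>
    counter_val N i m' + r' 28 * N ^ i = counter_val N i m + 1"
  have bounds: "8 * S < 2 ^ w" "n < S" "k \<le> n" using S_word n_S n2 by auto
  note br = b[unfolded base_def]
  have "hoare w odo_loop ((\<Sum>i<L. 9 + 2) + 2) r m (?I L)"
    unfolding odo_loop_def
  proof (rule hoare_for[where I = ?I and N = L and T = "\<lambda>_. 9"])
    show "?I 0 r m" using r by (auto simp: counter_val_def)
  next
    fix i r' m' assume I: "?I i r' m'" and i: "i < L"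
    then have kd: "x \<notin> {14, 18, 19, 28} \<Longrightarrow> r' x = r x" for x using keepsD by blast
    have mi: "m' (5 * S + i) = m (5 * S + i)" using I by simp
    have dN: "m (5 * S + i) < N" using dig i by simp
    have upd: "counter_val N (Suc i) (m'(5 * S + i := x)) = counter_val N i m' + x * N ^ i" for x
      unfolding counter_val_def by (auto intro: sum.cong)
    have vs: "counter_val N (Suc i) m = counter_val N i m + m (5 * S + i) * N ^ i" unfolding counter_val_def by simp
    have inv: "counter_val N i m' + r' 28 * N ^ i = counter_val N i m + 1" "r' 28 \<le> 1" using I by auto
    have lo: "counter_val N i m' + (m (5 * S + i) + r' 28) * N ^ i = counter_val N (Suc i) m + 1"
      using inv(1) unfolding vs by (simp add: algebra_simps)
    \<comment> \<open>Digit plus carry is at most \<open>N\<close>, so a failed comparison means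
      equality: digit 0 and carry 1 represent \<open>N\<close>.\<close>
    have hi: "counter_val N i m' + N * N ^ i = counter_val N (Suc i) m + 1" if "\<not> m (5 * S + i) + r' 28 < N"
    proof -
      have "m (5 * S + i) + r' 28 = N" using that dN inv(2) by linarith
      then show ?thesis using lo by simp
    qed
    show "r' 14 < r' 13 \<and> hoare w (Ins (Add 18 8 14) ;; Ins (Load 19 18) ;; Ins (Add 19 19 28) ;;
     IfLess 19 12 (Ins (Const 28 0)) (Ins (Const 28 1) ;; Ins (Const 19 0)) ;;
     Ins (Store 18 19) ;; Ins (Add 14 14 1)) 9 r' m'
       (\<lambda>r' m'. r' 0 < r' 1 \<and> ?I (Suc i) r' m')"
      apply (rule conjI)
      subgoal using I i r by (simp add: kd)
      apply (rule hoareI)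
      using I i br bounds r L N dN
      apply (simp add: mi upd lo hi less_Suc_eq kd)
      apply linarith
      done
  qed (use br r in \<open>auto simp: keepsD\<close>)
  then show ?thesis by (rule hoare_conseq) auto
qed

end

section \<open>Peeling\<close>

definition init_loop :: com where
  "init_loop = WhileLess 14 3 (Ins (Add 18 4 14) ;; Ins (Store 18 15) ;; Ins (Load 19 15) ;;
     Ins (Add 18 5 14) ;; Ins (Store 18 19) ;; Ins (Add 15 15 19) ;; Ins (Add 15 15 1) ;;
     Ins (Add 14 14 1))"

text \<open>Vertices below the threshold are scheduled already, so it suffices to look for
  equality.\<close>

definition level_loop :: com where
  "level_loop = WhileLess 14 3 (Ins (Add 18 5 14) ;; Ins (Load 18 18) ;;
     ifeq 18 9 (Ins (Add 18 6 11) ;; Ins (Store 18 14) ;; Ins (Add 11 11 1)) ;; Ins (Add 14 14 1))"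

text \<open>Lowers the remaining degree of all neighbors, even of removed ones. The equality test
  fires exactly when a vertex drops from \<open>D + 1\<close> to \<open>D\<close>; scheduled
  vertices are at most \<open>D\<close> beforehand and never fire it, so none is queued
  twice.\<close>

definition dec_loop :: com where
  "dec_loop = WhileLess 15 16 (Ins (Add 15 15 1) ;; Ins (Load 17 15) ;; Ins (Add 18 5 17) ;;
     Ins (Load 19 18) ;; Ins (Sub 19 19 1) ;; Ins (Store 18 19) ;;
     ifeq 19 9 (Ins (Add 18 6 11) ;; Ins (Store 18 17) ;; Ins (Add 11 11 1)))"

definition queue_loop :: com where
  "queue_loop = WhileLess 10 11 (Ins (Add 18 6 10) ;; Ins (Load 14 18) ;; Ins (Add 10 10 1) ;;
     Ins (Add 18 4 14) ;; Ins (Load 15 18) ;; Ins (Load 16 15) ;; Ins (Add 16 16 15) ;;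
     Block dec_loop)"

definition peel_loop :: com where
  "peel_loop = WhileLess 11 3 (Ins (Const 14 0) ;; Block level_loop ;; Block queue_loop ;;
     Ins (Add 9 9 1))"

context grundy_instance
begin

section \<open>Invariants of the peeling queue\<close>

definition input_at :: "(nat \<Rightarrow> nat) \<Rightarrow> bool" where
  "input_at m \<longleftrightarrow> (\<forall>v<n. m (addr v) = deg v \<and> (\<forall>i<deg v. m (addr v + Suc i) = adj ! v ! i))"

lemma static_inp: "static m \<longleftrightarrow> input_at m \<and> (\<forall>v<n. m (S + v) = addr v)"
  unfolding static_def input_at_def by blast

lemma input_at_upd [simp]: assumes "S \<le> a" shows "input_at (m(a := x)) \<longleftrightarrow> input_at m"
proof -
  have "v < n \<Longrightarrow> addr v \<noteq> a" "v < n \<Longrightarrow> i < deg v \<Longrightarrow> addr v + Suc i \<noteq> a"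
     for v i
    using addr_dg_less[of v] assms by auto
  then show ?thesis unfolding input_at_def by (metis (no_types, lifting) fun_upd_other)
qed

lemma static_upd [simp]: "2 * S \<le> a \<Longrightarrow> static (m(a := x)) \<longleftrightarrow> static m"
  using n_S by (auto simp: static_inp)

definition rest_deg :: "(nat \<Rightarrow> nat) \<Rightarrow> nat \<Rightarrow> nat" where "rest_deg m v = m (2 * S + v)"
definition queue :: "(nat \<Rightarrow> nat) \<Rightarrow> nat \<Rightarrow> nat" where "queue m i = m (3 * S + i)"

lemma rest_deg_upd [simp]:
  "rest_deg (m(2 * S + u := x)) v = (if v = u then x else rest_deg m v)"
  "v < n \<Longrightarrow> rest_deg (m(3 * S + i := x)) v = rest_deg m v"
  using n_S by (auto simp: rest_deg_def)

lemma queue_upd [simp]: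
  "u < n \<Longrightarrow> queue (m(2 * S + u := x)) = queue m"
  "queue (m(3 * S + i := x)) = (queue m)(i := x)"
  using n_S by (auto simp: queue_def fun_eq_iff)

lemma hoare_init_loop:
  assumes b: "base r" and r: "r 14 = 0" "r 15 = 2" and i: "input_at m" and z: "\<forall>x\<ge>S. m x = 0"
  shows "hoare w init_loop (10 * n + 2) r m (\<lambda>r' m'. keeps {14, 15, 18, 19} r r' \<and> static m' \<and>
    (\<forall>v<n. rest_deg m' v = deg v) \<and> (\<forall>x\<ge>3 * S. m' x = 0))"
proof -
  let ?I = "\<lambda>v r' m'. keeps {14, 15, 18, 19} r r' \<and> r' 14 = v \<and> r' 15 = addr v \<and> input_at m' \<and>
    (\<forall>u<v. m' (S + u) = addr u \<and> rest_deg m' u = deg u) \<and> (\<forall>x\<ge>3 * S. m' x = 0)"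
  have bounds: "8 * S < 2 ^ w" "n < S" using S_word n_S by auto
  note br = b[unfolded base_def]
  have "hoare w init_loop ((\<Sum>v<n. 8 + 2) + 2) r m (?I n)"
    unfolding init_loop_def
  proof (rule hoare_for[where I = ?I and N = n and T = "\<lambda>_. 8"])
    show "?I 0 r m" using r i z by (auto simp: addr_def)
  next
    fix v r' m' assume I: "?I v r' m'" and v: "v < n"
    have kd: "x \<notin> {14, 15, 18, 19} \<Longrightarrow> r' x = r x" for x using I keepsD by blast
    have a: "addr v + deg v < S" using addr_dg_less[OF v] .
    have m: "m' (addr v) = deg v" using I v by (simp add: input_at_def)
    have nS: "addr v \<noteq> S + v" using a by simp
    let ?m = "m'(S + v := addr v, 2 * S + v := deg v)"
    have "?m (S + u) = addr u \<and> rest_deg ?m u = deg u" if "u < Suc v" for u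
      using that I v bounds(2) by (auto simp: rest_deg_def less_Suc_eq)
    then have A: "\<forall>u<Suc v. ?m (S + u) = addr u \<and> rest_deg ?m u = deg u" by blast
    have B: "\<forall>x\<ge>3 * S. ?m x = 0" using I v bounds(2) by auto
    have C: "input_at ?m" using I by simp
    show "r' 14 < r' 3 \<and> hoare w (Ins (Add 18 4 14) ;; Ins (Store 18 15) ;; Ins (Load 19 15) ;;
     Ins (Add 18 5 14) ;; Ins (Store 18 19) ;; Ins (Add 15 15 19) ;; Ins (Add 15 15 1) ;;
     Ins (Add 14 14 1)) 8 r' m' (\<lambda>r' m'. r' 0 < r' 1 \<and> ?I (Suc v) r' m')"
      apply (rule conjI)
      subgoal using I v br by (simp add: kd)
      apply (rule hoareK)
      subgoal premises K for Y t q K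
        using I br v bounds a
        apply (simp add: kd m nS)
        apply (rule K)
         apply simp
        using A B C
        apply (simp add: kd addr_Suc del: rest_deg_upd)
        done
      done
  qed (use br in \<open>auto simp: keepsD\<close>)
  then show ?thesis by (rule hoare_conseq) (auto simp: static_inp)
qed

text \<open>
  The vertices \<open>queue m ` {..<h}\<close> have been removed from the graph, those up to the tail \<open>\<tau>\<close> are scheduled.
  A vertex is scheduled as soon as its remaining degree is small enough, so the queue itself is the
  peeling order. The parameter \<open>a\<close> of \<open>level_inv\<close> and the parameter \<open>e\<close> of \<open>dec_inv\<close> count the iterations of
  \<open>level_loop\<close> and \<open>dec_loop\<close>.
\<close>

definition queue_inv :: "nat \<Rightarrow> nat \<Rightarrow> nat \<Rightarrow> (nat \<Rightarrow> nat) \<Rightarrow> bool" where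
  "queue_inv h \<tau> D m \<longleftrightarrow> static m \<and> (\<forall>x\<ge>4 * S. m x = 0) \<and> h \<le> \<tau> \<and> \<tau> \<le> n \<and> inj_on (queue m) {..<\<tau>} \<and>
     queue m ` {..<\<tau>} \<subseteq> {..<n} \<and> (\<forall>i<h. card (nbrs (queue m i) - queue m ` {..<i}) < D)"

definition level_inv :: "nat \<Rightarrow> nat \<Rightarrow> nat \<Rightarrow> nat \<Rightarrow> (nat \<Rightarrow> nat) \<Rightarrow> bool" where
  "level_inv D h a \<tau> m \<longleftrightarrow> queue_inv h \<tau> D m \<and> (\<forall>v<n. rest_deg m v = card (nbrs v - queue m ` {..<h})) \<and>
     (\<forall>v<n. v \<in> queue m ` {..<\<tau>} \<longleftrightarrow> rest_deg m v < D \<or> v < a \<and> rest_deg m v = D)"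

definition dec_inv :: "nat \<Rightarrow> nat set \<Rightarrow> nat \<Rightarrow> nat \<Rightarrow> nat \<Rightarrow> nat \<Rightarrow> (nat \<Rightarrow> nat) \<Rightarrow> bool" where
  "dec_inv v A D h e \<tau> m \<longleftrightarrow> queue_inv h \<tau> (Suc D) m \<and> h < \<tau> \<and> queue m h = v \<and> queue m ` {..<h} = A \<and>
     (\<forall>u<n. rest_deg m u + of_bool (u \<in> set (take e (adj ! v))) = card (nbrs u - A)) \<and>
     (\<forall>u<n. u \<in> queue m ` {..<\<tau>} \<longleftrightarrow> rest_deg m u \<le> D)"

lemma image_upd_lessThan: "i \<le> \<tau> \<Longrightarrow> (f(\<tau> := u)) ` {..<i} = f ` {..<(i::nat)}"
  by (intro image_cong) auto

lemma image_upd_Suc: "(f(\<tau> := u)) ` {..<Suc \<tau>} = insert u (f ` {..<(\<tau>::nat)})"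
  unfolding lessThan_Suc image_insert using image_upd_lessThan[of \<tau> \<tau> f u] by simp

lemma queue_push:
  "i \<le> \<tau> \<Longrightarrow> queue (m(3 * S + \<tau> := u)) ` {..<i} = queue m ` {..<i}"
  "queue (m(3 * S + \<tau> := u)) ` {..<Suc \<tau>} = insert u (queue m ` {..<\<tau>})"
  using image_upd_lessThan[of i \<tau> "queue m" u] image_upd_Suc[of "queue m" \<tau> u] by simp_all

text \<open>Pigeonhole: the queue holds distinct vertices below \<open>n\<close> and misses
  \<open>u\<close>, so there is room, and the write stays inside the block from \<open>3 * S\<close>
  to \<open>4 * S\<close>.\<close>

lemma queue_inv_push:
  assumes q: "queue_inv h \<tau> D m" and u: "u < n" "u \<notin> queue m ` {..<\<tau>}"
  shows "queue_inv h (Suc \<tau>) D (m(3 * S + \<tau> := u))" "\<tau> < n"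
proof -
  have i: "inj_on (queue m) {..<\<tau>}" and s: "queue m ` {..<\<tau>} \<subseteq> {..<n}" using q by (auto simp: queue_inv_def)
  have "card (insert u (queue m ` {..<\<tau>})) \<le> card {..<n}" using s u by (intro card_mono) auto
  then show t: "\<tau> < n" using u i by (simp add: card_image)
  have "inj_on ((queue m)(\<tau> := u)) {..<Suc \<tau>}"
    using i u by (auto simp: lessThan_Suc inj_on_def)
  moreover have "card (nbrs (((queue m)(\<tau> := u)) i) - ((queue m)(\<tau> := u)) ` {..<i}) < D" if "i < h" for i
  proof -
    have "i < \<tau>" using that q by (simp add: queue_inv_def)
    then show ?thesis using that q image_upd_lessThan[of i \<tau> "queue m" u] by (simp add: queue_inv_def)
  qed
  moreover have "((queue m)(\<tau> := u)) ` {..<Suc \<tau>} \<subseteq> {..<n}"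
    unfolding image_upd_Suc using s u by simp
  moreover have "3 * S + \<tau> < 4 * S" using t n_S by simp
  ultimately show "queue_inv h (Suc \<tau>) D (m(3 * S + \<tau> := u))"
    using q u t unfolding queue_inv_def by simp
qed

lemma queue_inv_dl: "queue_inv h \<tau> D m \<Longrightarrow> u < n \<Longrightarrow> queue_inv h \<tau> D (m(2 * S + u := x))"
  using n_S unfolding queue_inv_def by auto

lemma level_inv_push:
  assumes l: "level_inv D h a \<tau> m" and a: "a < n" "rest_deg m a = D"
  shows "level_inv D h (Suc a) (Suc \<tau>) (m(3 * S + \<tau> := a))" "\<tau> < n"
proof -
  have q: "queue_inv h \<tau> D m" and an: "a \<notin> queue m ` {..<\<tau>}" using l a by (auto simp: level_inv_def)
  show "\<tau> < n" by (rule queue_inv_push(2)[OF q a(1) an])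
  have h: "h \<le> \<tau>" using q by (simp add: queue_inv_def)
  show "level_inv D h (Suc a) (Suc \<tau>) (m(3 * S + \<tau> := a))"
    using l a queue_inv_push(1)[OF q a(1) an]
    unfolding level_inv_def queue_push(1)[OF h] queue_push(2) by (auto simp: less_Suc_eq)
qed

lemma level_inv_skip: "level_inv D h a \<tau> m \<Longrightarrow> rest_deg m a \<noteq> D \<Longrightarrow> level_inv D h (Suc a) \<tau> m"
  unfolding level_inv_def by (auto simp: less_Suc_eq)

lemma level_inv_done: "level_inv D h n \<tau> m \<Longrightarrow> level_inv (Suc D) h 0 \<tau> m"
  unfolding level_inv_def queue_inv_def by (auto simp: less_Suc_eq)

lemma level_inv_decM:
  assumes "level_inv (Suc D) h 0 \<tau> m" "h < \<tau>"
  shows "dec_inv (queue m h) (queue m ` {..<h}) D h 0 \<tau> m"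
  using assms unfolding level_inv_def dec_inv_def by auto

text \<open>After the whole list of \<open>v\<close> has been processed, precisely its neighbors
  have been lowered. By symmetry of adjacency these are the vertices that lose a remaining neighbor
  with \<open>v\<close>.\<close>

lemma dec_inv_levelM:
  assumes d: "dec_inv v A D h (deg v) \<tau> m"
  shows "level_inv (Suc D) (Suc h) 0 \<tau> m"
proof -
  have q: "queue_inv h \<tau> (Suc D) m" "h < \<tau>" "queue m h = v" "queue m ` {..<h} = A" using d by (auto simp: dec_inv_def)
  have v: "v < n" using q by (auto simp: queue_inv_def)
  have "inj_on (queue m) {..<\<tau>}" using q by (simp add: queue_inv_def)
  then have vA: "v \<notin> A" using q(2) unfolding q(3)[symmetric] q(4)[symmetric]
    by (auto dest: inj_onD)
  have img: "queue m ` {..<Suc h} = insert v A" using q by (simp add: lessThan_Suc)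
  have rest_deg: "rest_deg m u = card (nbrs u - insert v A)" if u: "u < n" for u
  proof -
    have e: "rest_deg m u + of_bool (u \<in> nbrs v) = card (nbrs u - A)"
      using d u by (simp add: dec_inv_def nbrs_def deg_def)
    have s: "nbrs u - insert v A = (nbrs u - A) - {v}" by auto
    show ?thesis
    proof (cases "v \<in> nbrs u")
      case True
      then have "u \<in> nbrs v" using nbrs_sym[OF u] by simp
      then show ?thesis using e True vA unfolding s by simp
    next
      case False
      then have "u \<notin> nbrs v" using nbrs_sym[OF v] by blast
      then show ?thesis using e False unfolding s by simp
    qed
  qed
  \<comment> \<open>Here the peeling order gets its bound: a scheduled vertex has at most
    \<open>D\<close> neighbors outside the removed set.\<close>
  have "v \<in> queue m ` {..<\<tau>}" using q by auto
  then have "rest_deg m v \<le> D" using d v by (auto simp: dec_inv_def)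
  moreover have "nbrs v - insert v A = nbrs v - A" using nbrs_irrefl[OF v] by auto
  ultimately have "card (nbrs v - A) \<le> D" using rest_deg[OF v] by simp
  then have "queue_inv (Suc h) \<tau> (Suc D) m"
    using q unfolding queue_inv_def by (auto simp: less_Suc_eq)
  then show ?thesis using rest_deg d unfolding level_inv_def dec_inv_def img by (auto simp: less_Suc_eq_le)
qed

text \<open>\<open>v\<close> does not belong to \<open>A\<close> and is thus among the remaining
  neighbors of \<open>u\<close>; since list entries are distinct, \<open>u\<close> has not been
  lowered for \<open>v\<close> before. So the subtraction is not cut off at 0.\<close>

lemma dec_inv_step:
  assumes d: "dec_inv v A D h e \<tau> m" and e: "e < deg v"
  defines "u \<equiv> adj ! v ! e"
  shows "u < n" "0 < rest_deg m u"
    "rest_deg m u - 1 = D \<Longrightarrow> dec_inv v A D h (Suc e) (Suc \<tau>) (m(2 * S + u := D, 3 * S + \<tau> := u)) \<and> \<tau> < n"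
    "rest_deg m u - 1 \<noteq> D \<Longrightarrow> dec_inv v A D h (Suc e) \<tau> (m(2 * S + u := rest_deg m u - 1))"
proof -
  have q: "queue_inv h \<tau> (Suc D) m" "h < \<tau>" "queue m h = v" "queue m ` {..<h} = A" using d by (auto simp: dec_inv_def)
  have v: "v < n" using q by (auto simp: queue_inv_def)
  have "inj_on (queue m) {..<\<tau>}" using q by (simp add: queue_inv_def)
  then have vA: "v \<notin> A" using q(2) unfolding q(3)[symmetric] q(4)[symmetric]
    by (auto dest: inj_onD)
  have uv: "u \<in> nbrs v" using e by (simp add: u_def nbrs_def deg_def)
  show u: "u < n" using nbrs_less[OF v uv] .
  have tk: "set (take (Suc e) (adj ! v)) = insert u (set (take e (adj ! v)))"
    using e by (simp add: take_Suc_conv_app_nth deg_def u_def)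
  have ut: "u \<notin> set (take e (adj ! v))"
    using distinct_adj[OF v] e distinct_take[of "adj ! v" "Suc e"]
    by (simp add: take_Suc_conv_app_nth deg_def u_def)
  have "v \<in> nbrs u - A" using nbrs_sym[OF v uv] vA by simp
  then have "0 < card (nbrs u - A)" by (auto simp: card_gt_0_iff)
  then show pos: "0 < rest_deg m u" using d u ut by (auto simp: dec_inv_def)
  have dle: "rest_deg m x + of_bool (x \<in> set (take e (adj ! v))) = card (nbrs x - A)" if "x < n" for x
    using d that by (simp add: dec_inv_def)
  have iff: "x \<in> queue m ` {..<\<tau>} \<longleftrightarrow> rest_deg m x \<le> D" if "x < n" for x using d that by (simp add: dec_inv_def)
  let ?m = "m(2 * S + u := rest_deg m u - 1)"
  have qm: "queue_inv h \<tau> (Suc D) ?m" using queue_inv_dl[OF q(1) u] .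
  have new: "rest_deg ?m x + of_bool (x \<in> set (take (Suc e) (adj ! v))) = card (nbrs x - A)" if "x < n" for x
    using dle[OF that] ut pos unfolding tk by auto
  show "dec_inv v A D h (Suc e) \<tau> ?m" if ne: "rest_deg m u - 1 \<noteq> D"
    unfolding dec_inv_def
  proof (intro conjI allI impI)
    show "\<And>x. x < n \<Longrightarrow> (x \<in> queue ?m ` {..<\<tau>}) = (rest_deg ?m x \<le> D)"
      using iff u pos ne by auto
  qed (use qm q u new in auto)
  show "dec_inv v A D h (Suc e) (Suc \<tau>) (m(2 * S + u := D, 3 * S + \<tau> := u)) \<and> \<tau> < n"
    if eq: "rest_deg m u - 1 = D"
  proof -
    have un: "u \<notin> queue ?m ` {..<\<tau>}" using iff[OF u] eq pos u by simp
    have "dec_inv v A D h (Suc e) (Suc \<tau>) (?m(3 * S + \<tau> := u))"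
      unfolding dec_inv_def
    proof (intro conjI allI impI)
      show "queue_inv h (Suc \<tau>) (Suc D) (?m(3 * S + \<tau> := u))" using queue_inv_push(1)[OF qm u un] .
      show "queue (?m(3 * S + \<tau> := u)) h = v" using q u by simp
      show "queue (?m(3 * S + \<tau> := u)) ` {..<h} = A"
        using q u by (simp add: queue_push del: queue_upd(2))
      show "\<And>x. x < n \<Longrightarrow> rest_deg (?m(3 * S + \<tau> := u)) x + of_bool (x \<in> set (take (Suc e) (adj ! v))) = card (nbrs x - A)"
        using new by simp
      show "\<And>x. x < n \<Longrightarrow> (x \<in> queue (?m(3 * S + \<tau> := u)) ` {..<Suc \<tau>}) = (rest_deg (?m(3 * S + \<tau> := u)) x \<le> D)"
        unfolding queue_push(2) using iff u eq by auto
      show "h < Suc \<tau>" using q by simp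
    qed
    then show ?thesis using eq queue_inv_push(2)[OF qm u un] by simp
  qed
qed


section \<open>The loops of the peeling phase\<close>

lemma hoare_level_loop:
  assumes b: "base r" and r: "r 14 = 0" "r 9 = D" "r 10 = h" and l: "level_inv D h 0 (r 11) m"
  shows "hoare w level_loop (12 * n + 2) r m (\<lambda>r' m'. keeps {11, 14, 18} r r' \<and> level_inv D h n (r' 11) m')"
proof -
  let ?I = "\<lambda>a r' m'. keeps {11, 14, 18} r r' \<and> r' 14 = a \<and> level_inv D h a (r' 11) m'"
  have bounds: "8 * S < 2 ^ w" "n < S" using S_word n_S by auto
  note br = b[unfolded base_def]
  have "hoare w level_loop ((\<Sum>a<n. 10 + 2) + 2) r m (?I n)"
    unfolding level_loop_def
  proof (rule hoare_for[where I = ?I and N = n and T = "\<lambda>_. 10"])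
    show "?I 0 r m" using r l by simp
  next
    fix a r' m' assume I: "?I a r' m'" and a: "a < n"
    have kd: "x \<notin> {11, 14, 18} \<Longrightarrow> r' x = r x" for x using I keepsD by blast
    have l: "level_inv D h a (r' 11) m'" using I by simp
    note st = level_inv_push[OF l a] level_inv_skip[OF l]
    show "r' 14 < r' 3 \<and> hoare w (Ins (Add 18 5 14) ;; Ins (Load 18 18) ;;
     ifeq 18 9 (Ins (Add 18 6 11) ;; Ins (Store 18 14) ;; Ins (Add 11 11 1)) ;; Ins (Add 14 14 1))
     10 r' m' (\<lambda>r' m'. r' 0 < r' 1 \<and> ?I (Suc a) r' m')"
      apply (rule conjI)
      subgoal using I a br by (simp add: kd)
      apply (rule hoareI)
      using I a br bounds r
      apply (cases "rest_deg m' a = D")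
      using st
      by (simp_all add: kd rest_deg_def[symmetric])
  qed (use br in \<open>auto simp: keepsD\<close>)
  then show ?thesis by (rule hoare_conseq) auto
qed

lemma hoare_dec_loop:
  assumes b: "base r" and r: "r 9 = D" "r 15 = addr v" "r 16 = deg v + addr v"
    and l: "dec_inv v A D h 0 (r 11) m" and v: "v < n"
  shows "hoare w dec_loop (15 * deg v + 2) r m (\<lambda>r' m'. keeps {11, 15, 17, 18, 19} r r' \<and>
    dec_inv v A D h (deg v) (r' 11) m')"
proof -
  let ?I = "\<lambda>e r' m'. keeps {11, 15, 17, 18, 19} r r' \<and> r' 15 = addr v + e \<and> dec_inv v A D h e (r' 11) m'"
  have bounds: "8 * S < 2 ^ w" "n < S" using S_word n_S by auto
  have adv: "addr v + deg v < S" using addr_dg_less[OF v] .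
  note br = b[unfolded base_def]
  have "hoare w dec_loop ((\<Sum>e<deg v. 13 + 2) + 2) r m (?I (deg v))"
    unfolding dec_loop_def
  proof (rule hoare_for[where I = ?I and N = "deg v" and T = "\<lambda>_. 13"])
    show "?I 0 r m" using r l by simp
  next
    fix e r' m' assume I: "?I e r' m'" and e: "e < deg v"
    have kd: "x \<notin> {11, 15, 17, 18, 19} \<Longrightarrow> r' x = r x" for x using I keepsD by blast
    have l: "dec_inv v A D h e (r' 11) m'" using I by simp
    note st = dec_inv_step[OF l e]
    have "static m'" using l by (simp add: dec_inv_def queue_inv_def)
    then have m: "m' (Suc (addr v + e)) = adj ! v ! e" using v e by (simp add: static_def)
    show "r' 15 < r' 16 \<and> hoare w (Ins (Add 15 15 1) ;; Ins (Load 17 15) ;; Ins (Add 18 5 17) ;;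
     Ins (Load 19 18) ;; Ins (Sub 19 19 1) ;; Ins (Store 18 19) ;;
     ifeq 19 9 (Ins (Add 18 6 11) ;; Ins (Store 18 17) ;; Ins (Add 11 11 1)))
     13 r' m' (\<lambda>r' m'. r' 0 < r' 1 \<and> ?I (Suc e) r' m')"
      apply (rule conjI)
      subgoal using I e r by (simp add: kd)
      apply (rule hoareI)
      using I e br bounds r adv
      apply (cases "rest_deg m' (adj ! v ! e) - 1 = D")
      using st
      by (simp_all add: kd m rest_deg_def[symmetric])
  qed (use br r in \<open>auto simp: keepsD\<close>)
  then show ?thesis by (rule hoare_conseq) auto
qed

text \<open>Potential of the queue loop: every vertex not yet removed still has to pay for one pass
  over its list, in whatever order the removals come.\<close>

definition pending_cost :: "nat \<Rightarrow> (nat \<Rightarrow> nat) \<Rightarrow> nat" where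
  "pending_cost h m = (\<Sum>v\<in>{..<n} - queue m ` {..<h}. 11 + 15 * deg v)"

lemma hoare_queue_loop:
  assumes b: "base r" and r: "r 9 = D" and l: "level_inv (Suc D) (r 10) 0 (r 11) m"
  shows "hoare w queue_loop ((\<Sum>v<n. 11 + 15 * deg v) + 2) r m
    (\<lambda>r' m'. base r' \<and> r' 9 = D \<and> r' 10 = r' 11 \<and> level_inv (Suc D) (r' 10) 0 (r' 11) m')"
proof -
  let ?J = "\<lambda>x r' m'. base r' \<and> r' 9 = D \<and> level_inv (Suc D) (r' 10) 0 (r' 11) m' \<and> x = pending_cost (r' 10) m'"
  have bounds: "8 * S < 2 ^ w" "n < S" using S_word n_S by auto
  have "hoare w queue_loop (pending_cost (r 10) m + 2) r m (\<lambda>r m. \<not> r 10 < r 11 \<and> (\<exists>x. ?J x r m))"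
    unfolding queue_loop_def
  proof (rule hoare_while[where J = ?J and \<phi> = "\<lambda>x. x"])
    show "?J (pending_cost (r 10) m) r m" using b r l by simp
  next
    fix x r m assume J: "?J x r m" and lt: "r 10 < r 11"
    note br = conjunct1[OF J, unfolded base_def]
    define v where "v = queue m (r 10)"
    define A where "A = queue m ` {..<r 10}"
    have d: "dec_inv v A D (r 10) 0 (r 11) m" unfolding v_def A_def using level_inv_decM J lt by blast
    have q: "queue_inv (r 10) (r 11) (Suc D) m" using d by (simp add: dec_inv_def)
    have v: "v < n" using q lt by (auto simp: queue_inv_def v_def)
    have s: "static m" using q by (simp add: queue_inv_def)
    have mv: "m (3 * S + r 10) = v" by (simp add: v_def queue_def)
    have adv: "addr v + deg v < S" using addr_dg_less[OF v] .
    have h: "r 10 < n" using q lt by (simp add: queue_inv_def)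
    have "inj_on (queue m) {..<r 11}" using q by (simp add: queue_inv_def)
    then have vA: "v \<notin> A" unfolding v_def A_def using lt by (auto dest: inj_onD)
    have xA: "x = (11 + 15 * deg v) + (\<Sum>v\<in>{..<n} - insert v A. 11 + 15 * deg v)"
    proof -
      have "x = (\<Sum>v\<in>{..<n} - A. 11 + 15 * deg v)" using J unfolding pending_cost_def A_def by simp
      also have "\<dots> = (11 + 15 * deg v) + (\<Sum>v\<in>{..<n} - A - {v}. 11 + 15 * deg v)"
        using v vA by (intro sum.remove) auto
      also have "{..<n} - A - {v} = {..<n} - insert v A" by auto
      finally show ?thesis .
    qed
    have "hoare w (Ins (Add 18 6 10) ;; Ins (Load 14 18) ;; Ins (Add 10 10 1) ;;
     Ins (Add 18 4 14) ;; Ins (Load 15 18) ;; Ins (Load 16 15) ;; Ins (Add 16 16 15) ;;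
     Block dec_loop) (9 + 15 * deg v) r m
     (\<lambda>r' m'. r' 0 < r' 1 \<and> (\<exists>x'. ?J x' r' m' \<and> x' + (9 + 15 * deg v) + 2 \<le> x))"
      apply (rule hoareK)
      subgoal premises K for Y t q K
        using J v adv h bounds s br
        apply (simp add: mv static_def)
        apply (rule hoare_use[OF hoare_dec_loop[where D = D and v = v and A = A and h = "r 10"]])
              apply (simp add: base_def)
             apply simp
            apply simp
           apply simp
          apply (simp add: d)
         apply (rule v)
        apply simp
        subgoal premises p for r' m'
          apply (rule K)
           apply simp
        proof -
          have kd: "x \<notin> {11, 15, 17, 18, 19} \<Longrightarrow> x \<notin> {10, 14, 16} \<Longrightarrow> r' x = r x" "r' 10 = Suc (r 10)" for x
            using p by (simp_all add: keeps_def)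
          have dM: "dec_inv v A D (r 10) (deg v) (r' 11) m'" using p by simp
          have "base r'" using J by (simp add: base_def kd)
          moreover have "queue m' ` {..<r' 10} = insert v A"
            using dM unfolding dec_inv_def kd lessThan_Suc by auto
          ultimately show "r' 0 < r' 1 \<and> (\<exists>x'. ?J x' r' m' \<and> x' + (9 + 15 * deg v) + 2 \<le> x)"
            using J dec_inv_levelM[OF dM] xA by (auto simp: kd pending_cost_def base_def)
        qed
        done
      done
    then show "\<exists>T. T + 2 \<le> x \<and> hoare w (Ins (Add 18 6 10) ;; Ins (Load 14 18) ;; Ins (Add 10 10 1) ;;
     Ins (Add 18 4 14) ;; Ins (Load 15 18) ;; Ins (Load 16 15) ;; Ins (Add 16 16 15) ;;
     Block dec_loop) T r m (\<lambda>r' m'. r' 0 < r' 1 \<and> (\<exists>x'. ?J x' r' m' \<and> x' + T + 2 \<le> x))"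
      using xA by (intro exI[of _ "9 + 15 * deg v"]) simp
  qed (auto simp: base_def)
  then show ?thesis
  proof (rule hoare_conseq)
    show "pending_cost (r 10) m + 2 \<le> (\<Sum>v<n. 11 + 15 * deg v) + 2"
      unfolding pending_cost_def by (intro add_right_mono sum_mono2) auto
  next
    fix r' m' assume "\<not> r' 10 < r' 11 \<and> (\<exists>x. ?J x r' m')"
    then show "base r' \<and> r' 9 = D \<and> r' 10 = r' 11 \<and> level_inv (Suc D) (r' 10) 0 (r' 11) m'"
      by (auto simp: level_inv_def queue_inv_def)
  qed
qed

text \<open>Each round is charged for the whole graph. With at most \<open>d + 1\<close> rounds this
  is of order \<open>(d + 1) * (m + n)\<close>, which the final bound absorbs.\<close>

definition round_time :: nat where
  "round_time = 1 + (12 * n + 2) + ((\<Sum>v<n. 11 + 15 * deg v) + 2) + 1"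

text \<open>When the queue is exhausted, every unremoved vertex has at least \<open>D\<close>
  unremoved neighbors, so these vertices induce a subgraph of minimum degree at least
  \<open>D\<close>.\<close>

lemma level_inv_degenerate:
  assumes l: "level_inv D h 0 h m" and h: "h < n"
  shows "D \<le> d"
proof -
  let ?A = "queue m ` {..<h}"
  let ?R = "{..<n} - ?A"
  have inj: "inj_on (queue m) {..<h}" and sub: "?A \<subseteq> {..<n}" using l by (auto simp: level_inv_def queue_inv_def)
  have "card ?A = h" using inj by (simp add: card_image)
  then have "?R \<noteq> {}" using h by (metis Diff_eq_empty_iff card_lessThan card_mono finite_imageI finite_lessThan not_le)
  moreover have "D \<le> card {u \<in> ?R. {v, u} \<in> edges G}" if v: "v \<in> ?R" for v
  proof -
    have "\<not> rest_deg m v < D" using l v by (auto simp: level_inv_def)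
    moreover have "rest_deg m v = card (nbrs v - ?A)" using l v by (simp add: level_inv_def)
    moreover have "nbrs v - ?A = {u \<in> ?R. {v, u} \<in> edges G}" using v nbrs_less[of v] nbrs_iff[of v] by auto
    ultimately show ?thesis by simp
  qed
  ultimately show ?thesis
    using degenerate_min_degree[OF simple degen, of ?R D] by (auto simp: verts_eq)
qed

text \<open>\<open>d\<close> occurs in the potential only, not in the code: no round starts with a
  threshold above \<open>d\<close>, so the final value of register 9 is at most
  \<open>d + 1\<close>.\<close>

lemma hoare_peel_loop:
  assumes b: "base r" and r: "r 9 = 0" "r 10 = 0" "r 11 = 0"
    and s: "static m" "\<forall>v<n. rest_deg m v = deg v" "\<forall>x\<ge>3 * S. m x = 0"
  shows "hoare w peel_loop ((d + 1) * (round_time + 2) + 2) r m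
    (\<lambda>r' m'. base r' \<and> 1 \<le> r' 9 \<and> r' 9 \<le> d + 1 \<and> r' 9 \<le> n \<and> queue_inv n n (r' 9) m')"
proof -
  let ?J = "\<lambda>x r' m'. base r' \<and> r' 9 \<le> d + 1 \<and> r' 9 \<le> n \<and> (r' 9 = 0 \<longrightarrow> r' 11 = 0) \<and> r' 10 = r' 11 \<and>
    level_inv (r' 9) (r' 10) 0 (r' 11) m' \<and> x = (d + 1 - r' 9) * (round_time + 2)"
  have bounds: "8 * S < 2 ^ w" "n < S" using S_word n_S by auto
  have "hoare w peel_loop ((d + 1) * (round_time + 2) + 2) r m (\<lambda>r m. \<not> r 11 < r 3 \<and> (\<exists>x. ?J x r m))"
    unfolding peel_loop_def
  proof (rule hoare_while[where J = ?J and \<phi> = "\<lambda>x. x"])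
    show "?J ((d + 1) * (round_time + 2)) r m"
      using b r s by (auto simp: level_inv_def queue_inv_def deg_card)
  next
    fix x r m assume J: "?J x r m" and lt: "r 11 < r 3"
    note br = conjunct1[OF J, unfolded base_def]
    have D: "r 9 \<le> d" using level_inv_degenerate[of "r 9" "r 10" m] J lt br by auto
    then have x: "x = (d + 1 - Suc (r 9)) * (round_time + 2) + (round_time + 2)"
      using J by (simp add: Suc_diff_le)
    \<comment> \<open>Some vertex is left, and its degree bounds the threshold. This keeps
      \<open>k * D\<close> within a word no matter how large \<open>d\<close> is.\<close>
    have dS: "r 9 < n"
    proof -
      have "r 10 < n" using J lt br by auto
      moreover have "queue m ` {..<r 10} \<subseteq> {..<n}" "inj_on (queue m) {..<r 10}"
        using J by (auto simp: level_inv_def queue_inv_def)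
      ultimately obtain v where v: "v < n" "v \<notin> queue m ` {..<r 10}"
        by (metis card_image card_lessThan card_mono finite_imageI finite_lessThan lessThan_iff not_le subsetI)
      have "r 9 \<le> rest_deg m v" using J v by (auto simp: level_inv_def)
      also have "rest_deg m v \<le> card (nbrs v)" using J v by (auto simp: level_inv_def intro: card_mono)
      also have "\<dots> < n" using deg_le[OF v(1)] deg_card[OF v(1)] by simp
      finally show ?thesis .
    qed
    have "hoare w (Ins (Const 14 0) ;; Block level_loop ;; Block queue_loop ;; Ins (Add 9 9 1)) round_time r m
     (\<lambda>r' m'. r' 0 < r' 1 \<and> (\<exists>x'. ?J x' r' m' \<and> x' + round_time + 2 \<le> x))"
      apply (rule hoareK)
      subgoal premises K for Y t q K
        unfolding round_time_def
        apply simp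
        apply (rule hoare_use[OF hoare_level_loop[where D = "r 9" and h = "r 10"]])
             apply (use br in \<open>simp add: base_def\<close>)
            apply simp
           apply simp
          apply simp
         apply (use J in auto)[1]
        apply simp
        subgoal premises p for r' m'
        proof -
          have kd: "x \<notin> {11, 14, 18} \<Longrightarrow> r' x = r x" for x using p by (auto simp: keeps_def)
          have l: "level_inv (Suc (r 9)) (r' 10) 0 (r' 11) m'"
            using p level_inv_done by (auto simp: kd)
          have b': "base r'" using br by (simp add: base_def kd)
          have r9: "r' 9 = r 9" by (simp add: kd)
          show ?thesis
            apply (rule hoare_use[OF hoare_queue_loop[OF b' r9 l]])
             apply simp
            subgoal premises u for r'' m''
              using u dS bounds
              apply (simp add: base_def)
              apply (rule K)
               apply simp
              using x D dS by (auto simp: base_def)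
            done
        qed
        done
      done
    then show "\<exists>T. T + 2 \<le> x \<and> hoare w (Ins (Const 14 0) ;; Block level_loop ;; Block queue_loop ;; Ins (Add 9 9 1)) T r m
       (\<lambda>r' m'. r' 0 < r' 1 \<and> (\<exists>x'. ?J x' r' m' \<and> x' + T + 2 \<le> x))"
      using x by (intro exI[of _ round_time]) simp
  qed (auto simp: base_def)
  then show ?thesis
  proof (rule hoare_conseq)
    fix r' m' assume h: "\<not> r' 11 < r' 3 \<and> (\<exists>x. ?J x r' m')"
    then have "r' 11 = n" "r' 10 = n" by (auto simp: base_def level_inv_def queue_inv_def)
    then show "base r' \<and> 1 \<le> r' 9 \<and> r' 9 \<le> d + 1 \<and> r' 9 \<le> n \<and> queue_inv n n (r' 9) m'"
      using h n2 by (auto simp: level_inv_def)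
  qed simp
qed

end

section \<open>Sampling\<close>

text \<open>Walks the queue backwards. A number already carried by a neighbor is replaced by
  \<open>k\<close>; other numbers from \<open>k\<close> on are stored as they are and also mean no
  class.\<close>

definition sample_loop :: com where
  "sample_loop = WhileLess 0 14 (Ins (Sub 14 14 1) ;; Ins (Rand 20 12) ;; Ins (Add 18 6 14) ;;
     Ins (Load 22 18) ;; Block scan ;; IfLess 0 21 (Ins (Add 20 2 0)) Skip ;;
     Ins (Add 18 7 22) ;; Ins (Store 18 20))"

definition verdict :: com where
  "verdict = Ins (Const 24 1) ;; Ins (Const 25 0) ;; Block class_loop ;; IfLess 0 24 (Ins (Halt True)) Skip ;;
     Ins (Const 14 0) ;; Ins (Const 28 1) ;; Block odo_loop ;; IfLess 0 28 (Ins (Halt False)) Skip"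

text \<open>The test on the two constants is always true: the loop ends only through
  \<open>Halt\<close>, on success or on overflow of the counter.\<close>

definition trial_loop :: com where
  "trial_loop = WhileLess 0 1 (Ins (Const 14 0) ;; Block clear_loop ;; Ins (Add 14 3 0) ;;
     Block sample_loop ;; Block verdict)"

text \<open>The witness is assumed only for yes-instances and is arbitrary otherwise. One analysis
  then covers soundness, time and probability.\<close>

locale grundy_trial = grundy_instance +
  fixes Q :: "nat \<Rightarrow> nat" and \<Delta> :: nat and W :: "nat set" and c :: "nat \<Rightarrow> nat"
  assumes bijQ: "bij_betw Q {..<n} {..<n}"
    and outQ: "\<And>i. i < n \<Longrightarrow> card (nbrs (Q i) - Q ` {..<i}) < \<Delta>"
    and \<Delta>1: "1 \<le> \<Delta>" and \<Delta>n: "\<Delta> \<le> n"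
    and wit: "PGC_yes_instance G k \<Longrightarrow> grundy_witness G k W c"
begin

definition Y :: bool where "Y = PGC_yes_instance G k"
definition N :: nat where "N = k * \<Delta>"
definition L :: nat where "L = 2 * k ^ 2"
text \<open>The vertices that have to stay out of the classes for \<open>W\<close> to survive.
  Earlier neighbors are left out: they are drawn once the witness vertex is settled and cannot enter
  its class any more.\<close>

definition X :: "nat set" where "X = {u. u \<notin> W \<and> (\<exists>i<n. Q i \<in> W \<and> u \<in> nbrs (Q i) - Q ` {..<i})}"
definition class_of :: "(nat \<Rightarrow> nat) \<Rightarrow> nat \<Rightarrow> nat" where "class_of m v = m (4 * S + v)"

lemma k_le_N: "k \<le> N" using \<Delta>1 by (simp add: N_def)
lemma N2: "2 \<le> N" using k_le_N k2 by simp
lemma N_S: "N < S"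
proof -
  have "N \<le> n * n" unfolding N_def using n2 \<Delta>n by (intro mult_le_mono) auto
  then show ?thesis using kn_word by simp
qed

lemma static_cong: assumes "\<And>x. x < 4 * S \<Longrightarrow> m x = m' x" shows "static m \<longleftrightarrow> static m'"
proof -
  have "m (S + v) = m' (S + v)" "m (addr v) = m' (addr v)" "\<And>i. i < deg v \<Longrightarrow> m (addr v + Suc i) = m' (addr v + Suc i)"
    if "v < n" for v
    using addr_dg_less[OF that] that n_S by (intro assms; simp)+
  then show ?thesis unfolding static_def by metis
qed

section \<open>One trial: the draws and the surviving witness\<close>

definition sample_inv :: "(nat \<Rightarrow> nat) \<Rightarrow> nat \<Rightarrow> (nat \<Rightarrow> nat) \<Rightarrow> bool" where
  "sample_inv m0 j m \<longleftrightarrow> (\<forall>x. x < 4 * S \<or> 4 * S + n \<le> x \<longrightarrow> m x = m0 x) \<and> (\<forall>i<j. class_of m (Q i) = k) \<and>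
     (\<forall>u<n. \<forall>v\<in>nbrs u. class_of m u < k \<longrightarrow> class_of m v \<noteq> class_of m u)"

definition follows_witness :: "nat \<Rightarrow> (nat \<Rightarrow> nat) \<Rightarrow> bool" where
  "follows_witness j m \<longleftrightarrow> (\<forall>i. j \<le> i \<and> i < n \<longrightarrow> (Q i \<in> W \<longrightarrow> class_of m (Q i) = c (Q i)) \<and> (Q i \<in> X \<longrightarrow> k \<le> class_of m (Q i)))"

definition choice :: "nat \<Rightarrow> nat \<Rightarrow> bool" where
  "choice v x \<longleftrightarrow> (v \<in> W \<longrightarrow> x = c v) \<and> (v \<in> X \<longrightarrow> k \<le> x)"

lemma Q_less: "i < n \<Longrightarrow> Q i < n" using bijQ by (auto simp: bij_betw_def)
lemma Q_inj: "i < n \<Longrightarrow> j < n \<Longrightarrow> Q i = Q j \<longleftrightarrow> i = j" using bijQ by (auto simp: bij_betw_def inj_on_def)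
lemma Q_surj: "v < n \<Longrightarrow> \<exists>i<n. Q i = v" using bijQ unfolding bij_betw_def by (metis imageE lessThan_iff)

lemma class_of_upd [simp]: "class_of (m(4 * S + v := x)) = (class_of m)(v := x)"
  by (auto simp: class_of_def fun_eq_iff)

lemma hit_cl: "hit m v x \<longleftrightarrow> (\<exists>u\<in>nbrs v. class_of m u = x)" by (simp add: hit_def class_of_def)

lemma sample_inv_step:
  assumes s: "sample_inv m0 (Suc j) m" and j: "j < n"
  shows "sample_inv m0 j (m(4 * S + Q j := (if hit m (Q j) x then k else x)))"
proof -
  let ?y = "if hit m (Q j) x then k else x"
  have v: "Q j < n" using Q_less[OF j] .
  have "((class_of m)(Q j := ?y)) b \<noteq> ((class_of m)(Q j := ?y)) a"
    if a: "a < n" "b \<in> nbrs a" "((class_of m)(Q j := ?y)) a < k" for a b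
  proof -
    have ab: "a \<noteq> b" using nbrs_irrefl a by auto
    consider "a = Q j" | "b = Q j" "a \<noteq> Q j" | "a \<noteq> Q j" "b \<noteq> Q j" by blast
    then show ?thesis
    proof cases
      case 1
      then have "\<not> hit m (Q j) x" using a by auto
      then show ?thesis using 1 a ab by (auto simp: hit_cl)
    next
      case 2
      then have "a \<in> nbrs (Q j)" using nbrs_sym a by blast
      then show ?thesis using 2 a by (auto simp: hit_cl)
    next
      case 3
      then show ?thesis using s a by (auto simp: sample_inv_def)
    qed
  qed
  moreover have "\<forall>i<j. Q i \<noteq> Q j" using Q_inj j by auto
  ultimately show ?thesis using s v unfolding sample_inv_def by auto
qed

text \<open>A witness vertex can be blocked only by a neighbor carrying its color. Earlier neighbors
  still carry \<open>k\<close>, later ones in \<open>W\<close> have different colors as the witness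
  is properly colored, and the other later ones lie in \<open>X\<close> and carry at least
  \<open>k\<close>.\<close>

lemma follows_witness_step:
  assumes s: "sample_inv m0 (Suc j) m" and j: "j < n" and g: "follows_witness (Suc j) m" and yes: Y
    and x: "choice (Q j) x"
  shows "follows_witness j (m(4 * S + Q j := (if hit m (Q j) x then k else x)))"
proof -
  have gw: "grundy_witness G k W c" using wit yes by (simp add: Y_def)
  have v: "Q j < n" using Q_less[OF j] .
  have nh: "\<not> hit m (Q j) x" if W: "Q j \<in> W"
  proof
    assume "hit m (Q j) x"
    then obtain u where u: "u \<in> nbrs (Q j)" "class_of m u = x" by (auto simp: hit_cl)
    have xc: "x = c (Q j)" "x < k" using x W gw by (auto simp: choice_def grundy_witness_def)
    obtain i where i: "i < n" "Q i = u" using Q_surj nbrs_less[OF v u(1)] by blast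
    have "i \<noteq> j" using u nbrs_irrefl[OF v] i by auto
    then consider "i < j" | "j < i" by linarith
    then show False
    proof cases
      case 1
      then show False using s i u xc by (auto simp: sample_inv_def)
    next
      case 2
      show False
      proof (cases "u \<in> W")
        case True
        then have "c (Q j) \<noteq> c u"
          using gw W u(1) nbrs_iff[OF v] unfolding grundy_witness_def by blast
        moreover have "class_of m u = c u" using g 2 i True by (auto simp: follows_witness_def)
        ultimately show False using u xc by simp
      next
        case False
        have "u \<notin> Q ` {..<j}" using Q_inj i 2 j by (auto simp: i(2)[symmetric])
        then have "u \<in> X" using False W u j by (auto simp: X_def)
        then have "k \<le> class_of m u" using g 2 i by (auto simp: follows_witness_def)
        then show False using u xc by simp
      qed
    qed
  qed
  show ?thesis
    unfolding follows_witness_def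
  proof (intro allI impI conjI)
    fix i assume i: "j \<le> i \<and> i < n"
    show "class_of (m(4 * S + Q j := (if hit m (Q j) x then k else x))) (Q i) = c (Q i)" if "Q i \<in> W"
      using i that x nh g Q_inj[of i j] j by (cases "i = j") (auto simp: follows_witness_def choice_def)
    show "k \<le> class_of (m(4 * S + Q j := (if hit m (Q j) x then k else x))) (Q i)" if "Q i \<in> X"
      using i that x g Q_inj[of i j] j by (cases "i = j") (auto simp: follows_witness_def choice_def)
  qed
qed

definition vertex_prob :: "nat \<Rightarrow> real" where
  "vertex_prob v = (if v \<in> W then 1 / real N else if v \<in> X then (real \<Delta> - 1) / real \<Delta> else 1)"

text \<open>This explains the range \<open>k * \<Delta>\<close>: one number is the own color, and
  \<open>k * (\<Delta> - 1)\<close> numbers are at least \<open>k\<close>, a fraction of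
  \<open>1 - 1 / \<Delta>\<close>.\<close>

lemma card_choice:
  assumes Y "v < n"
  shows "real (card {x. x < N \<and> choice v x}) = vertex_prob v * real N"
proof -
  have gw: "grundy_witness G k W c" using wit assms by (simp add: Y_def)
  have N0: "real N \<noteq> 0" using N2 by simp
  consider "v \<in> W" | "v \<notin> W" "v \<in> X" | "v \<notin> W" "v \<notin> X" by blast
  then show ?thesis
  proof cases
    case 1
    then have "c v < N" "v \<notin> X" using gw k_le_N by (auto simp: grundy_witness_def X_def)
    then have "{x. x < N \<and> choice v x} = {c v}" using 1 by (auto simp: choice_def)
    then show ?thesis using 1 N0 by (simp add: vertex_prob_def)
  next
    case 2
    then have "{x. x < N \<and> choice v x} = {k..<N}" by (auto simp: choice_def)
    then have "real (card {x. x < N \<and> choice v x}) = real N - real k" using k_le_N by (simp add: of_nat_diff)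
    also have "\<dots> = (real \<Delta> - 1) / real \<Delta> * real N" using \<Delta>1 by (simp add: N_def field_simps)
    finally show ?thesis using 2 by (simp add: vertex_prob_def)
  next
    case 3
    then have "{x. x < N \<and> choice v x} = {..<N}" by (auto simp: choice_def)
    then show ?thesis using 3 by (simp add: vertex_prob_def)
  qed
qed

lemma vertex_prob_bounds: "0 \<le> vertex_prob v" "vertex_prob v \<le> 1"
  using N2 \<Delta>1 by (auto simp: vertex_prob_def)

text \<open>Sampling runs downwards, so the indices below \<open>j\<close> are the ones still to be
  drawn.\<close>

definition prefix_prob :: "nat \<Rightarrow> real" where "prefix_prob j = (\<Prod>i<j. vertex_prob (Q i))"

lemma prefix_prob_bounds: "0 \<le> prefix_prob j" "prefix_prob j \<le> 1"
  unfolding prefix_prob_def by (auto intro: prod_nonneg prod_le_1 simp: vertex_prob_bounds)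

definition vertex_cost :: "nat \<Rightarrow> nat" where "vertex_cost v = 19 + 11 * deg v"

text \<open>
  If a failed trial leaves a chance \<open>q0\<close>, and the choices so far agree with the witness, the chance of
  success is at least \<open>q0 + prefix_prob j * (1 - q0)\<close> with \<open>j\<close> vertices still to be sampled.
\<close>

definition success_bound :: "real \<Rightarrow> nat \<Rightarrow> (nat \<Rightarrow> nat) \<Rightarrow> real" where
  "success_bound q0 j m = (if Y \<and> follows_witness j m then q0 + prefix_prob j * (1 - q0) else q0)"

lemma average:
  assumes Y "j < n"
  shows "(\<Sum>x<N. if choice (Q j) x then q0 + prefix_prob j * (1 - q0) else q0) / real N = q0 + prefix_prob (Suc j) * (1 - q0)"
proof -
  have "(\<Sum>x<N. if choice (Q j) x then q0 + prefix_prob j * (1 - q0) else q0) =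
    (\<Sum>x<N. q0 + (if choice (Q j) x then prefix_prob j * (1 - q0) else 0))" by (intro sum.cong) auto
  also have "\<dots> = real N * q0 + (\<Sum>x<N. if choice (Q j) x then prefix_prob j * (1 - q0) else 0)"
    by (simp add: sum.distrib)
  also have "(\<Sum>x<N. if choice (Q j) x then prefix_prob j * (1 - q0) else 0) =
     real (card {x. x < N \<and> choice (Q j) x}) * (prefix_prob j * (1 - q0))"
    by (simp add: sum.If_cases Int_def)
  also have "\<dots> = real N * (prefix_prob (Suc j) * (1 - q0))"
    using card_choice[OF assms(1) Q_less[OF assms(2)]] by (simp add: prefix_prob_def)
  finally show ?thesis using N2 by (simp add: field_simps)
qed

text \<open>At the exit either only the chance \<open>q0\<close> of the later trials is owed, or all
  draws followed the witness and up to certainty may be owed. The induction consumes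
  \<open>prefix_prob\<close> one factor per draw.\<close>

lemma wp_sample_loop:
  assumes b: "base r0" and N: "r0 12 = N" and s0: "static m0" "\<forall>i<n. queue m0 i = Q i"
    and q0: "q0 \<le> 1"
    and K: "\<And>t' q' r' m'. t0 \<le> t' \<Longrightarrow> keeps {14, 15, 16, 17, 18, 20, 21, 22} r0 r' \<Longrightarrow> sample_inv m0 0 m' \<Longrightarrow>
      q' \<le> q0 \<or> Y \<and> follows_witness 0 m' \<and> q' \<le> 1 \<Longrightarrow> K t' q' r' m'"
  shows "j \<le> n \<Longrightarrow> keeps {14, 15, 16, 17, 18, 20, 21, 22} r0 r \<Longrightarrow> r 14 = j \<Longrightarrow> sample_inv m0 j m \<Longrightarrow>
    wp w Y sample_loop K (t0 + (\<Sum>i<j. vertex_cost (Q i)) + 2) (success_bound q0 j m) r m"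
proof (induction j arbitrary: r m)
  case 0
  have kd: "x \<notin> {14, 15, 16, 17, 18, 20, 21, 22} \<Longrightarrow> r x = r0 x" for x using 0 keepsD by blast
  show ?case
    unfolding sample_loop_def
  proof (rule wp_While)
    assume "r 0 < r 14"
    then show "wp w Y a K' t q r m" for a K' t q using 0 by simp
  next
    have "K t0 (success_bound q0 0 m) r m"
      by (rule K) (use 0 q0 in \<open>auto simp: success_bound_def prefix_prob_def\<close>)
    then show "1 < t0 + (\<Sum>i<0. vertex_cost (Q i)) + 2 \<and> r 0 < r 1 \<and> K (t0 + (\<Sum>i<0. vertex_cost (Q i)) + 2 - 2) (success_bound q0 0 m) r m"
      using b kd[of 0] kd[of 1] by (simp add: base_def)
  qed simp
next
  case (Suc j)
  have kd: "x \<notin> {14, 15, 16, 17, 18, 20, 21, 22} \<Longrightarrow> r x = r0 x" for x using Suc.prems keepsD by blast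
  have jn: "j < n" using Suc.prems by simp
  have v: "Q j < n" using Q_less[OF jn] .
  have bounds: "8 * S < 2 ^ w" "n < S" "k \<le> n" using S_word n_S n2 by auto
  have br: "base r" using b by (simp add: base_def kd)
  note brr = br[unfolded base_def]
  have rN: "r 12 = N" using N by (simp add: kd)
  have fr: "x < 4 * S \<Longrightarrow> m x = m0 x" for x using Suc.prems by (simp add: sample_inv_def)
  have st: "static m"
    using static_cong[of m m0] fr s0(1) by simp
  have mq: "m (3 * S + j) = Q j" using s0(2) fr[of "3 * S + j"] jn bounds by (simp add: queue_def)
  define T where "T = t0 + (\<Sum>i<j. vertex_cost (Q i)) + 2"
  have T: "t0 + (\<Sum>i<Suc j. vertex_cost (Q i)) + 2 = T + vertex_cost (Q j)" by (simp add: T_def)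
  \<comment> \<open>The claim made after drawing \<open>x\<close>; by \<open>average\<close> it
    averages to the claim before the draw.\<close>
  define g where "g x = (if Y \<and> follows_witness (Suc j) m \<and> choice (Q j) x then q0 + prefix_prob j * (1 - q0) else q0)" for x
  have qg: "success_bound q0 (Suc j) m \<le> (\<Sum>x<r 12. g x) / real (r 12)"
  proof (cases "Y \<and> follows_witness (Suc j) m")
    case True
    then show ?thesis using average[OF conjunct1[OF True] jn, of q0] by (simp add: success_bound_def g_def rN)
  next
    case False
    then show ?thesis using N2 by (auto simp: success_bound_def g_def rN)
  qed
  show ?case
    unfolding T sample_loop_def
  proof (rule wp_While)
    assume "r 0 < r 14"
    let ?K = "\<lambda>t q r m. 0 < t \<and> r 0 < r 1 \<and> wp w Y sample_loop K (t - 1) q r m"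
    let ?y = "\<lambda>x. if hit m (Q j) x then k else x"
    have step: "?K t (g x) r' (m(4 * S + Q j := ?y x))"
      if "keeps {14, 15, 16, 17, 18, 20, 21, 22} r0 r'" "r' 14 = j" "T + 1 \<le> t" for r' x t
    proof -
      have kd': "x \<notin> {14, 15, 16, 17, 18, 20, 21, 22} \<Longrightarrow> r' x = r0 x" for x using that keepsD by blast
      have "wp w Y sample_loop K T (success_bound q0 j (m(4 * S + Q j := ?y x))) r' (m(4 * S + Q j := ?y x))"
        unfolding T_def by (rule Suc.IH[OF less_imp_le[OF jn] that(1,2) sample_inv_step[OF Suc.prems(4) jn]])
      moreover have "g x \<le> success_bound q0 j (m(4 * S + Q j := ?y x))"
        using follows_witness_step[OF Suc.prems(4) jn, of x] q0 prefix_prob_bounds(1)[of j]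
        by (auto simp: g_def success_bound_def)
      ultimately have "wp w Y sample_loop K (t - 1) (g x) r' (m(4 * S + Q j := ?y x))"
        by (elim wp_weaken) (use that(3) in auto)
      then show ?thesis using b kd'[of 0] kd'[of 1] that(3) by (simp add: base_def)
    qed
    show "wp w Y (Ins (Sub 14 14 1) ;; Ins (Rand 20 12) ;; Ins (Add 18 6 14) ;;
     Ins (Load 22 18) ;; Block scan ;; IfLess 0 21 (Ins (Add 20 2 0)) Skip ;;
     Ins (Add 18 7 22) ;; Ins (Store 18 20))
     (\<lambda>t q r m. 0 < t \<and> r 0 < r 1 \<and> wp w Y (WhileLess 0 14 (Ins (Sub 14 14 1) ;; Ins (Rand 20 12) ;; Ins (Add 18 6 14) ;;
     Ins (Load 22 18) ;; Block scan ;; IfLess 0 21 (Ins (Add 20 2 0)) Skip ;;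
     Ins (Add 18 7 22) ;; Ins (Store 18 20))) K (t - 1) q r m) (T + vertex_cost (Q j) - 1) (success_bound q0 (Suc j) m) r m"
      unfolding sample_loop_def[symmetric]
      apply (rule vc_wp)
      using Suc.prems(3) brr
      apply (simp add: vertex_cost_def)
      apply (rule wp_Rand[where g = g])
         apply simp
        apply (use N2 rN in simp)
      subgoal premises p for x
        using p bounds jn
        apply (simp add: mq rN)
        apply (rule hoare_use[OF hoare_scan])
            apply (use br in \<open>simp add: base_def\<close>)
           apply (rule st)
          apply (simp add: v)
         apply simp
        subgoal premises u for r' m'
        proof -
          have kp: "keeps {14, 15, 16, 17, 18, 20, 21, 22} r0 r'"
            using u Suc.prems(2) by (simp add: keeps_def)
          have kd': "x \<notin> {14, 15, 16, 17, 18, 20, 21, 22} \<Longrightarrow> r' x = r0 x" for x using kp keepsD by blast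
          have b': "r' 0 = 0" "r' (Suc 0) = Suc 0" "r' 2 = k" "r' 7 = 4 * S" using b by (auto simp: base_def kd')
          have r': "r' 14 = j" "r' 20 = x" "r' 22 = Q j" "r' 21 = of_bool (hit m (Q j) x)" "m' = m"
            using u by (auto simp: keeps_def)
          have xk: "4 * S + Q j < 2 ^ w" "k < 2 ^ w" using v bounds by linarith+
          show ?thesis
          proof (cases "hit m (Q j) x")
            case True
            then show ?thesis
              using step[where x = x and r' = "r'(20 := k, 18 := 4 * S + Q j)" and t = "T + 1"] kp r' b' xk
              by simp
          next
            case False
            then show ?thesis
              using step[where x = x and r' = "r'(18 := 4 * S + Q j)" and t = "T + 1"] kp r' b' xk
              by simp
          qed
        qed
        done
      apply (use qg in simp)
      done
  next
    assume "\<not> r 0 < r 14"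
    then show "1 < T + vertex_cost (Q j) \<and> r 0 < r 1 \<and> K (T + vertex_cost (Q j) - 2) (success_bound q0 (Suc j) m) r m"
      using brr Suc.prems(3) by simp
  qed (simp add: vertex_cost_def)
qed


text \<open>The classified vertices, colored by their classes, form a witness themselves; it need
  not be \<open>W\<close>.\<close>

lemma check_sound:
  assumes s: "sample_inv m0 0 m" and ch: "\<forall>i<k. \<exists>v<n. good m i v"
  shows Y
proof -
  let ?W = "{v. v < n \<and> class_of m v < k}"
  have "grundy_witness G k ?W (class_of m)"
    unfolding grundy_witness_def
  proof (intro conjI ballI allI impI)
    show "?W \<subseteq> verts G" by (auto simp: verts_eq)
  next
    fix u v assume uv: "u \<in> ?W" "v \<in> ?W" "{u, v} \<in> edges G"
    then have "v \<in> nbrs u" using nbrs_iff by simp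
    then show "class_of m u \<noteq> class_of m v" using s uv by (fastforce simp: sample_inv_def)
  next
    fix i assume i: "i < k"
    then obtain v where v: "v < n" "class_of m v = i" "\<forall>j<i. hit m v j" using ch by (auto simp: good_def class_of_def)
    have "\<exists>u\<in>?W. {v, u} \<in> edges G \<and> class_of m u = j" if j: "j < i" for j
    proof -
      obtain u where u: "u \<in> nbrs v" "class_of m u = j" using v(3) j by (auto simp: hit_cl)
      then show ?thesis using nbrs_less[OF v(1) u(1)] nbrs_iff[OF v(1)] j i by (intro bexI[of _ u]) auto
    qed
    then show "\<exists>v\<in>?W. class_of m v = i \<and> (\<forall>j<i. \<exists>u\<in>?W. {v, u} \<in> edges G \<and> class_of m u = j)"
      using v i by (intro bexI[of _ v]) auto
  qed auto
  then show ?thesis unfolding Y_def by (rule grundy_witness_yes[OF simple, rotated]) (use k2 in simp)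
qed

lemma check_complete:
  assumes yes: Y and g: "follows_witness 0 m"
  shows "\<forall>i<k. \<exists>v<n. good m i v"
proof (intro allI impI)
  fix i assume i: "i < k"
  have gw: "grundy_witness G k W c" using wit yes by (simp add: Y_def)
  have Wc: "u < n \<and> class_of m u = c u" if u: "u \<in> W" for u
  proof -
    have un: "u < n" using gw u by (auto simp: grundy_witness_def verts_eq)
    obtain a where "a < n" "Q a = u" using Q_surj[OF un] by blast
    then show ?thesis using g u un unfolding follows_witness_def by blast
  qed
  obtain v where v: "v \<in> W" "c v = i" "\<forall>j<i. \<exists>u\<in>W. {v, u} \<in> edges G \<and> c u = j"
    using gw i unfolding grundy_witness_def by blast
  have "hit m v j" if j: "j < i" for j
  proof -
    obtain u where "u \<in> W" "{v, u} \<in> edges G" "c u = j" using v(3) j by blast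
    then show ?thesis using Wc[of u] Wc[OF v(1)] nbrs_iff[of v u] by (auto simp: hit_cl)
  qed
  then show "\<exists>v<n. good m i v" using Wc[OF v(1)] v(2) by (auto simp: good_def class_of_def)
qed

text \<open>Set to 0 for no-instances, so that \<open>1 - (1 - p)^R\<close> is a valid claim in both
  cases.\<close>

definition p :: real where "p = (if Y then prefix_prob n else 0)"

lemma p_bounds: "0 \<le> p" "p \<le> 1" using prefix_prob_bounds by (auto simp: p_def)

definition verdict_time :: nat where
  "verdict_time = 2 + (k * (6 + vertex_time) + 2) + 2 + 2 + (11 * L + 2) + 2"

definition digits :: "(nat \<Rightarrow> nat) \<Rightarrow> bool" where
  "digits m \<longleftrightarrow> (\<forall>j<L. m (5 * S + j) < N)"

lemma counter_val_less: "\<forall>j<l. m (5 * S + j) < N \<Longrightarrow> counter_val N l m < N ^ l"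
proof (induction l)
  case (Suc l)
  then have "counter_val N l m < N ^ l" and "Suc (m (5 * S + l)) \<le> N" by auto
  then have "counter_val N l m + m (5 * S + l) * N ^ l < N ^ l + m (5 * S + l) * N ^ l" by simp
  also have "\<dots> = Suc (m (5 * S + l)) * N ^ l" by simp
  also have "\<dots> \<le> N * N ^ l" using \<open>Suc (m (5 * S + l)) \<le> N\<close> by (rule mult_le_mono1)
  finally show ?case by (simp add: counter_val_def)
qed (simp add: counter_val_def)

text \<open>\<open>R\<close> counts the trials after this one, so the counter overflows exactly if
  \<open>R = 0\<close>; if the check has failed, nothing is owed then and No is a legitimate answer.
  If the draws followed the witness, the check succeeds and the machine halts with Yes.\<close>

lemma wp_verdict:
  assumes b: "base r" and r: "r 12 = N" "r 13 = L" and s: "static m" "sample_inv m0 0 m" and deg: "digits m"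
    and R: "counter_val N L m + Suc R = N ^ L"
    and q: "q \<le> 1 - (1 - p) ^ R \<or> Y \<and> follows_witness 0 m \<and> q \<le> 1"
    and K: "\<And>t' r' m'. t0 \<le> t' \<Longrightarrow> base r' \<Longrightarrow> r' 12 = N \<Longrightarrow> r' 13 = L \<Longrightarrow> (\<forall>x<5 * S. m' x = m x) \<Longrightarrow>
      digits m' \<Longrightarrow> counter_val N L m' + R = N ^ L \<Longrightarrow> q \<le> 1 - (1 - p) ^ R \<Longrightarrow> K t' q r' m'"
  shows "wp w Y verdict K (t0 + verdict_time) q r m"
proof -
  have bounds: "8 * S < 2 ^ w" "n < S" "k \<le> n" using S_word n_S n2 by auto
  have one: "Suc 0 < 2 ^ w" using bounds by linarith
  note br = b[unfolded base_def]
  have pR: "0 \<le> (1 - p) ^ R" using p_bounds by simp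
  show ?thesis
    apply (rule vc_wp)
    unfolding verdict_def
    using br one
    apply (simp add: verdict_time_def)
    apply (rule hoare_use[OF hoare_class_loop])
        apply (use br in \<open>simp add: base_def\<close>)
       apply (rule s(1))
      apply simp
     apply simp
     apply simp
    subgoal premises u for r' m'
    proof -
      have kd: "x \<notin> {15, 16, 17, 18, 20, 21, 22, 23, 24, 25, 27} \<Longrightarrow> r' x = r x" for x
        using u by (simp add: keeps_def)
      have r': "r' 24 = of_bool (\<forall>i<k. \<exists>v<n. good m i v)" "m' = m" using u by auto
      have b': "base r'" using br by (simp add: base_def kd)
      note br' = b'[unfolded base_def]
      show ?thesis
      proof (cases "\<forall>i<k. \<exists>v<n. good m i v")
        case True
        have "q \<le> 1" using q pR by auto
        then show ?thesis using True check_sound[OF s(2)] r' br' by simp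
      next
        case False
        then have q': "q \<le> 1 - (1 - p) ^ R" using q check_complete by blast
        have r24: "r' 24 = 0" using False r' by auto
        show ?thesis
          using r24 r'(2) br' one
          apply simp
          apply (rule hoare_use[OF hoare_odo_loop[where L = L and N = N]])
                   apply (use br' in \<open>simp add: base_def\<close>)
                  apply simp
                 apply simp
                apply (simp add: kd r)
               apply (simp add: kd r)
              apply (use k_word in \<open>simp add: L_def\<close>)
             apply (use N2 in simp)
            apply (use N_S in simp)
           apply (use deg in \<open>simp add: digits_def\<close>)
          apply simp
          subgoal premises z for r'' m''
          proof -
            have kd'': "x \<notin> {14, 18, 19, 28} \<Longrightarrow> r'' x = r' x" for x using z by (simp add: keeps_def)
            have b'': "base r''" using br' by (simp add: base_def kd'')
            note br'' = b''[unfolded base_def]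
            have z': "\<forall>x<5 * S. m'' x = m x" "\<forall>j<L. m'' (5 * S + j) < N" "r'' 28 \<le> 1"
              "counter_val N L m'' + r'' 28 * N ^ L = counter_val N L m + 1" using z by auto
            show ?thesis
            proof (cases "r'' 28 = 0")
              case True
              then have "counter_val N L m'' + R = N ^ L" using z' R by simp
              then show ?thesis using True br'' 
                apply simp
                apply (rule K)
                using b'' z' q' r
                by (simp_all add: kd kd'' digits_def)
            next
              case False
              then have "r'' 28 = 1" using z' by simp
              then have "R = 0" using z' R by simp
              then have "q \<le> 0" using q' by simp
              then show ?thesis using False br'' by simp
            qed
          qed
          done
      qed
    qed
    done
qed

section \<open>Repeated trials\<close>

definition trial_inv :: "nat \<Rightarrow> (nat \<Rightarrow> nat) \<Rightarrow> (nat \<Rightarrow> nat) \<Rightarrow> bool" where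
  "trial_inv R r m \<longleftrightarrow> base r \<and> r 12 = N \<and> r 13 = L \<and> static m \<and> (\<forall>i<n. queue m i = Q i) \<and> digits m \<and>
     counter_val N L m + R = N ^ L"

definition trial_time :: nat where
  "trial_time = 1 + (1 + (5 * n + 2) + 1 + ((\<Sum>i<n. vertex_cost (Q i)) + 2) + verdict_time) + 1"

lemma wp_trial_loop: "trial_inv R r m \<Longrightarrow> wp w Y trial_loop K (R * trial_time) (1 - (1 - p) ^ R) r m"
proof (induction R arbitrary: r m)
  case 0
  \<comment> \<open>With no trial left the counter would have to be \<open>N^L\<close>, which
    \<open>L\<close> digits below \<open>N\<close> cannot represent.\<close>
  then show ?case using counter_val_less[of L m] by (simp add: trial_inv_def digits_def)
next
  case (Suc R)
  have bounds: "8 * S < 2 ^ w" "n < S" "k \<le> n" using S_word n_S n2 by auto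
  have br: "base r" using Suc.prems by (simp add: trial_inv_def)
  note brr = br[unfolded base_def]
  let ?q = "1 - (1 - p) ^ R"
  \<comment> \<open>With \<open>q = 1 - (1 - p)^R\<close>, the left side is
    \<open>q + p * (1 - q)\<close>. Before the first draw \<open>follows_witness\<close> holds
    vacuously.\<close>
  have qS: "1 - (1 - p) ^ Suc R \<le> success_bound ?q n m'" for m'
    by (auto simp: success_bound_def p_def follows_witness_def algebra_simps)
  have q1: "?q \<le> 1" using p_bounds by simp
  have nw: "n < 2 ^ w" using bounds by linarith
  show ?case
    unfolding trial_loop_def
  proof (rule wp_While)
    show "0 < Suc R * trial_time" by (simp add: trial_time_def)
    show "1 < Suc R * trial_time \<and> r 0 < r 1 \<and> K (Suc R * trial_time - 2) (1 - (1 - p) ^ Suc R) r m"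
      if "\<not> r 0 < r 1" using that brr by simp
    let ?K = "\<lambda>t q r m. 0 < t \<and> r 0 < r 1 \<and> wp w Y trial_loop K (t - 1) q r m"
    show "wp w Y (Ins (Const 14 0) ;; Block clear_loop ;; Ins (Add 14 3 0) ;; Block sample_loop ;; Block verdict)
     (\<lambda>t q r m. 0 < t \<and> r 0 < r 1 \<and> wp w Y (WhileLess 0 1 (Ins (Const 14 0) ;; Block clear_loop ;; Ins (Add 14 3 0) ;;
       Block sample_loop ;; Block verdict)) K (t - 1) q r m)
     (Suc R * trial_time - 1) (1 - (1 - p) ^ Suc R) r m"
      unfolding trial_loop_def[symmetric]
      apply (rule vc_wp)
      using brr
      apply simp
      apply (rule conjI)
      subgoal by (simp add: trial_time_def)
      apply (rule hoare_use[OF hoare_clear_loop])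
         apply (use brr in \<open>simp add: base_def\<close>)
        apply simp
       apply (simp add: trial_time_def)
      subgoal premises u for r' m'
      proof -
        define m1 where "m1 = (\<lambda>x. if 4 * S \<le> x \<and> x < 4 * S + n then k else m x)"
        have m': "m' = m1" using u by (simp add: m1_def)
        have kd: "x \<notin> {14, 18} \<Longrightarrow> r' x = r x" for x using u by (simp add: keeps_def)
        have b': "base r'" using brr by (simp add: base_def kd)
        let ?r = "r'(14 := n)"
        have br1: "base ?r" using b' by (simp add: base_def)
        have lo: "x < 4 * S \<Longrightarrow> m1 x = m x" for x by (simp add: m1_def)
        have hi: "5 * S \<le> x \<Longrightarrow> m1 x = m x" for x using bounds by (auto simp: m1_def)
        have st: "static m1" using static_cong[of m1 m] lo Suc.prems by (simp add: trial_inv_def)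
        have qu1: "\<forall>i<n. queue m1 i = Q i"
          using Suc.prems lo bounds by (auto simp: trial_inv_def queue_def)
        have val1: "counter_val N L m1 = counter_val N L m" unfolding counter_val_def using hi by (intro sum.cong) auto
        have dig1: "digits m1" using Suc.prems hi by (auto simp: trial_inv_def digits_def)
        have smp: "sample_inv m1 n m1" using Q_less by (auto simp: sample_inv_def class_of_def m1_def dest: nbrs_less)
        have w: "wp w Y sample_loop (wp w Y verdict ?K)
           ((R * trial_time + 1 + verdict_time) + (\<Sum>i<n. vertex_cost (Q i)) + 2) (success_bound ?q n m1) ?r m1"
        proof (rule wp_sample_loop[where r0 = ?r and m0 = m1])
          fix t' q' r'' m''
          assume a: "R * trial_time + 1 + verdict_time \<le> t'" "keeps {14, 15, 16, 17, 18, 20, 21, 22} ?r r''"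
            "sample_inv m1 0 m''" "q' \<le> ?q \<or> Y \<and> follows_witness 0 m'' \<and> q' \<le> 1"
          have kd'': "x \<notin> {14, 15, 16, 17, 18, 20, 21, 22} \<Longrightarrow> r'' x = r' x" for x
            using a(2) by (simp add: keeps_def)
          have b'': "base r''" using b' by (simp add: base_def kd'')
          have lo2: "x < 4 * S \<Longrightarrow> m'' x = m1 x" and hi2: "5 * S \<le> x \<Longrightarrow> m'' x = m1 x" for x
            using a(3) bounds by (auto simp: sample_inv_def)
          have st2: "static m''" using static_cong[of m'' m1] lo2 st by simp
          have val2: "counter_val N L m'' = counter_val N L m1" unfolding counter_val_def using hi2 by (intro sum.cong) auto
          have dig2: "digits m''" using dig1 hi2 by (auto simp: digits_def)
          have "wp w Y verdict ?K (R * trial_time + 1 + verdict_time) q' r'' m''"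
          proof (rule wp_verdict[where R = R, OF b'' _ _ st2 a(3) dig2 _ a(4)])
            show "r'' 12 = N" "r'' 13 = L" using Suc.prems by (simp_all add: trial_inv_def kd kd'')
            show "counter_val N L m'' + Suc R = N ^ L" using Suc.prems by (simp add: trial_inv_def val1 val2)
            fix t3 r3 m3
            assume h: "R * trial_time + 1 \<le> t3" "base r3" "r3 12 = N" "r3 13 = L" "\<forall>x<5 * S. m3 x = m'' x"
              "digits m3" "counter_val N L m3 + R = N ^ L" "q' \<le> ?q"
            have "static m3" using static_cong[of m3 m''] h(5) st2 by simp
            moreover have "\<forall>i<n. queue m3 i = Q i"
            proof (intro allI impI)
              fix i assume "i < n"
              then show "queue m3 i = Q i" using qu1 h(5) lo2[of "3 * S + i"] bounds by (simp add: queue_def)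
            qed
            ultimately have "trial_inv R r3 m3" using h by (simp add: trial_inv_def)
            then have "wp w Y trial_loop K (R * trial_time) ?q r3 m3" by (rule Suc.IH)
            then have "wp w Y trial_loop K (t3 - 1) q' r3 m3" by (rule wp_weaken) (use h in auto)
            then show "0 < t3 \<and> r3 0 < r3 1 \<and> wp w Y trial_loop K (t3 - 1) q' r3 m3"
              using h by (simp add: base_def)
          qed
          then show "wp w Y verdict ?K t' q' r'' m''" by (rule wp_weaken) (use a(1) in auto)
        qed (use br1 st qu1 q1 smp Suc.prems in \<open>auto simp: trial_inv_def kd\<close>)
        have w': "wp w Y sample_loop (wp w Y verdict ?K) t (1 - (1 - p) ^ Suc R) ?r m1"
          if "(R * trial_time + 1 + verdict_time) + (\<Sum>i<n. vertex_cost (Q i)) + 2 \<le> t" for t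
          by (rule wp_weaken[OF w]) (use that qS in auto)
        show ?thesis
          using b' nw
          unfolding m'
          apply (simp add: base_def)
          apply (rule conjI)
          subgoal by (simp add: trial_time_def)
          apply (rule w'[simplified])
          apply (simp add: trial_time_def)
          done
      qed
      done
  qed
qed

text \<open>By the peeling order, each vertex of \<open>W\<close> contributes at most
  \<open>\<Delta> - 1\<close> later neighbors.\<close>

lemma card_X:
  assumes Y shows "card X \<le> (\<Delta> - 1) * card W" "W \<subseteq> {..<n}" "X \<subseteq> {..<n}"
proof -
  have gw: "grundy_witness G k W c" using wit assms by (simp add: Y_def)
  show Wn: "W \<subseteq> {..<n}" using gw by (auto simp: grundy_witness_def verts_eq)
  show "X \<subseteq> {..<n}" using nbrs_less Q_less by (auto simp: X_def)
  let ?I = "{i. i < n \<and> Q i \<in> W}"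
  have inj: "inj_on Q ?I" using Q_inj by (auto simp: inj_on_def)
  have "Q ` ?I = W" using Q_surj Wn by force
  then have cI: "card ?I = card W" using card_image[OF inj] by simp
  have "X \<subseteq> (\<Union>i\<in>?I. nbrs (Q i) - Q ` {..<i})" by (auto simp: X_def)
  then have "card X \<le> card (\<Union>i\<in>?I. nbrs (Q i) - Q ` {..<i})" by (intro card_mono) auto
  also have "\<dots> \<le> (\<Sum>i\<in>?I. card (nbrs (Q i) - Q ` {..<i}))" by (intro card_UN_le) simp
  also have "\<dots> \<le> (\<Sum>i\<in>?I. \<Delta> - 1)" using outQ by (intro sum_mono) fastforce
  finally show "card X \<le> (\<Delta> - 1) * card W" using cI by (simp add: mult.commute)
qed

lemma success_probability:
  assumes yes: Y and card: "2 * card W \<le> k ^ 2 + k"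
  shows "2 / 3 \<le> 1 - (1 - p) ^ (N ^ L)"
proof -
  have "prefix_prob n = (1 / real N) ^ card W * ((real \<Delta> - 1) / real \<Delta>) ^ card X"
    unfolding prefix_prob_def vertex_prob_def
    by (rule prod_two_sets[OF bijQ card_X(2,3)[OF yes]]) (auto simp: X_def)
  moreover have "1 / real N ^ (k ^ 2 + k) \<le> (1 / real N) ^ card W * ((real \<Delta> - 1) / real \<Delta>) ^ card X"
    unfolding N_def using trial_probability[OF \<Delta>1 _ card_X(1)[OF yes] card, of k] k2 by simp
  ultimately have "1 / real N ^ (k ^ 2 + k) \<le> p" using yes by (simp add: p_def)
  from amplification[OF k2 N2 this p_bounds(2)] show ?thesis by (simp add: L_def)
qed

end

section \<open>The program\<close>

definition main_part :: com where
  "main_part = Ins (Const 18 2) ;; Ins (Add 18 3 18) ;; Ins (Mul 4 18 18) ;; Ins (Add 5 4 4) ;;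
     Ins (Add 6 5 4) ;; Ins (Add 7 6 4) ;; Ins (Add 8 7 4) ;;
     Ins (Const 14 0) ;; Ins (Const 15 2) ;; Block init_loop ;;
     Ins (Const 9 0) ;; Ins (Const 10 0) ;; Ins (Const 11 0) ;; Block peel_loop ;;
     Ins (Mul 12 2 9) ;; Ins (Mul 13 2 2) ;; Ins (Add 13 13 13) ;; Block trial_loop"

text \<open>Register 1 contains 1, so the second test separates \<open>k = 1\<close>, where any
  vertex is a witness, from the main case.\<close>

definition pgc_program :: com where
  "pgc_program = Ins (Const 1 1) ;; Ins (Load 2 0) ;; Ins (Load 3 1) ;;
     IfLess 3 2 (Ins (Halt False)) (IfLess 1 2 (Block main_part) (Ins (Halt True)))"

context grundy_instance
begin

text \<open>\<open>trial_time\<close> freed from the order \<open>Q\<close>, which exists only after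
  peeling.\<close>

definition trial_bound :: nat where
  "trial_bound = 1 + (1 + (5 * n + 2) + 1 + ((\<Sum>v<n. 19 + 11 * deg v) + 2) +
     (2 + (k * (6 + vertex_time) + 2) + 2 + 2 + (11 * (2 * k ^ 2) + 2) + 2)) + 1"

definition main_time :: nat where
  "main_time = 9 + (10 * n + 2) + 3 + ((d + 1) * (round_time + 2) + 2) + 3 +
     (k * (d + 1)) ^ (2 * k ^ 2) * trial_bound"

end

context grundy_trial
begin

lemma wp_trials:
  assumes T: "trial_inv (N ^ L) r m" and \<Delta>d: "\<Delta> \<le> d + 1" and card: "Y \<Longrightarrow> 2 * card W \<le> k ^ 2 + k"
  shows "wp w Y trial_loop K ((k * (d + 1)) ^ (2 * k ^ 2) * trial_bound) (if Y then 2 / 3 else 0) r m"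
proof (rule wp_weaken[OF wp_trial_loop[OF T]])
  have "(\<Sum>i<n. vertex_cost (Q i)) = (\<Sum>v<n. vertex_cost v)" by (rule sum.reindex_bij_betw[OF bijQ])
  then have e: "trial_time = trial_bound"
    by (simp add: trial_time_def trial_bound_def verdict_time_def vertex_cost_def L_def)
  have "N ^ L \<le> (k * (d + 1)) ^ (2 * k ^ 2)"
    unfolding N_def L_def using \<Delta>d by (intro power_mono mult_le_mono) auto
  then show "N ^ L * trial_time \<le> (k * (d + 1)) ^ (2 * k ^ 2) * trial_bound" unfolding e by (rule mult_le_mono1)
  show "(if Y then 2 / 3 else 0) \<le> 1 - (1 - p) ^ N ^ L"
    using success_probability card p_bounds by (auto intro: power_le_one)
qed auto

end

context grundy_instance
begin

lemma wp_main_part: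
  assumes r: "r 0 = 0" "r 1 = 1" "r 2 = k" "r 3 = n" and i: "input_at m" and z: "\<forall>x\<ge>S. m x = 0"
  shows "wp w (PGC_yes_instance G k) main_part K main_time (if PGC_yes_instance G k then 2 / 3 else 0) r m"
proof -
  define yes where "yes = PGC_yes_instance G k"
  define q where "q = (if yes then 2 / 3 else 0 :: real)"
  define T where "T = (k * (d + 1)) ^ (2 * k ^ 2) * trial_bound"
  define T' where "T' = (d + 1) * (round_time + 2)"
  have bounds: "8 * S < 2 ^ w" "n < S" "k \<le> n" "2 < S" using S_word n_S n2 by auto
  have S2: "(n + 2) * (n + 2) = S" by (simp add: S_def power2_eq_square)
  obtain W c where W: "yes \<Longrightarrow> grundy_witness G k W c" "yes \<Longrightarrow> 2 * card W \<le> k ^ 2 + k"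
    using yes_grundy_witness[of G k] unfolding yes_def by metis
  have fin: "wp w yes trial_loop K t q (r'(12 := k * r' 9, 13 := k * k + k * k)) m'"
    if h: "base r'" "1 \<le> r' 9" "r' 9 \<le> d + 1" "r' 9 \<le> n" "queue_inv n n (r' 9) m'" and t: "T \<le> t" for r' m' t
  proof -
    have qs: "static m'" "\<forall>x\<ge>4 * S. m' x = 0" "inj_on (queue m') {..<n}" "queue m' ` {..<n} \<subseteq> {..<n}"
      "\<forall>i<n. card (nbrs (queue m' i) - queue m' ` {..<i}) < r' 9"
      using h(5) by (auto simp: queue_inv_def)
    have bij: "bij_betw (queue m') {..<n} {..<n}"
      unfolding bij_betw_def using qs(3,4) by (metis card_image card_subset_eq finite_lessThan)
    \<comment> \<open>The order and the degree bound are what peeling has left in the queue and in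
      register 9.\<close>
    interpret I: grundy_trial G adj k d w "queue m'" "r' 9" W c
      by unfold_locales (use bij qs h W in \<open>auto simp: yes_def\<close>)
    \<comment> \<open>Memory from \<open>4 * S\<close> on is still zero, so the counter starts at 0
      and all \<open>N^L\<close> trials remain.\<close>
    have "counter_val (k * r' 9) (2 * k ^ 2) m' = 0" using qs(2) by (simp add: counter_val_def)
    then have "I.trial_inv (I.N ^ I.L) (r'(12 := k * r' 9, 13 := k * k + k * k)) m'"
      using h(1,2) qs k2 unfolding I.trial_inv_def I.digits_def I.N_def I.L_def
      by (simp add: base_def power2_eq_square mult_2)
    from I.wp_trials[OF this h(3)] W(2) have "wp w yes trial_loop K T q (r'(12 := k * r' 9, 13 := k * k + k * k)) m'"
      by (simp add: I.Y_def yes_def T_def q_def)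
    then show ?thesis by (rule wp_weaken) (use t in auto)
  qed
  have "wp w yes main_part K (9 + (10 * n + 2) + 3 + (T' + 2) + 3 + T) q r m"
    apply (rule vc_wp)
    unfolding main_part_def
    using r bounds S2
    apply simp
    apply (rule hoare_use[OF hoare_init_loop])
         apply (simp add: base_def)
        apply simp
       apply simp
      apply (rule i)
     apply (rule z)
    apply simp
    subgoal premises u for r' m'
    proof -
      have kd: "x \<notin> {4, 5, 6, 7, 8, 14, 15, 18, 19} \<Longrightarrow> r' x = r x" for x
        using u by (simp add: keeps_def)
      have b': "base r'" using u by (simp add: base_def keeps_def)
      have m': "static m'" "\<forall>v<n. rest_deg m' v = deg v" "\<forall>x\<ge>3 * S. m' x = 0" using u by auto
      show ?thesis
        using bounds
        apply simp
        apply (rule hoare_use[OF hoare_peel_loop[OF _ _ _ _ m', folded T'_def]])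
             apply (use b' in \<open>simp add: base_def\<close>)
            apply simp
           apply simp
          apply simp
         apply simp
        subgoal premises v for r'' m''
        proof -
          have v: "base r''" "1 \<le> r'' 9" "r'' 9 \<le> d + 1" "r'' 9 \<le> n" "queue_inv n n (r'' 9) m''" using v by auto
          have "k * r'' 9 \<le> n * n" "k * k \<le> n * n" using v(4) bounds by (auto intro: mult_le_mono)
          then have "k * r'' 9 < 2 ^ w" "k * k < 2 ^ w" "k * k + k * k < 2 ^ w"
            using kn_word bounds by linarith+
          then show ?thesis
            using v(1) fin[OF v] by (simp add: base_def)
        qed
        done
    qed
    done
  then show ?thesis by (simp add: main_time_def T_def T'_def q_def yes_def)
qed

section \<open>The overall time bound\<close>

lemma vertex_time_le: "vertex_time \<le> 40 * (k * (card (edges G) + n))"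
proof -
  have "vertex_time = 15 * n + 13 * (k * n) + 11 * (k * (\<Sum>v<n. deg v)) + 2"
    unfolding vertex_time_def
    by (simp add: sum.distrib sum_distrib_left algebra_simps)
  moreover have "k * (\<Sum>v<n. deg v) \<le> k * (2 * card (edges G))" using sum_dg by simp
  moreover have "2 * n \<le> k * n" using k2 by simp
  moreover have "2 \<le> n" using n2 by simp
  moreover have "k * (2 * card (edges G)) = 2 * (k * card (edges G))" by simp
  moreover have "k * (card (edges G) + n) = k * card (edges G) + k * n" by (rule distrib_left)
  ultimately show ?thesis by linarith
qed

text \<open>One trial costs of order \<open>k^2 * (m + n)\<close>. Since
  \<open>k^2 <= 2 * 2^k\<close>, the factor \<open>k^2\<close> is at most twice the
  \<open>k\<close>-th power of \<open>k * (d + 1)\<close>; this is the summand \<open>k\<close> in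
  the exponent.\<close>

lemma main_time_le:
  "main_time \<le> 400 * ((k * (d + 1)) ^ (2 * k ^ 2 + k) * max 1 (card (edges G) + n))"
proof -
  define E where "E = card (edges G) + n"
  let ?N = "k * (d + 1)"
  have E2: "2 \<le> E" using n2 by (simp add: E_def)
  define s where "s = (\<Sum>v<n. deg v)"
  have sum: "s \<le> 2 * card (edges G)" unfolding s_def by (rule sum_dg)
  have kE: "E \<le> k ^ 2 * E" "k ^ 2 \<le> k ^ 2 * E" "k \<le> k ^ 2" using k2 E2 by (auto simp: power2_eq_square)
  have s1: "(\<Sum>v<n. 11 + 15 * deg v) = 11 * n + 15 * s" by (simp add: s_def sum.distrib sum_distrib_left)
  have rt: "round_time + 2 \<le> 40 * E" unfolding E_def round_time_def s1 distrib_left using sum n2(1) by (simp del: One_nat_def)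
  have s2: "(\<Sum>v<n. 19 + 11 * deg v) = 19 * n + 11 * s" by (simp add: s_def sum.distrib sum_distrib_left)
  have t: "trial_bound \<le> 20 + 24 * E + k * (6 + vertex_time) + 22 * k ^ 2"
    unfolding E_def trial_bound_def s2 distrib_left using sum by (simp del: One_nat_def)
  have "k * (6 + vertex_time) \<le> k * (6 + 40 * (k * E))" using vertex_time_le by (simp add: E_def)
  also have "k * (6 + 40 * (k * E)) = 6 * k + 40 * (k ^ 2 * E)" by (simp add: power2_eq_square algebra_simps)
  finally have v: "k * (6 + vertex_time) \<le> 6 * k + 40 * (k ^ 2 * E)" .
  have tb: "trial_bound \<le> 110 * (k ^ 2 * E)" using t v kE E2 by linarith
  have N2: "2 \<le> ?N" using k2 by simp
  have k2k: "k ^ 2 \<le> 2 * 2 ^ k"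
  proof (induction k)
    case (Suc j)
    show ?case
    proof (cases "3 \<le> j")
      case True
      then have "3 * j \<le> j * j" by simp
      moreover have "Suc j ^ 2 = j * j + 2 * j + 1" "j ^ 2 = j * j" by (simp_all add: power2_eq_square)
      ultimately have "Suc j ^ 2 \<le> 2 * j ^ 2" using True by linarith
      then show ?thesis using Suc by simp
    next
      case False
      then have "j = 0 \<or> j = 1 \<or> j = 2" by auto
      then show ?thesis by (auto simp: power2_eq_square)
    qed
  qed simp
  also have "2 * 2 ^ k \<le> 2 * ?N ^ k" using N2 by (simp add: power_mono)
  finally have kN: "k ^ 2 \<le> 2 * ?N ^ k" .
  define P where "P = ?N ^ (2 * k ^ 2 + k)"
  have "?N ^ (2 * k ^ 2) * trial_bound \<le> ?N ^ (2 * k ^ 2) * (110 * ((2 * ?N ^ k) * E))"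
    by (intro mult_left_mono order_trans[OF tb] mult_right_mono kN) auto
  also have "\<dots> = 220 * (P * E)" by (simp add: P_def power_add algebra_simps)
  finally have A: "?N ^ (2 * k ^ 2) * trial_bound \<le> 220 * (P * E)" .
  have "?N ^ 1 \<le> P" unfolding P_def using N2 k2 by (intro power_increasing) auto
  then have NP: "?N \<le> P" by simp
  have "1 * (d + 1) \<le> ?N" using k2 by (intro mult_le_mono1) simp
  then have "(d + 1) * (round_time + 2) \<le> ?N * (40 * E)" using rt by (intro mult_le_mono) simp_all
  also have "\<dots> \<le> P * (40 * E)" using NP by (intro mult_le_mono1)
  finally have B: "(d + 1) * (round_time + 2) \<le> 40 * (P * E)" by (simp add: algebra_simps)
  have C: "E \<le> P * E" using NP N2 by (metis le_trans mult_le_mono1 nat_mult_1 one_le_numeral)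
  have "n \<le> E" by (simp add: E_def)
  have "main_time \<le> 19 + 10 * n + 40 * (P * E) + 220 * (P * E)"
    unfolding main_time_def using A B by linarith
  also have "\<dots> \<le> 400 * (P * E)" using C E2 \<open>n \<le> E\<close> by linarith
  also have "E = max 1 (card (edges G) + n)" using E2 by (simp add: E_def)
  finally show ?thesis by (simp only: P_def)
qed

end

section \<open>Input encoding, trivial instances and the final assembly\<close>

lemma concat_encoding_split:
  assumes "v < length adj"
  shows "concat (map (\<lambda>us. length us # us) adj) =
    concat (map (\<lambda>us. length us # us) (take v adj)) @ (length (adj ! v) # adj ! v) @
    concat (map (\<lambda>us. length us # us) (drop (Suc v) adj))"
  by (subst id_take_nth_drop[OF assms]) simp

lemma length_concat_encoding_take:
  "v \<le> length adj \<Longrightarrow> length (concat (map (\<lambda>us. length us # us) (take v adj))) = (\<Sum>u<v. Suc (length (adj ! u)))"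
  by (induction v) (auto simp: take_Suc_conv_app_nth)

context grundy_instance
begin

lemma input_layout:
  fixes m defines "xs \<equiv> encode_instance adj k"
  defines "m \<equiv> \<lambda>i. if i < length xs then xs ! i else 0"
  shows "input_at m" "\<forall>x\<ge>S. m x = 0"
proof -
  let ?f = "\<lambda>us. length us # us"
  have xs: "xs = k # n # concat (map ?f adj)" by (simp add: xs_def encode_instance_def n_def)
  have len: "length xs = addr n"
    using length_concat_encoding_take[of n adj] by (simp add: xs addr_def deg_def n_def)
  show "\<forall>x\<ge>S. m x = 0" using addr_bound[of n] by (auto simp: m_def len)
  show "input_at m"
    unfolding input_at_def
  proof (intro allI impI)
    fix v assume v: "v < n"
    let ?p = "concat (map ?f (take v adj))"
    have lp: "2 + length ?p = addr v"
      using length_concat_encoding_take[of v adj] v by (simp add: addr_def deg_def n_def)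
    have x: "xs = (k # n # ?p) @ (deg v # adj ! v) @ concat (map ?f (drop (Suc v) adj))"
      unfolding xs using concat_encoding_split[of v adj] v by (simp add: n_def deg_def)
    have nth: "xs ! (addr v + j) = (deg v # adj ! v) ! j \<and> addr v + j < length xs" if "j < Suc (deg v)" for j
    proof -
      have l: "length (k # n # ?p) = addr v" using lp by simp
      have "xs ! (addr v + j) = ((deg v # adj ! v) @ concat (map ?f (drop (Suc v) adj))) ! j"
        unfolding x using nth_append_length_plus[of "k # n # ?p"] l by metis
      also have "\<dots> = (deg v # adj ! v) ! j" using that by (simp only: nth_append) (simp add: deg_def)
      finally have "xs ! (addr v + j) = (deg v # adj ! v) ! j" .
      moreover have "addr v + j < length xs"
        using that unfolding x by (subst length_append, subst l) (simp add: deg_def)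
      ultimately show ?thesis by blast
    qed
    show "m (addr v) = deg v \<and> (\<forall>i<deg v. m (addr v + Suc i) = adj ! v ! i)"
    proof (intro conjI allI impI)
      show "m (addr v) = deg v" using nth[of 0] by (simp add: m_def)
      fix i assume "i < deg v"
      then show "m (addr v + Suc i) = adj ! v ! i" using nth[of "Suc i"] by (simp add: m_def)
    qed
  qed
qed

end

lemma too_few_vertices_no:
  assumes "simple_graph G" "card (verts G) < k"
  shows "\<not> PGC_yes_instance G k"
proof
  assume "PGC_yes_instance G k"
  then obtain k' c where k': "k \<le> k'" "partial_grundy_coloring G k' c" by (auto simp: PGC_yes_instance_def)
  have "i \<in> c ` verts G" if i: "i \<in> {1..k'}" for i
  proof -
    obtain v where "v \<in> verts G" "c v = i" using k'(2) i unfolding partial_grundy_coloring_def by blast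
    then show ?thesis by blast
  qed
  then have "{1..k'} \<subseteq> c ` verts G" by blast
  then have "card {1..k'} \<le> card (verts G)"
    using assms(1) by (meson card_image_le card_mono finite_imageI order_trans simple_graph_def)
  then show False using assms(2) k' by simp
qed

lemma one_color_yes:
  assumes "simple_graph G" "verts G \<noteq> {}"
  shows "PGC_yes_instance G 1"
proof -
  obtain v where v: "v \<in> verts G" using assms(2) by blast
  have "{v} \<notin> edges G" using assms(1) by (auto simp: simple_graph_def)
  then have "grundy_witness G 1 {v} (\<lambda>_. 0)" using v by (auto simp: grundy_witness_def)
  then show ?thesis using grundy_witness_yes[OF assms(1)] by simp
qed

lemma pgc_program_correct:
  assumes G: "simple_graph G" and adj: "adjacency_lists G adj" and k: "1 \<le> k" and d: "degenerate d G"
    and word: "(card (verts G) + card (edges G) + k + 2) ^ 4 \<le> (2::nat) ^ w"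
    and T: "T = 405 * ((k * (d + 1)) ^ (2 * k ^ 2 + k) * max 1 (card (edges G) + card (verts G)))"
  shows "ok w (PGC_yes_instance G k) (compile pgc_program 0) T
    (if PGC_yes_instance G k then 2 / 3 else 0) (start (encode_instance adj k))"
proof -
  let ?Y = "PGC_yes_instance G k"
  let ?q = "if ?Y then 2 / 3 else 0 :: real"
  define m where "m = (\<lambda>i. if i < length (encode_instance adj k) then encode_instance adj k ! i else 0)"
  have n: "card (verts G) = length adj" "verts G = {..<length adj}" using adj by (auto simp: adjacency_lists_def)
  have m0: "m 0 = k" "m (Suc 0) = length adj" by (auto simp: m_def encode_instance_def)
  have w1: "Suc 0 < 2 ^ w"
  proof -
    have "2 ^ 4 \<le> (card (verts G) + card (edges G) + k + 2) ^ 4" by (intro power_mono) auto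
    also note word
    finally have "16 \<le> (2::nat) ^ w" by simp
    then show ?thesis by linarith
  qed
  have pos: "1 \<le> (k * (d + 1)) ^ (2 * k ^ 2 + k) * max 1 (card (edges G) + card (verts G))"
    using k by simp
  then have T9: "405 \<le> T" unfolding T by linarith
  \<comment> \<open>The continuation is false: every path has to halt, none may run off the end of
    the code.\<close>
  have "vc w ?Y pgc_program (\<lambda>_ _ _ _. False) T ?q (\<lambda>_. 0) m"
  proof (cases "length adj < k")
    case True
    then have "\<not> ?Y" using too_few_vertices_no[OF G] n by simp
    then show ?thesis using True m0 w1 T9 by (simp add: pgc_program_def)
  next
    case False
    show ?thesis
    proof (cases "k = 1")
      case True
      then have ?Y using one_color_yes[OF G] n False by auto
      then show ?thesis using True False m0 w1 T9 by (simp add: pgc_program_def)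
    next
      case k1: False
      interpret grundy_instance G adj k d w
        by unfold_locales (use G adj k k1 False d word n in auto)
      have lay: "input_at m" "\<forall>x\<ge>S. m x = 0" using input_layout unfolding m_def by auto
      \<comment> \<open>Five instructions precede \<open>main_part\<close>; they account for the
        difference between the constants 405 and 400.\<close>
      have le: "main_time \<le> T - 5"
        using main_time_le pos unfolding T n(1) n_def by linarith
      have "wp w ?Y main_part K (T - Suc (Suc (Suc (Suc (Suc 0))))) ?q ((\<lambda>_. 0)(Suc 0 := Suc 0, 2 := k, 3 := length adj)) m" for K
        by (rule wp_weaken[OF wp_main_part[OF _ _ _ _ lay]]) (use le in \<open>auto simp: n_def\<close>)
      then show ?thesis using k k1 False m0 w1 T9 by (cases ?Y) (simp_all add: pgc_program_def)
    qed
  qed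
  then have "wp w ?Y pgc_program (\<lambda>_ _ _ _. False) T ?q (\<lambda>_. 0) m" by (rule vc_wp)
  moreover have "code_at (compile pgc_program 0) 0 (compile pgc_program 0)" by (simp add: code_at_def)
  ultimately show ?thesis unfolding wp_def start_def m_def by blast
qed

text \<open>The number \<open>d\<close> is not part of the input, so the time bound holds for every
  \<open>d\<close> for which the graph is degenerate. The maximum with 1 covers the empty
  graph.\<close>

theorem theorem15:
  "\<exists>(P :: instr list) (C :: nat) (c :: nat).
     \<forall>(G :: nat graph) (adj :: nat list list) (k :: nat) (d :: nat) (w :: nat) (n :: nat) (m :: nat) (T :: nat).
       simple_graph G \<and> adjacency_lists G adj \<and> k \<ge> 1 \<and> degenerate d G \<and>
       n = card (verts G) \<and> m = card (edges G) \<and>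
       (n + m + k + 2) ^ c \<le> 2 ^ w \<and>
       T = C * ((k * (d + 1)) ^ (2 * k ^ 2 + k) * max 1 (m + n)) \<longrightarrow>
         halts_within w P (encode_instance adj k) T \<and>
         (\<not> PGC_yes_instance G k \<longrightarrow> prob_answer w P (encode_instance adj k) T False = 1) \<and>
         (PGC_yes_instance G k \<longrightarrow> prob_answer w P (encode_instance adj k) T True \<ge> 2 / 3)"
proof (intro exI allI impI)
  fix G :: "nat graph" and adj k d w n m T
  let ?P = "compile pgc_program 0"
  assume h: "simple_graph G \<and> adjacency_lists G adj \<and> k \<ge> 1 \<and> degenerate d G \<and>
       n = card (verts G) \<and> m = card (edges G) \<and>
       (n + m + k + 2) ^ 4 \<le> 2 ^ w \<and>
       T = 405 * ((k * (d + 1)) ^ (2 * k ^ 2 + k) * max 1 (m + n))"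
  let ?R = "run w ?P T (start (encode_instance adj k))"
  have "ok w (PGC_yes_instance G k) ?P T (if PGC_yes_instance G k then 2 / 3 else 0) (start (encode_instance adj k))"
    by (rule pgc_program_correct[where d = d]) (use h in auto)
  then have A: "\<forall>s\<in>set_pmf ?R. \<exists>b. s = Halted b \<and> (b \<longrightarrow> PGC_yes_instance G k)"
    and B: "(if PGC_yes_instance G k then 2 / 3 else 0) \<le> pmf ?R (Halted True)"
    unfolding ok_def by blast+
  have "prob_answer w ?P (encode_instance adj k) T False = 1" if no: "\<not> PGC_yes_instance G k"
  proof -
    have "\<forall>s\<in>set_pmf ?R. s = Halted False" using A no by (metis (full_types))
    then show ?thesis unfolding prob_answer_def by (simp add: measure_pmf.prob_eq_1 AE_measure_pmf_iff)
  qed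
  moreover have "2 / 3 \<le> prob_answer w ?P (encode_instance adj k) T True" if "PGC_yes_instance G k"
    using B that by (simp add: prob_answer_def measure_pmf_single)
  moreover have "halts_within w ?P (encode_instance adj k) T"
    unfolding halts_within_def using A by blast
  ultimately show "halts_within w ?P (encode_instance adj k) T \<and>
     (\<not> PGC_yes_instance G k \<longrightarrow> prob_answer w ?P (encode_instance adj k) T False = 1) \<and>
     (PGC_yes_instance G k \<longrightarrow> prob_answer w ?P (encode_instance adj k) T True \<ge> 2 / 3)" by blast
qed

end
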